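(* The map $$(\sigma,x)\in\mathrm{Gal}(k^s/k)\times\mathbb{A}^{1,\mathrm{an}}_{\widehat{k^a}}\longmapsto\sigma(x)\in\mathbb{A}^{1,\mathrm{an}}_{\widehat{k^a}}$$ is continuous and proper. The projection map $\pi_{\widehat{k^a}/k}\colon \mathbb{A}^{1,\mathrm{an}}_{\widehat{k^a}}\to\mathbb{A}^{1,\mathrm{an}}_k$ induces a homeomorphism $$\mathbb{A}^{1,\mathrm{an}}_{\widehat{k^a}}/\mathrm{Gal}(k^s/k)\xrightarrow{\ \sim\ }\mathbb{A}^{1,\mathrm{an}}_k.$$ In particular, $\pi_{\widehat{k^a}/k}$ is continuous, proper, open and surjective.
   Context: $(k,|\cdot|)$ is a complete non-Archimedean valued field, $k^s$ a separable closure of $k$, $k^a$ the corresponding algebraic closure with the unique extension of $|\cdot|$, and $\widehat{k^a}$ the completion of $k^a$ (it coincides with the completion of $k^s$). For a complete valued field $K$, the Berkovich affine line $\mathbb{A}^{1,\mathrm{an}}_K$ is the set of multiplicative seminorms $|\cdot|_x$ on $K[T]$ inducing the given absolute value on $K$, with the coarsest topology making all maps $x\mapsto|P|_x$ ($P\in K[T]$) continuous. For a complete valued extension $K$ of $k$, the projection $\pi_{K/k}\colon\mathbb{A}^{1,\mathrm{an}}_K\to\mathbb{A}^{1,\mathrm{an}}_k$ is the restriction of seminorms along $k[T]\to K[T]$. Every $\sigma\in\mathrm{Gal}(k^s/k)$ preserves the absolute value and extends by continuity to an automorphism of $\widehat{k^a}$, acting on $\widehat{k^a}[T]$ coefficientwise;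 for $x\in\mathbb{A}^{1,\mathrm{an}}_{\widehat{k^a}}$, $\sigma(x)$ is the point given by the seminorm $P\mapsto|\sigma(P)|_x$. $\mathrm{Gal}(k^s/k)$ carries its profinite topology. *)

theory Defs
  imports "Jordan_Normal_Form.Matrix" "HOL-Analysis.Analysis"
begin

section \<open>Non-Archimedean valued fields\<close>

text \<open>The trivial absolute value is allowed.\<close>

locale nonarch_abs_value =
  fixes v :: "'a::field \<Rightarrow> real"
  assumes nonneg: "0 \<le> v x"
    and eq_0_iff: "v x = 0 \<longleftrightarrow> x = 0"
    and mult: "v (x * y) = v x * v y"
    and ultrametric: "v (x + y) \<le> max (v x) (v y)"

definition valued_field_topology :: "('a::field \<Rightarrow> real) \<Rightarrow> 'a topology"
  where "valued_field_topology v = Metric_space.mtopology UNIV (\<lambda>x y. v (x - y))"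

locale complete_nonarch_field = nonarch_abs_value +
  assumes complete: "Metric_space.mcomplete UNIV (\<lambda>x y. v (x - y))"

text \<open>A completion is an isometric embedding with dense image into a complete valued field; this
  determines it up to a unique isometric isomorphism.\<close>

definition is_completion ::
    "('a::field \<Rightarrow> real) \<Rightarrow> ('c::field \<Rightarrow> real) \<Rightarrow> ('a \<Rightarrow> 'c) \<Rightarrow> bool"
  where "is_completion v w e \<longleftrightarrow>
    complete_nonarch_field w \<and> field_hom e \<and> (\<forall>x. w (e x) = v x) \<and>
    valued_field_topology w closure_of range e = UNIV"


section \<open>Field extensions and Galois groups\<close>

text \<open>A field extension is given by its embedding \<open>i\<close>.\<close>

definition is_algebraic_extension :: "('k::field \<Rightarrow> 'l::field) \<Rightarrow> bool"
  where "is_algebraic_extension i \<longleftrightarrow>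
    field_hom i \<and> (\<forall>x. \<exists>p. p \<noteq> 0 \<and> poly (map_poly i p) x = 0)"

definition is_algebraic_closure :: "('k::field \<Rightarrow> 'l::alg_closed_field) \<Rightarrow> bool"
  where "is_algebraic_closure i \<longleftrightarrow> is_algebraic_extension i"

definition separable_poly :: "'k::field poly \<Rightarrow> bool"
  where "separable_poly p \<longleftrightarrow> coprime p (pderiv p)"

text \<open>Up to a unit, the irreducible \<open>p\<close> below is the minimal polynomial of \<open>x\<close>.\<close>

definition is_separable_extension :: "('k::field \<Rightarrow> 'l::field) \<Rightarrow> bool"
  where "is_separable_extension i \<longleftrightarrow>
    field_hom i \<and>
    (\<forall>x. \<exists>p. irreducible p \<and> separable_poly p \<and> poly (map_poly i p) x = 0)"

definition is_separable_closure :: "('k::field \<Rightarrow> 'l::field) \<Rightarrow> bool"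
  where "is_separable_closure i \<longleftrightarrow>
    is_separable_extension i \<and>
    (\<forall>p :: 'l poly. 0 < degree p \<and> separable_poly p \<longrightarrow> (\<exists>x. poly p x = 0))"

definition galois_group :: "('k::field \<Rightarrow> 's::field) \<Rightarrow> ('s \<Rightarrow> 's) set"
  where "galois_group i = {\<sigma>. field_hom \<sigma> \<and> bij \<sigma> \<and> (\<forall>a. \<sigma> (i a) = i a)}"

definition finite_subextension :: "('k::field \<Rightarrow> 's::field) \<Rightarrow> 's set \<Rightarrow> bool"
  where "finite_subextension i L \<longleftrightarrow>
    range i \<subseteq> L \<and> (\<forall>x\<in>L. \<forall>y\<in>L. x - y \<in> L \<and> x * y \<in> L \<and> inverse x \<in> L) \<and>
    (\<exists>B. finite B \<and> L = {\<Sum>b\<in>B. i (c b) * b | c. True})"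

text \<open>The profinite (Krull) topology: the cosets \<open>\<sigma> Gal(s/L)\<close>, for \<open>L/k\<close> finite, are a subbasis
  (indeed a basis).\<close>

definition galois_topology :: "('k::field \<Rightarrow> 's::field) \<Rightarrow> ('s \<Rightarrow> 's) topology"
  where "galois_topology i = topology_generated_by
    {{\<tau> \<in> galois_group i. \<forall>x\<in>L. \<tau> x = \<sigma> x} | \<sigma> L. \<sigma> \<in> galois_group i \<and> finite_subextension i L}"

text \<open>The extension of \<open>\<sigma>\<close> to a continuous automorphism of the completion \<open>c\<close> of the algebraic
  closure, with \<open>e\<close> the embedding of the separable closure into \<open>c\<close>. Unless the absolute value is
  trivial, the image of \<open>e\<close> is dense and this is the extension by continuity; if it is trivial,
  then \<open>c\<close> is purely inseparable over the image of \<open>e\<close>, and uniqueness comes from requiring a field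
  automorphism.\<close>

definition galois_extend ::
    "('c::field \<Rightarrow> real) \<Rightarrow> ('s::field \<Rightarrow> 'c) \<Rightarrow> ('s \<Rightarrow> 's) \<Rightarrow> 'c \<Rightarrow> 'c"
  where "galois_extend v e \<sigma> = (THE \<tau>. field_hom \<tau> \<and> bij \<tau> \<and>
    continuous_map (valued_field_topology v) (valued_field_topology v) \<tau> \<and>
    (\<forall>x. \<tau> (e x) = e (\<sigma> x)))"


section \<open>The Berkovich affine line\<close>

text \<open>The last condition includes \<open>x 0 = 0\<close> and \<open>x 1 = 1\<close>.\<close>

definition berkovich_points :: "('c::field \<Rightarrow> real) \<Rightarrow> ('c poly \<Rightarrow> real) set"
  where "berkovich_points v = {x.
    (\<forall>P. 0 \<le> x P) \<and> (\<forall>P Q. x (P + Q) \<le> x P + x Q) \<and> (\<forall>P Q. x (P * Q) = x P * x Q) \<and>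
    (\<forall>a. x [:a:] = v a)}"

definition berkovich_line :: "('c::field \<Rightarrow> real) \<Rightarrow> ('c poly \<Rightarrow> real) topology"
  where "berkovich_line v = topology_generated_by
    {{x \<in> berkovich_points v. x P \<in> U} | P U. open U}"

lemma topspace_berkovich_line: "topspace (berkovich_line v) = berkovich_points v"
  unfolding berkovich_line_def topology_generated_by_topspace by (auto intro: open_UNIV)

definition berkovich_projection ::
    "('k::field \<Rightarrow> 'c::field) \<Rightarrow> ('c poly \<Rightarrow> real) \<Rightarrow> 'k poly \<Rightarrow> real"
  where "berkovich_projection \<iota> x = (\<lambda>P. x (map_poly \<iota> P))"

definition galois_act ::
    "('c::field \<Rightarrow> real) \<Rightarrow> ('s::field \<Rightarrow> 'c) \<Rightarrow> ('s \<Rightarrow> 's) \<Rightarrow> ('c poly \<Rightarrow> real) \<Rightarrow> 'c poly \<Rightarrow> real"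
  where "galois_act v e \<sigma> x = (\<lambda>P. x (map_poly (galois_extend v e \<sigma>) P))"

definition galois_orbit ::
    "('k::field \<Rightarrow> 's::field) \<Rightarrow> ('c::field \<Rightarrow> real) \<Rightarrow> ('s \<Rightarrow> 'c) \<Rightarrow> ('c poly \<Rightarrow> real) \<Rightarrow> ('c poly \<Rightarrow> real) set"
  where "galois_orbit i v e x = (\<lambda>\<sigma>. galois_act v e \<sigma> x) ` galois_group i"


section \<open>Quotient spaces\<close>

definition quotient_topology :: "'a topology \<Rightarrow> ('a \<Rightarrow> 'b) \<Rightarrow> 'b topology"
  where "quotient_topology X q =
    topology (\<lambda>U. U \<subseteq> q ` topspace X \<and> openin X {x \<in> topspace X. q x \<in> U})"

lemma openin_quotient_topology:
  "openin (quotient_topology X q) U \<longleftrightarrow>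
    U \<subseteq> q ` topspace X \<and> openin X {x \<in> topspace X. q x \<in> U}"
proof -
  have "istopology (\<lambda>U. U \<subseteq> q ` topspace X \<and> openin X {x \<in> topspace X. q x \<in> U})"
    unfolding istopology_def
  proof (intro conjI allI impI)
    fix S T
    assume "S \<subseteq> q ` topspace X \<and> openin X {x \<in> topspace X. q x \<in> S}"
      and "T \<subseteq> q ` topspace X \<and> openin X {x \<in> topspace X. q x \<in> T}"
    moreover have "{x \<in> topspace X. q x \<in> S \<inter> T} =
        {x \<in> topspace X. q x \<in> S} \<inter> {x \<in> topspace X. q x \<in> T}"
      by auto
    ultimately show "S \<inter> T \<subseteq> q ` topspace X" "openin X {x \<in> topspace X. q x \<in> S \<inter> T}"
      by auto
  next
    fix \<K>
    assume K: "\<forall>K\<in>\<K>. K \<subseteq> q ` topspace X \<and> openin X {x \<in> topspace X. q x \<in> K}"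
    have "{x \<in> topspace X. q x \<in> \<Union>\<K>} = (\<Union>K\<in>\<K>. {x \<in> topspace X. q x \<in> K})"
      by auto
    with K show "\<Union>\<K> \<subseteq> q ` topspace X" "openin X {x \<in> topspace X. q x \<in> \<Union>\<K>}"
      by auto
  qed
  then show ?thesis
    unfolding quotient_topology_def by (simp add: topology_inverse')
qed

lemma topspace_quotient_topology: "topspace (quotient_topology X q) = q ` topspace X"
proof
  show "topspace (quotient_topology X q) \<subseteq> q ` topspace X"
    using openin_quotient_topology[of X q] openin_topspace by blast
  have "{x \<in> topspace X. q x \<in> q ` topspace X} = topspace X"
    by auto
  then have "openin (quotient_topology X q) (q ` topspace X)"
    by (simp add: openin_quotient_topology)
  then show "q ` topspace X \<subseteq> topspace (quotient_topology X q)"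
    by (rule openin_subset)
qed

lemma quotient_map_quotient_topology: "quotient_map X (quotient_topology X q) q"
  by (auto simp: quotient_map_def topspace_quotient_topology openin_quotient_topology)

end

theory Submission
  imports Defs "Jordan_Normal_Form.Char_Poly" "HOL-Computational_Algebra.Computational_Algebra"
begin

text \<open>
  Write \<open>A_K\<close> for the line over \<open>K\<close>, \<open>G\<close> for the Galois group, \<open>C\<close> for the completed algebraic closure,
  \<open>T\<close> for the variable, and \<open>\<pi>\<close> for the projection from \<open>A_C\<close> to \<open>A_k\<close>.

  The topological claims follow from compactness once \<open>\<pi>\<close> is known to be surjective with the orbits
  of \<open>G\<close> as fibres. A point satisfies \<open>x(P) \<le> \<Sum>|a_i| x(T)^i\<close> for \<open>P = \<Sum>a_i T^i\<close>, so by Tychonoff's theorem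
  the balls \<open>x(T) \<le> r\<close> are compact (\<open>compactin_ball\<close>), and a continuous map into a line is proper as soon
  as the preimages of balls are compact (\<open>proper_map_into_berkovich_line\<close>). The preimage of a ball is a
  ball under \<open>\<pi>\<close>, and it is the product of \<open>G\<close> with a ball under the action, because \<open>G\<close> fixes \<open>T\<close>; and \<open>G\<close>
  is compact, being closed in a product of finite sets of roots (\<open>compact_galois_topology\<close>). So \<open>\<pi>\<close> is
  continuous, closed and surjective, hence a quotient map, which gives the homeomorphism; it is
  open because the saturation of an open set is the union of its translates.

  The action itself is continuous because each \<open>\<sigma>\<close> acts isometrically on \<open>C\<close> and its value at a
  given element of the dense subfield of algebraic elements is locally constant in \<open>\<sigma>\<close>. That \<open>\<sigma>\<close> extends uniquely to the algebraic
  closure holds since the latter is purely inseparable over the separable closure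
  (\<open>purely_inseparable\<close>); the extension is isometric by the uniqueness of norms on algebraic extensions
  of a complete field (\<open>point_over_root\<close>), and therefore it extends to \<open>C\<close>.

  For the fibres, let \<open>x\<close> and \<open>y\<close> have the same restriction to \<open>k[T]\<close>. A point of \<open>A_C\<close> is determined by
  its values at \<open>T - b\<close> for algebraic \<open>b\<close>, and by compactness of \<open>G\<close> it suffices to match these values for
  finitely many \<open>b\<close> at a time, which may be taken to be the roots of a polynomial over \<open>k\<close>. Pick a root
  \<open>a\<close> and one of the two points, say \<open>y\<close>, for which the value at \<open>T - a\<close> is least, and conjugate \<open>x\<close> to make
  its value at \<open>T - a\<close> least among those at conjugates of \<open>a\<close>. Then the ultrametric inequality expresses
  all relevant values by distances between roots, and comparing the two points at the minimal
  polynomial of \<open>a\<close> shows that the values agree (\<open>conjugate_on_roots\<close>).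

  For surjectivity, let \<open>y\<close> be a point of \<open>A_k\<close>. If \<open>y\<close> kills a nonzero polynomial, then it is evaluation
  at an algebraic element, by uniqueness of norms. Otherwise \<open>y\<close> is a norm on \<open>k[T]\<close> and extends to a norm
  on the rational functions over the algebraic closure, by Zorn's lemma applied to subrings that
  meet \<open>k(T)\<close> in the unit ball (\<open>abs_value_extends\<close>); by uniqueness again the extension is the given absolute
  value on constants. In both cases there is a point over the algebraic closure, and it extends to \<open>C\<close>
  by density (\<open>point_extends\<close>).
\<close>

section \<open>Extending homomorphisms along algebraic extensions\<close>

lemma poly_in_subring:
  assumes "0 \<in> R" "\<And>a b. a \<in> R \<Longrightarrow> b \<in> R \<Longrightarrow> a + b \<in> R" "\<And>a b. a \<in> R \<Longrightarrow> b \<in> R \<Longrightarrow> a * b \<in> R"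
    and "x \<in> R" "\<And>n. coeff p n \<in> R"
  shows "poly p (x :: 'a::comm_ring_1) \<in> R"
  using assms(5)
proof (induction p)
  case 0
  show ?case using assms(1) by simp
next
  case (pCons a p)
  have "coeff p n \<in> R" for n using pCons.prems[of "Suc n"] by simp
  moreover have "a \<in> R" using pCons.prems[of 0] by simp
  ultimately show ?case using pCons.IH assms by simp
qed

text \<open>An equation of \<open>x\<close> with nonzero constant term \<open>a\<close> reads \<open>x *
  q(x) = - a\<close> and so exhibits the inverse as a polynomial in \<open>x\<close>. Hence
  intermediate rings of an algebraic extension are fields, and the constructions below only have
  to produce rings.\<close>

lemma inverse_in_algebraic_subring:
  fixes e :: "'k::field \<Rightarrow> 'a::field"
  assumes e: "field_hom e" and R: "range e \<subseteq> R"
    "\<And>a b. a \<in> R \<Longrightarrow> b \<in> R \<Longrightarrow> a + b \<in> R" "\<And>a b. a \<in> R \<Longrightarrow> b \<in> R \<Longrightarrow> a * b \<in> R"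
    and x: "x \<in> R" and p: "p \<noteq> 0" "poly (map_poly e p) x = 0"
  shows "inverse x \<in> R"
proof -
  interpret e: field_hom e by fact
  have 0: "0 \<in> R" using R(1) e.hom_zero by (metis rangeI subsetD)
  show ?thesis using p
  proof (induction p)
    case 0
    then show ?case by simp
  next
    case (pCons a p)
    have px: "poly (map_poly e p) x \<in> R"
      by (rule poly_in_subring[OF 0 R(2,3) x]) (use R(1) in auto)
    have eq: "e a + x * poly (map_poly e p) x = 0"
      using pCons.prems by (simp add: e.map_poly_pCons_hom)
    show ?case
    proof (cases "a = 0")
      case False
      then have x0: "x \<noteq> 0" using eq by auto
      have "x * poly (map_poly e p) x = - e a" using eq by (simp add: eq_neg_iff_add_eq_0 add.commute)
      then have "x * (poly (map_poly e p) x * e (- inverse a)) = - e a * e (- inverse a)"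
        by (simp add: mult.assoc[symmetric])
      also have "\<dots> = 1" using False by (simp add: e.hom_uminus e.hom_inverse)
      finally have "inverse x = poly (map_poly e p) x * e (- inverse a)"
        using x0 by (simp add: inverse_unique)
      then show ?thesis using px R(1,3) by (metis rangeI subsetD)
    next
      case True
      then have "x = 0 \<or> poly (map_poly e p) x = 0" using eq by simp
      then show ?thesis using True pCons 0 by auto
    qed
  qed
qed

text \<open>A homomorphism from a subring, represented by its graph, which is a subring of the product
  ring. With graphs, the union of a chain of partial homomorphisms is literally a union.\<close>

definition partial_hom :: "('a::comm_ring_1 \<times> 'b::comm_ring_1) set \<Rightarrow> bool" where
  "partial_hom \<Gamma> \<longleftrightarrow> (1, 1) \<in> \<Gamma> \<and>
    (\<forall>a b c d. (a, b) \<in> \<Gamma> \<longrightarrow> (c, d) \<in> \<Gamma> \<longrightarrow> (a - c, b - d) \<in> \<Gamma> \<and> (a * c, b * d) \<in> \<Gamma>) \<and>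
    (\<forall>b. (0, b) \<in> \<Gamma> \<longrightarrow> b = 0)"

context
  fixes \<Gamma> :: "('a::comm_ring_1 \<times> 'b::comm_ring_1) set"
  assumes ph: "partial_hom \<Gamma>"
begin

lemma partial_hom_one: "(1, 1) \<in> \<Gamma>"
  and partial_hom_diff: "(a, b) \<in> \<Gamma> \<Longrightarrow> (c, d) \<in> \<Gamma> \<Longrightarrow> (a - c, b - d) \<in> \<Gamma>"
  and partial_hom_mult: "(a, b) \<in> \<Gamma> \<Longrightarrow> (c, d) \<in> \<Gamma> \<Longrightarrow> (a * c, b * d) \<in> \<Gamma>"
  and partial_hom_0D: "(0, b) \<in> \<Gamma> \<Longrightarrow> b = 0"
  using ph unfolding partial_hom_def by blast+

lemma partial_hom_zero: "(0, 0) \<in> \<Gamma>"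
  using partial_hom_diff[OF partial_hom_one partial_hom_one] by simp

lemma partial_hom_add: "(a, b) \<in> \<Gamma> \<Longrightarrow> (c, d) \<in> \<Gamma> \<Longrightarrow> (a + c, b + d) \<in> \<Gamma>"
  using partial_hom_diff[of a b "0 - c" "0 - d"] partial_hom_diff[OF partial_hom_zero, of c d] by simp

lemma partial_hom_unique: "(a, b) \<in> \<Gamma> \<Longrightarrow> (a, c) \<in> \<Gamma> \<Longrightarrow> b = c"
  using partial_hom_diff[of a b a c] partial_hom_0D[of "b - c"] by simp

lemma partial_hom_sum: "(\<And>x. x \<in> A \<Longrightarrow> (f x, g x) \<in> \<Gamma>) \<Longrightarrow> (sum f A, sum g A) \<in> \<Gamma>"
  by (induction A rule: infinite_finite_induct) (auto intro: partial_hom_zero partial_hom_add)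

end

text \<open>The graph of the extension that sends \<open>x\<close> to \<open>y\<close>.\<close>

definition adjoin_pair ::
    "('a::comm_ring_1 \<times> 'b::comm_ring_1) set \<Rightarrow> 'a \<Rightarrow> 'b \<Rightarrow> ('a \<times> 'b) set" where
  "adjoin_pair \<Gamma> x y = {(poly p x, poly q y) | p q. \<forall>n. (coeff p n, coeff q n) \<in> \<Gamma>}"

text \<open>Here \<open>m'\<close> is the image of the minimal polynomial \<open>m\<close> of
  \<open>x\<close>. The extension to polynomial expressions in \<open>x\<close> is well defined
  because a polynomial that vanishes at \<open>x\<close> can be reduced to 0 by subtracting
  multiples of \<open>m\<close>, which does not change the value of its image at the root
  \<open>y\<close> of \<open>m'\<close>.\<close>

lemma partial_hom_adjoin_pair:
  fixes \<Gamma> :: "('a::field \<times> 'b::field) set"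
  assumes ph: "partial_hom \<Gamma>"
    and inv: "\<And>a b. (a, b) \<in> \<Gamma> \<Longrightarrow> \<exists>c. (inverse a, c) \<in> \<Gamma>"
    and m: "m \<noteq> 0" "\<And>n. (coeff m n, coeff m' n) \<in> \<Gamma>" "poly m' y = 0"
    and min: "\<And>p. poly p x = 0 \<Longrightarrow> p \<noteq> 0 \<Longrightarrow> (\<forall>n. coeff p n \<in> Domain \<Gamma>) \<Longrightarrow> degree m \<le> degree p"
    and mx: "poly m x = 0"
  shows "partial_hom (adjoin_pair \<Gamma> x y)"
proof -
  have key: "poly q y = 0" if "\<forall>n. (coeff p n, coeff q n) \<in> \<Gamma>" "poly p x = 0" for p q
    using that
  proof (induction "degree p" arbitrary: p q rule: less_induct)
    case less
    show ?case
    proof (cases "p = 0")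
      case True
      then have "coeff q n = 0" for n using less.prems(1) partial_hom_0D[OF ph] by simp
      then have "q = 0" by (simp add: poly_eq_iff)
      then show ?thesis by simp
    next
      case False
      then have le: "degree m \<le> degree p" using less.prems by (intro min) auto
      obtain c where c: "(inverse (lead_coeff m), c) \<in> \<Gamma>" using inv m(2) by blast
      define a where "a = lead_coeff p * inverse (lead_coeff m)"
      define b where "b = coeff q (degree p) * c"
      have ab: "(a, b) \<in> \<Gamma>" unfolding a_def b_def using less.prems(1) c partial_hom_mult[OF ph] by blast
      define d where "d = degree p - degree m"
      define p' where "p' = p - monom a d * m"
      define q' where "q' = q - monom b d * m'"
      have 1: "\<forall>n. (coeff p' n, coeff q' n) \<in> \<Gamma>"
        unfolding p'_def q'_def using ab m(2) less.prems(1)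
        by (auto simp: coeff_monom_mult intro!: partial_hom_diff[OF ph] partial_hom_mult[OF ph] partial_hom_zero[OF ph])
      have 2: "poly p' x = 0" using less.prems mx by (simp add: p'_def)
      have q'y: "poly q' y = poly q y" using m(3) by (simp add: q'_def)
      show ?thesis
      proof (cases "degree p = 0")
        case True
        then have "\<exists>r. p = [:r:]" using degree_eq_zeroE by blast
        then show ?thesis using less.prems False by auto
      next
        case pos: False
        have m0: "a \<noteq> 0" using False m(1) by (simp add: a_def)
        have "degree (monom a d * m) = degree p"
          using m0 m(1) le by (simp add: degree_mult_eq monom_eq_0_iff degree_monom_eq d_def)
        moreover have "coeff (monom a d * m) (degree p) = lead_coeff p"
          using le m(1) by (simp add: coeff_monom_mult d_def a_def)
        ultimately have "degree p' < degree p"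
          unfolding p'_def using pos
          by (metis coeff_diff degree_diff_le diff_self le_degree leading_coeff_0_iff le_neq_implies_less
              degree_0 order_refl neq0_conv)
        then show ?thesis using less.hyps[OF _ 1 2] q'y by simp
      qed
    qed
  qed
  show ?thesis
    unfolding partial_hom_def
  proof (intro conjI allI impI)
    show "(1, 1) \<in> adjoin_pair \<Gamma> x y"
      unfolding adjoin_pair_def using partial_hom_one[OF ph] partial_hom_zero[OF ph]
      by (auto intro!: exI[of _ 1] simp: coeff_1)
  next
    fix a b c d assume ab: "(a, b) \<in> adjoin_pair \<Gamma> x y" and cd: "(c, d) \<in> adjoin_pair \<Gamma> x y"
    from ab obtain p q where pq: "a = poly p x" "b = poly q y" "\<And>n. (coeff p n, coeff q n) \<in> \<Gamma>"
      unfolding adjoin_pair_def by auto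
    from cd obtain r s where rs: "c = poly r x" "d = poly s y" "\<And>n. (coeff r n, coeff s n) \<in> \<Gamma>"
      unfolding adjoin_pair_def by auto
    have "\<forall>n. (coeff (p - r) n, coeff (q - s) n) \<in> \<Gamma>" using pq rs partial_hom_diff[OF ph] by simp
    moreover have "\<forall>n. (coeff (p * r) n, coeff (q * s) n) \<in> \<Gamma>"
      unfolding coeff_mult using pq rs by (intro allI partial_hom_sum[OF ph] partial_hom_mult[OF ph]) auto
    ultimately show "(a - c, b - d) \<in> adjoin_pair \<Gamma> x y" "(a * c, b * d) \<in> adjoin_pair \<Gamma> x y"
      unfolding adjoin_pair_def using pq rs by (auto, (metis poly_diff poly_mult)+)
  next
    fix b assume "(0, b) \<in> adjoin_pair \<Gamma> x y"
    then show "b = 0" unfolding adjoin_pair_def using key by auto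
  qed
qed

text \<open>By Zorn's lemma there is a maximal extension, and it is everywhere defined: at a missing point,
  the image of the minimal polynomial has a root in the algebraically closed target.\<close>

lemma partial_hom_extends:
  fixes e :: "'k::field \<Rightarrow> 'a::field" and \<Gamma>\<^sub>0 :: "('a \<times> 'b::alg_closed_field) set"
  assumes alg: "is_algebraic_extension e" and ph0: "partial_hom \<Gamma>\<^sub>0" and dom: "range e \<subseteq> Domain \<Gamma>\<^sub>0"
  shows "\<exists>\<phi>. field_hom \<phi> \<and> (\<forall>(a, b) \<in> \<Gamma>\<^sub>0. \<phi> a = b)"
proof -
  interpret e: field_hom e using alg unfolding is_algebraic_extension_def by blast
  define \<A> where "\<A> = {\<Gamma>. partial_hom \<Gamma> \<and> \<Gamma>\<^sub>0 \<subseteq> \<Gamma>}"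
  have "\<exists>M\<in>\<A>. \<forall>X\<in>\<A>. M \<subseteq> X \<longrightarrow> X = M"
  proof (rule subset_Zorn_nonempty)
    show "\<A> \<noteq> {}" using ph0 by (auto simp: \<A>_def)
    fix \<C> assume ne: "\<C> \<noteq> {}" and ch: "subset.chain \<A> \<C>"
    have sub: "\<C> \<subseteq> \<A>" using ch by (simp add: subset_chain_def)
    have pair: "\<exists>\<Gamma>\<in>\<C>. p \<in> \<Gamma> \<and> q \<in> \<Gamma>" if "p \<in> \<Union>\<C>" "q \<in> \<Union>\<C>" for p q
      using that ch unfolding subset_chain_def by blast
    have "partial_hom (\<Union>\<C>)"
      unfolding partial_hom_def
    proof (intro conjI allI impI)
      show "(1, 1) \<in> \<Union>\<C>" using ne sub partial_hom_one unfolding \<A>_def by blast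
    next
      fix a b c d assume "(a, b) \<in> \<Union>\<C>" "(c, d) \<in> \<Union>\<C>"
      then obtain \<Gamma> where "\<Gamma> \<in> \<C>" "(a, b) \<in> \<Gamma>" "(c, d) \<in> \<Gamma>" using pair by metis
      then show "(a - c, b - d) \<in> \<Union>\<C>" "(a * c, b * d) \<in> \<Union>\<C>"
        using sub partial_hom_diff partial_hom_mult unfolding \<A>_def by blast+
    next
      fix b assume "(0, b) \<in> \<Union>\<C>"
      then show "b = 0" using sub partial_hom_0D unfolding \<A>_def by blast
    qed
    then show "\<Union>\<C> \<in> \<A>" using ne sub by (auto simp: \<A>_def)
  qed
  then obtain \<Gamma> where M: "\<Gamma> \<in> \<A>" "\<forall>X\<in>\<A>. \<Gamma> \<subseteq> X \<longrightarrow> X = \<Gamma>" by blast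
  then have \<Gamma>: "partial_hom \<Gamma>" "\<Gamma>\<^sub>0 \<subseteq> \<Gamma>" by (simp_all add: \<A>_def)
  have max: "X = \<Gamma>" if "partial_hom X" "\<Gamma> \<subseteq> X" for X
    using M(2) that \<Gamma>(2) by (simp add: \<A>_def)
  have rng: "range e \<subseteq> Domain \<Gamma>" using dom \<Gamma>(2) by blast
  have inv: "\<exists>c. (inverse a, c) \<in> \<Gamma>" if ab: "(a, b) \<in> \<Gamma>" for a b
  proof -
    obtain p where p: "p \<noteq> 0" "poly (map_poly e p) a = 0"
      using alg unfolding is_algebraic_extension_def by blast
    have "inverse a \<in> Domain \<Gamma>"
      by (rule inverse_in_algebraic_subring[OF e.field_hom_axioms rng _ _ _ p])
        (use ab partial_hom_add[OF \<Gamma>(1)] partial_hom_mult[OF \<Gamma>(1)] in blast)+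
    then show ?thesis by blast
  qed
  have total: "x \<in> Domain \<Gamma>" for x
  proof -
    define S where "S = {p. p \<noteq> 0 \<and> poly p x = 0 \<and> (\<forall>n. coeff p n \<in> Domain \<Gamma>)}"
    obtain p where p: "p \<noteq> 0" "poly (map_poly e p) x = 0"
      using alg unfolding is_algebraic_extension_def by blast
    then have "map_poly e p \<in> S" using rng by (auto simp: S_def)
    then obtain m where mS: "m \<in> S" and min: "\<And>p. p \<in> S \<Longrightarrow> degree m \<le> degree p"
      using ex_has_least_nat[of "\<lambda>p. p \<in> S" "map_poly e p" degree] by blast
    have m: "m \<noteq> 0" "poly m x = 0" "\<And>n. coeff m n \<in> Domain \<Gamma>" using mS by (auto simp: S_def)
    \<comment> \<open>The case distinction gives \<open>g 0 = 0\<close>, without which \<open>map_poly\<close> is not coefficientwise.\<close>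
    define g where "g a = (if a = 0 then 0 else SOME b. (a, b) \<in> \<Gamma>)" for a
    have g: "(a, g a) \<in> \<Gamma>" if "a \<in> Domain \<Gamma>" for a
      using that partial_hom_zero[OF \<Gamma>(1)] by (auto simp: g_def intro: someI)
    define m' where "m' = map_poly g m"
    have cm': "coeff m' n = g (coeff m n)" for n
      by (simp add: m'_def coeff_map_poly g_def)
    have mm': "(coeff m n, coeff m' n) \<in> \<Gamma>" for n using g m(3) cm' by simp
    \<comment> \<open>The domain is a field, so partial homomorphisms are injective and the degree does not drop.\<close>
    have "g (lead_coeff m) \<noteq> 0"
    proof
      assume 0: "g (lead_coeff m) = 0"
      obtain c where "(inverse (lead_coeff m), c) \<in> \<Gamma>" using inv mm' by blast
      from partial_hom_mult[OF \<Gamma>(1) mm' this, of "degree m"] have "(1, 0) \<in> \<Gamma>" using 0 m(1) cm' by simp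
      then have "(0::'b) = 1" using partial_hom_unique[OF \<Gamma>(1) _ partial_hom_one[OF \<Gamma>(1)]] by blast
      then show False by simp
    qed
    then have "degree m' \<ge> degree m" using cm' by (intro le_degree) simp
    moreover have "degree m > 0"
    proof (rule ccontr)
      assume "\<not> 0 < degree m"
      then obtain c where "m = [:c:]" using degree_eq_zeroE by blast
      then show False using m by simp
    qed
    ultimately obtain y where y: "poly m' y = 0"
      using alg_closed_imp_poly_has_root[of m'] by auto
    have "partial_hom (adjoin_pair \<Gamma> x y)"
      by (rule partial_hom_adjoin_pair[OF \<Gamma>(1) inv m(1) mm' y _ m(2)]) (auto intro!: min simp: S_def)
    moreover have "\<Gamma> \<subseteq> adjoin_pair \<Gamma> x y"
    proof
      fix ab assume "ab \<in> \<Gamma>"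
      then have "\<forall>n. (coeff [:fst ab:] n, coeff [:snd ab:] n) \<in> \<Gamma>"
        using partial_hom_zero[OF \<Gamma>(1)] by (auto simp: coeff_pCons split: nat.split)
      then show "ab \<in> adjoin_pair \<Gamma> x y"
        unfolding adjoin_pair_def
        by (intro CollectI exI[of _ "[:fst ab:]"] exI[of _ "[:snd ab:]"]) auto
    qed
    ultimately have eq: "adjoin_pair \<Gamma> x y = \<Gamma>" using max by blast
    have "\<forall>n. (coeff [:0, 1:] n, coeff [:0, 1:] n) \<in> \<Gamma>"
      using partial_hom_zero[OF \<Gamma>(1)] partial_hom_one[OF \<Gamma>(1)] by (auto simp: coeff_pCons split: nat.split)
    then have "(x, y) \<in> adjoin_pair \<Gamma> x y"
      unfolding adjoin_pair_def
      by (intro CollectI exI[of _ "[:0, 1:]"]) auto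
    then show ?thesis using eq by blast
  qed
  define \<phi> where "\<phi> a = (SOME b. (a, b) \<in> \<Gamma>)" for a
  have \<phi>: "(a, \<phi> a) \<in> \<Gamma>" for a using total[of a] by (auto simp: \<phi>_def intro: someI)
  have \<phi>eq: "(a, b) \<in> \<Gamma> \<Longrightarrow> \<phi> a = b" for a b using partial_hom_unique[OF \<Gamma>(1) \<phi>] .
  have "field_hom \<phi>"
    by unfold_locales
      (auto intro!: \<phi>eq partial_hom_add[OF \<Gamma>(1)] partial_hom_mult[OF \<Gamma>(1)] \<phi> partial_hom_zero[OF \<Gamma>(1)] partial_hom_one[OF \<Gamma>(1)])
  then show ?thesis using \<phi>eq \<Gamma>(2) by blast
qed

section \<open>Ultrametric absolute values and multiplicative seminorms\<close>

text \<open>The linear factor is what the binomial expansion of a power costs.\<close>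

lemma le_of_powers_le:
  fixes a b C :: real
  assumes "0 \<le> a" "0 \<le> b" and le: "\<And>n. a ^ n \<le> C * (real n + 1) * b ^ n"
  shows "a \<le> b"
proof (rule ccontr)
  assume "\<not> a \<le> b"
  then have ab: "b < a" "0 < a" using assms(2) by auto
  define t where "t = b / a"
  have t: "0 \<le> t" "t < 1" using ab assms(2) by (auto simp: t_def)
  have 1: "(\<lambda>n. real n * t ^ n) \<longlonglongrightarrow> 0" 
    using powser_times_n_limit_0[of t] t by simp
  have 2: "(\<lambda>n. t ^ n) \<longlonglongrightarrow> 0" by (rule LIMSEQ_realpow_zero[OF t])
  have "(\<lambda>n. C * (real n * t ^ n + t ^ n)) \<longlonglongrightarrow> C * (0 + 0)"
    by (rule tendsto_mult[OF tendsto_const tendsto_add[OF 1 2]])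
  moreover have "1 \<le> C * (real n * t ^ n + t ^ n)" for n
  proof -
    have "1 = a ^ n / a ^ n" using ab by simp
    also have "\<dots> \<le> C * (real n + 1) * b ^ n / a ^ n" using le[of n] ab by (intro divide_right_mono) auto
    also have "\<dots> = C * (real n * t ^ n + t ^ n)" by (simp add: t_def power_divide algebra_simps add_divide_distrib)
    finally show ?thesis .
  qed
  ultimately have "(1::real) \<le> C * (0 + 0)" by (intro LIMSEQ_le_const) auto
  then show False by simp
qed

context nonarch_abs_value
begin

lemma v_0 [simp]: "v 0 = 0" using eq_0_iff by simp

lemma v_1 [simp]: "v 1 = 1"
  using mult[of 1 1] eq_0_iff[of 1] by simp

lemma v_power: "v (x ^ n) = v x ^ n"
  by (induction n) (auto simp: mult)

lemma v_minus [simp]: "v (- x) = v x"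
proof -
  have "v (- 1) * v (- 1) = 1" using mult[of "-1" "-1"] by simp
  then have "v (- 1) = 1" using nonneg[of "-1"]
    by (metis abs_of_nonneg abs_square_eq_1 power2_eq_square)
  then show ?thesis using mult[of "-1" x] by simp
qed

lemma v_pos: "x \<noteq> 0 \<Longrightarrow> 0 < v x"
  using nonneg[of x] eq_0_iff[of x] by linarith

lemma v_diff: "v (x - y) \<le> max (v x) (v y)"
  using ultrametric[of x "- y"] by simp

lemma v_commute: "v (x - y) = v (y - x)"
  using v_minus[of "x - y"] by simp

lemma v_add: "v (x + y) \<le> v x + v y"
  using ultrametric[of x y] nonneg[of x] nonneg[of y] by linarith

lemma v_triangle: "v (x - z) \<le> v (x - y) + v (y - z)"
  using v_add[of "x - y" "y - z"] by simp

lemma v_of_nat: "v (of_nat n) \<le> 1"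
proof (induction n)
  case (Suc n)
  then show ?case using ultrametric[of 1 "of_nat n"] by simp
qed simp

lemma Metric_space: "Metric_space UNIV (\<lambda>x y. v (x - y))"
proof
  fix x y z
  show "0 \<le> v (x - y)" by (rule nonneg)
  show "v (x - y) = v (y - x)" by (rule v_commute)
  show "v (x - y) = 0 \<longleftrightarrow> x = y" by (simp add: eq_0_iff)
  show "v (x - z) \<le> v (x - y) + v (y - z)" by (rule v_triangle)
qed

definition conv :: "(nat \<Rightarrow> 'a) \<Rightarrow> 'a \<Rightarrow> bool" where
  "conv s z \<longleftrightarrow> (\<lambda>n. v (s n - z)) \<longlonglongrightarrow> 0"

lemma conv_comparison:
  assumes "\<And>n. v (s n - z) \<le> b n" "b \<longlonglongrightarrow> 0"
  shows "conv s z"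
  unfolding conv_def
  by (rule Lim_null_comparison[OF always_eventually assms(2)]) (use assms(1) nonneg in simp)

lemma conv_v: assumes "conv s z" shows "(\<lambda>n. v (s n)) \<longlonglongrightarrow> v z"
proof (rule LIM_zero_cancel, rule Lim_null_comparison[OF always_eventually assms[unfolded conv_def]], intro allI)
  fix n
  show "norm (v (s n) - v z) \<le> v (s n - z)"
    using v_add[of "s n - z" z] v_add[of "z - s n" "s n"] v_commute[of z "s n"] by simp
qed

lemma conv_add: assumes "conv s z" "conv t y" shows "conv (\<lambda>n. s n + t n) (z + y)"
proof (rule conv_comparison)
  show "v (s n + t n - (z + y)) \<le> v (s n - z) + v (t n - y)" for n
    using v_add[of "s n - z" "t n - y"] by (simp add: algebra_simps)
  show "(\<lambda>n. v (s n - z) + v (t n - y)) \<longlonglongrightarrow> 0"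
    using tendsto_add[OF assms[unfolded conv_def]] by simp
qed

lemma conv_uminus: "conv s z \<Longrightarrow> conv (\<lambda>n. - s n) (- z)"
  unfolding conv_def using v_minus[of "s _ - z"] by (simp add: v_commute)

lemma conv_diff: "conv s z \<Longrightarrow> conv t y \<Longrightarrow> conv (\<lambda>n. s n - t n) (z - y)"
  using conv_add[OF _ conv_uminus, of s z t y] by simp

lemma conv_mult: assumes "conv s z" "conv t y" shows "conv (\<lambda>n. s n * t n) (z * y)"
proof (rule conv_comparison)
  show "v (s n * t n - z * y) \<le> v (s n) * v (t n - y) + v (s n - z) * v y" for n
    using v_add[of "s n * (t n - y)" "(s n - z) * y"]
    by (simp only: mult[symmetric]) (simp add: algebra_simps)
  show "(\<lambda>n. v (s n) * v (t n - y) + v (s n - z) * v y) \<longlonglongrightarrow> 0"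
    using tendsto_add[OF tendsto_mult[OF conv_v[OF assms(1)] assms(2)[unfolded conv_def]]
      tendsto_mult[OF assms(1)[unfolded conv_def] tendsto_const[of "v y"]]] by simp
qed

lemma conv_const: "conv (\<lambda>_. z) z"
  by (simp add: conv_def)

text \<open>The largest submultiplicative norm on polynomials with the given value \<open>r\<close> on the
  variable and the given absolute value on constants. It bounds every point with \<open>x(T) =
  r\<close> and makes points Lipschitz functions of the polynomial.\<close>

definition poly_norm :: "real \<Rightarrow> 'a poly \<Rightarrow> real" where
  "poly_norm r P = poly (map_poly v P) r"

lemma poly_norm_0 [simp]: "poly_norm r 0 = 0"
  by (simp add: poly_norm_def)

lemma poly_norm_pCons [simp]: "poly_norm r (pCons a P) = v a + r * poly_norm r P"
  by (cases "a = 0 \<and> P = 0") (auto simp: poly_norm_def map_poly_pCons)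

lemma poly_norm_nonneg: "0 \<le> r \<Longrightarrow> 0 \<le> poly_norm r P"
  by (induction P) (auto simp: nonneg)

lemma poly_norm_mono:
  assumes "0 \<le> r" "r \<le> s"
  shows "poly_norm r P \<le> poly_norm s P"
proof (induction P)
  case (pCons a P)
  have "r * poly_norm r P \<le> s * poly_norm s P"
    using pCons.IH assms poly_norm_nonneg[of r P] by (intro mult_mono) auto
  then show ?case by simp
qed simp

lemma poly_norm_add: "0 \<le> r \<Longrightarrow> poly_norm r (P + Q) \<le> poly_norm r P + poly_norm r Q"
proof (induction P Q rule: poly_induct2)
  case (pCons a p b q)
  have "r * poly_norm r (p + q) \<le> r * (poly_norm r p + poly_norm r q)"
    using pCons by (intro mult_left_mono) auto
  then show ?case using v_add[of a b] by (simp add: algebra_simps)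
qed simp

lemma poly_norm_minus: "poly_norm r (- P) = poly_norm r P"
  by (induction P) auto

lemma poly_norm_diff: "0 \<le> r \<Longrightarrow> poly_norm r (P - Q) \<le> poly_norm r P + poly_norm r Q"
  using poly_norm_add[of r P "- Q"] by (simp add: poly_norm_minus)

lemma poly_norm_commute: "poly_norm r (P - Q) = poly_norm r (Q - P)"
  using poly_norm_minus[of r "P - Q"] by simp

lemma poly_norm_smult: "poly_norm r (smult c P) = v c * poly_norm r P"
  by (induction P) (auto simp: mult algebra_simps)

lemma poly_norm_mult: "0 \<le> r \<Longrightarrow> poly_norm r (P * Q) \<le> poly_norm r P * poly_norm r Q"
proof (induction P)
  case (pCons a P)
  have "poly_norm r (pCons a P * Q) \<le> poly_norm r (smult a Q) + poly_norm r (pCons 0 (P * Q))"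
    using poly_norm_add[OF \<open>0 \<le> r\<close>, of "smult a Q" "pCons 0 (P * Q)"] by simp
  also have "\<dots> \<le> v a * poly_norm r Q + r * (poly_norm r P * poly_norm r Q)"
    using pCons by (auto simp: poly_norm_smult intro: mult_left_mono)
  finally show ?case by (simp add: algebra_simps)
qed simp

lemma poly_norm_eq_sum:
  assumes "\<forall>i\<ge>n. coeff P i = 0"
  shows "poly_norm r P = (\<Sum>i<n. v (coeff P i) * r ^ i)"
  using assms
proof (induction n arbitrary: P)
  case 0
  then have "P = 0" by (simp add: poly_eq_iff)
  then show ?case by simp
next
  case (Suc n)
  obtain a Q where P: "P = pCons a Q" by (cases P)
  have "\<forall>i\<ge>n. coeff Q i = 0" using Suc.prems P by (metis coeff_pCons_Suc Suc_le_mono)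
  then have "poly_norm r P = v a + r * (\<Sum>i<n. v (coeff Q i) * r ^ i)" using P Suc.IH by simp
  also have "\<dots> = (\<Sum>i<Suc n. v (coeff P i) * r ^ i)"
    unfolding sum.lessThan_Suc_shift by (simp add: P sum_distrib_left mult_ac)
  finally show ?case .
qed

lemma poly_norm_bound:
  assumes "0 \<le> r" "\<And>i. v (coeff P i) \<le> B" "\<forall>i\<ge>n. coeff P i = 0"
  shows "poly_norm r P \<le> B * (\<Sum>i<n. r ^ i)"
  unfolding poly_norm_eq_sum[OF assms(3)] sum_distrib_left
  by (rule sum_mono, rule mult_right_mono[OF assms(2)]) (simp add: assms(1))

end

lemma conv_Cauchy:
  assumes "nonarch_abs_value v" "nonarch_abs_value.conv v s z" "\<epsilon> > 0"
  shows "\<exists>N. \<forall>m n. N \<le> m \<longrightarrow> N \<le> n \<longrightarrow> v (s m - s n) < \<epsilon>"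
proof -
  interpret nonarch_abs_value v by fact
  have "\<forall>\<^sub>F n in sequentially. v (s n - z) < \<epsilon> / 2"
    using order_tendstoD(2)[OF assms(2)[unfolded conv_def], of "\<epsilon> / 2"] assms(3) by simp
  then obtain N where N: "\<And>n. n \<ge> N \<Longrightarrow> v (s n - z) < \<epsilon> / 2"
    unfolding eventually_sequentially by blast
  have "v (s m - s n) < \<epsilon>" if "N \<le> m" "N \<le> n" for m n
    using v_triangle[of "s m" "s n" z] N[OF that(1)] N[OF that(2)] v_commute[of z "s n"] by linarith
  then show ?thesis by blast
qed

locale berkovich_point = nonarch_abs_value v for v :: "'a::field \<Rightarrow> real" +
  fixes x :: "'a poly \<Rightarrow> real"
  assumes point: "x \<in> berkovich_points v"
begin

lemma x_nonneg: "0 \<le> x P" and x_add: "x (P + Q) \<le> x P + x Q"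
  and x_mult: "x (P * Q) = x P * x Q" and x_const: "x [:a:] = v a"
  using point unfolding berkovich_points_def by auto

lemma x_0 [simp]: "x 0 = 0" using x_const[of 0] by simp

lemma x_1 [simp]: "x 1 = 1" using x_const[of 1] by (simp flip: one_pCons)

lemma x_power: "x (P ^ n) = x P ^ n"
  by (induction n) (auto simp: x_mult)

lemma x_smult: "x (smult a P) = v a * x P"
  using x_mult[of "[:a:]" P] by (simp add: x_const)

lemma x_minus: "x (- P) = x P"
  using x_smult[of "- 1" P] by simp

lemma x_diff: "\<bar>x P - x Q\<bar> \<le> x (P - Q)"
  using x_add[of "P - Q" Q] x_add[of "Q - P" P] x_minus[of "P - Q"] by simp

lemma x_sum: "x (sum f A) \<le> (\<Sum>i\<in>A. x (f i))"
proof (induction A rule: infinite_finite_induct)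
  case (insert i F)
  then show ?case using x_add[of "f i" "sum f F"] by simp
qed simp_all

text \<open>The definition of points requires only the triangle inequality; as integers have absolute value
  at most 1, expanding high powers by the binomial theorem improves it to the ultrametric one.\<close>

lemma x_ultrametric: "x (P + Q) \<le> max (x P) (x Q)"
proof (rule le_of_powers_le[where C = 1])
  define M where "M = max (x P) (x Q)"
  have M: "0 \<le> M" "x P \<le> M" "x Q \<le> M" using x_nonneg[of P] by (auto simp: M_def)
  show "0 \<le> x (P + Q)" by (rule x_nonneg)
  show "0 \<le> max (x P) (x Q)" using M by (simp add: M_def)
  fix n
  have "x (P + Q) ^ n = x ((P + Q) ^ n)" by (simp add: x_power)
  also have "\<dots> = x (\<Sum>k\<le>n. of_nat (n choose k) * P ^ k * Q ^ (n - k))" by (simp add: binomial_ring)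
  also have "\<dots> \<le> (\<Sum>k\<le>n. x (of_nat (n choose k) * P ^ k * Q ^ (n - k)))" by (rule x_sum)
  also have "\<dots> \<le> (\<Sum>k\<le>n. M ^ n)"
  proof (rule sum_mono)
    fix k assume "k \<in> {..n}"
    have "x (of_nat (n choose k)) \<le> 1" by (simp add: of_nat_poly x_const v_of_nat)
    then have "x (of_nat (n choose k)) * x P ^ k * x Q ^ (n - k) \<le> 1 * M ^ k * M ^ (n - k)"
      using M x_nonneg by (intro mult_mono power_mono) auto
    also have "\<dots> = M ^ n" using \<open>k \<in> {..n}\<close> by (simp add: power_add[symmetric])
    finally show "x (of_nat (n choose k) * P ^ k * Q ^ (n - k)) \<le> M ^ n" by (simp add: x_mult x_power)
  qed
  finally show "x (P + Q) ^ n \<le> 1 * (real n + 1) * max (x P) (x Q) ^ n" by (simp add: M_def add.commute)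
qed

lemma x_le_poly_norm: "x P \<le> poly_norm (x [:0, 1:]) P"
proof (induction P)
  case (pCons a P)
  have "x (pCons a P) = x ([:a:] + [:0, 1:] * P)" by simp
  also have "\<dots> \<le> x [:a:] + x ([:0, 1:] * P)" by (rule x_add)
  also have "\<dots> = v a + x [:0, 1:] * x P" by (simp only: x_const x_mult)
  also have "\<dots> \<le> v a + x [:0, 1:] * poly_norm (x [:0, 1:]) P"
    using pCons.IH x_nonneg by (simp add: mult_left_mono)
  finally show ?case by simp
qed simp

lemma x_diff_poly_norm: "\<bar>x P - x Q\<bar> \<le> poly_norm (x [:0, 1:]) (P - Q)"
  using x_diff x_le_poly_norm order_trans by blast

end

section \<open>Uniqueness of norms over a complete field\<close>

lemma complete_nonarch_field_limit:
  assumes "complete_nonarch_field v"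
    and "\<And>\<epsilon>. \<epsilon> > 0 \<Longrightarrow> \<exists>N. \<forall>m n. N \<le> m \<longrightarrow> N \<le> n \<longrightarrow> v (s m - s n) < \<epsilon>"
  shows "\<exists>L. (\<lambda>n. v (s n - L)) \<longlonglongrightarrow> 0"
proof -
  interpret complete_nonarch_field v by fact
  interpret M: Metric_space UNIV "\<lambda>x y. v (x - y)" by (rule Metric_space)
  have "M.MCauchy s" unfolding M.MCauchy_def using assms(2) by blast
  then obtain L where "limitin M.mtopology s L sequentially"
    using complete unfolding M.mcomplete_def by blast
  then have "\<forall>\<epsilon>>0. \<exists>N. \<forall>n\<ge>N. v (s n - L) < \<epsilon>" unfolding M.limit_metric_sequentially by simp
  then have "(\<lambda>n. v (s n - L)) \<longlonglongrightarrow> 0"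
    unfolding LIMSEQ_iff by (simp add: nonneg)
  then show ?thesis ..
qed

text \<open>Completeness of the base field makes norms on the algebraic extension unique.\<close>

locale valued_extension =
  k: complete_nonarch_field vk + a: nonarch_abs_value va + e: field_hom e
  for vk :: "'k::field \<Rightarrow> real" and va :: "'a::field \<Rightarrow> real" and e :: "'k \<Rightarrow> 'a" +
  assumes va_e: "va (e c) = vk c" and algebraic: "is_algebraic_extension e"
begin

lemma va_eval_le: "va (poly (map_poly e Q) \<alpha>) \<le> k.poly_norm (va \<alpha>) Q"
proof (induction Q)
  case (pCons c Q)
  have "va (poly (map_poly e (pCons c Q)) \<alpha>) \<le> va (e c) + va (\<alpha> * poly (map_poly e Q) \<alpha>)"
    by (simp add: e.map_poly_pCons_hom a.v_add)
  also have "\<dots> \<le> vk c + va \<alpha> * k.poly_norm (va \<alpha>) Q"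
    using pCons.IH a.nonneg by (simp add: va_e a.mult mult_left_mono)
  finally show ?case by simp
qed simp

context
  fixes \<alpha> :: 'a and m :: "'k poly"
  assumes m0: "m \<noteq> 0" and m\<alpha>: "poly (map_poly e m) \<alpha> = 0"
    and min: "\<And>q. q \<noteq> 0 \<Longrightarrow> poly (map_poly e q) \<alpha> = 0 \<Longrightarrow> degree m \<le> degree q"
begin

abbreviation ev :: "'k poly \<Rightarrow> 'a" where "ev Q \<equiv> poly (map_poly e Q) \<alpha>"

lemma ev_simps: "ev (P + Q) = ev P + ev Q" "ev (P - Q) = ev P - ev Q" "ev (P * Q) = ev P * ev Q"
  "ev (smult c P) = e c * ev P" "ev (monom c n) = e c * \<alpha> ^ n" "ev [:c:] = e c"
proof -
  interpret h: map_poly_inj_idom_hom e ..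
  show "ev (P + Q) = ev P + ev Q" "ev (P - Q) = ev P - ev Q" "ev (P * Q) = ev P * ev Q"
    "ev (smult c P) = e c * ev P" "ev (monom c n) = e c * \<alpha> ^ n" "ev [:c:] = e c"
    by (simp_all add: hom_distribs e.map_poly_pCons_hom poly_monom)
qed

text \<open>Completeness enters here. Elements of the span of the lower powers that approach \<open>-
  \<alpha> ^ n\<close> have Cauchy coordinates by the bound \<open>C\<close>, so the coordinates
  converge in the base field, and the limit would be an equation for \<open>\<alpha>\<close> of
  degree less than its minimal polynomial \<open>m\<close>.\<close>

lemma distance_to_span:
  assumes n: "n < degree m" and C: "\<And>Q i. (\<forall>i\<ge>n. coeff Q i = 0) \<Longrightarrow> vk (coeff Q i) \<le> C * va (ev Q)" "C \<ge> 0"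
  shows "\<exists>d>0. \<forall>Q. (\<forall>i\<ge>n. coeff Q i = 0) \<longrightarrow> d \<le> va (ev Q + \<alpha> ^ n)"
proof (rule ccontr)
  assume no: "\<not> ?thesis"
  have "\<exists>Q. (\<forall>i\<ge>n. coeff Q i = 0) \<and> va (ev Q + \<alpha> ^ n) < 1 / (real j + 1)" for j :: nat
  proof -
    have "0 < 1 / (real j + 1)" by simp
    with no show ?thesis by (metis not_le)
  qed
  then obtain Q where Q: "\<And>j i. i \<ge> n \<Longrightarrow> coeff (Q j) i = 0"
    "\<And>j. va (ev (Q j) + \<alpha> ^ n) < 1 / (real j + 1)" by metis
  have small: "(\<lambda>j. 1 / (real j + 1)) \<longlonglongrightarrow> 0" by real_asymp
  have lim: "\<exists>L. (\<lambda>j. vk (coeff (Q j) i - L)) \<longlonglongrightarrow> 0" for i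
  proof (rule complete_nonarch_field_limit[OF k.complete_nonarch_field_axioms])
    fix \<epsilon> :: real assume \<epsilon>: "\<epsilon> > 0"
    have "\<forall>\<^sub>F j in sequentially. 1 / (real j + 1) < \<epsilon> / (C + 1)"
      using order_tendstoD(2)[OF small] \<epsilon> C(2) by simp
    then obtain N where N: "\<And>j. j \<ge> N \<Longrightarrow> 1 / (real j + 1) < \<epsilon> / (C + 1)"
      unfolding eventually_sequentially by blast
    have "vk (coeff (Q p) i - coeff (Q q) i) < \<epsilon>" if "N \<le> p" "N \<le> q" for p q
    proof -
      have eq: "ev (Q p - Q q) = (ev (Q p) + \<alpha> ^ n) - (ev (Q q) + \<alpha> ^ n)" by (simp add: ev_simps)
      have le: "va (ev (Q p - Q q)) < \<epsilon> / (C + 1)"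
        unfolding eq using a.v_diff[of "ev (Q p) + \<alpha> ^ n" "ev (Q q) + \<alpha> ^ n"] Q(2)[of p] Q(2)[of q] N that
        by (smt (verit, best))
      have "vk (coeff (Q p - Q q) i) \<le> C * va (ev (Q p - Q q))"
        by (rule C(1)) (use Q(1) in simp)
      also have "\<dots> \<le> C * (\<epsilon> / (C + 1))" using le C(2) by (intro mult_left_mono) auto
      also have "\<dots> < \<epsilon>" using \<epsilon> C(2) by (simp add: field_simps)
      finally show ?thesis by simp
    qed
    then show "\<exists>N. \<forall>m n. N \<le> m \<longrightarrow> N \<le> n \<longrightarrow> vk (coeff (Q m) i - coeff (Q n) i) < \<epsilon>" by blast
  qed
  then obtain L where L: "\<And>i. (\<lambda>j. vk (coeff (Q j) i - L i)) \<longlonglongrightarrow> 0" by metis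
  define P where "P = (\<Sum>i<n. monom (L i) i)"
  have cP: "coeff P i = (if i < n then L i else 0)" for i
    by (simp add: P_def coeff_sum coeff_monom)
  have pn: "k.poly_norm (va \<alpha>) (Q j - P) = (\<Sum>i<n. vk (coeff (Q j) i - L i) * va \<alpha> ^ i)" for j
    using k.poly_norm_eq_sum[of n "Q j - P" "va \<alpha>"] Q(1) by (simp add: cP)
  have bound: "va (ev P + \<alpha> ^ n) \<le> k.poly_norm (va \<alpha>) (Q j - P) + 1 / (real j + 1)" for j
  proof -
    have eq: "ev P + \<alpha> ^ n = (ev (Q j) + \<alpha> ^ n) + - ev (Q j - P)" by (simp add: ev_simps)
    have "va (ev P + \<alpha> ^ n) \<le> va (ev (Q j) + \<alpha> ^ n) + va (ev (Q j - P))"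
      unfolding eq using a.v_add[of "ev (Q j) + \<alpha> ^ n" "- ev (Q j - P)"] by (simp only: a.v_minus)
    then show ?thesis using Q(2)[of j] va_eval_le[of "Q j - P" \<alpha>] by linarith
  qed
  have "(\<lambda>j. k.poly_norm (va \<alpha>) (Q j - P) + 1 / (real j + 1)) \<longlonglongrightarrow> (\<Sum>i<n. 0 * va \<alpha> ^ i) + 0"
    unfolding pn by (intro tendsto_add tendsto_sum tendsto_mult L small tendsto_const)
  then have "va (ev P + \<alpha> ^ n) \<le> 0"
    using bound by (intro LIMSEQ_le_const[of _ _ "va (ev P + \<alpha> ^ n)"]) auto
  then have "ev (P + monom 1 n) = 0" using a.v_pos[of "ev P + \<alpha> ^ n"] by (auto simp: ev_simps poly_monom)
  moreover have c1: "coeff (P + monom 1 n) n = 1" by (simp add: cP)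
  then have "P + monom 1 n \<noteq> 0" by (metis coeff_0 zero_neq_one)
  ultimately have "degree m \<le> degree (P + monom 1 n)" by (intro min)
  moreover have "degree (P + monom 1 n) \<le> n" by (rule degree_le) (simp add: cP)
  ultimately show False using n by simp
qed

text \<open>All norms on a finite-dimensional space over a complete field are equivalent; this is the half
  of it that is used, for the basis of powers of \<open>\<alpha>\<close>. The distance to the
  span of the lower powers bounds the top coordinate, and then the induction hypothesis bounds
  the others.\<close>

lemma coordinates_bounded:
  "n \<le> degree m \<Longrightarrow> \<exists>C\<ge>0. \<forall>Q. (\<forall>i\<ge>n. coeff Q i = 0) \<longrightarrow> (\<forall>i. vk (coeff Q i) \<le> C * va (ev Q))"
proof (induction n)
  case 0
  show ?case by (intro exI[of _ 0]) auto
next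
  case (Suc n)
  then obtain C where C: "C \<ge> 0" "\<And>Q i. (\<forall>i\<ge>n. coeff Q i = 0) \<Longrightarrow> vk (coeff Q i) \<le> C * va (ev Q)"
    using Suc_leD by blast
  obtain d where d: "d > 0" "\<And>Q. (\<forall>i\<ge>n. coeff Q i = 0) \<Longrightarrow> d \<le> va (ev Q + \<alpha> ^ n)"
    using distance_to_span[OF _ C(2,1)] Suc.prems by (metis Suc_le_lessD)
  \<comment> \<open>\<open>1 / d\<close> bounds the top coefficient, and \<open>A\<close> the top term, in units of \<open>va (ev Q)\<close>.\<close>
  define A where "A = va \<alpha> ^ n / d"
  have A0: "A \<ge> 0" using d(1) a.nonneg by (simp add: A_def)
  define D where "D = 1 / d + C * (1 + A)"
  have D: "D \<ge> 0" "1 / d \<le> D" "C * (1 + A) \<le> D" using d(1) C(1) A0 by (auto simp: D_def)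
  have "vk (coeff Q i) \<le> D * va (ev Q)" if Q: "\<forall>i\<ge>Suc n. coeff Q i = 0" for Q i
  proof -
    define c where "c = coeff Q n"
    define Q' where "Q' = Q - monom c n"
    have Q': "\<forall>i\<ge>n. coeff Q' i = 0"
      using Q by (auto simp: Q'_def c_def coeff_monom Suc_le_eq)
    have evQ: "ev Q = ev Q' + e c * \<alpha> ^ n" by (simp add: Q'_def ev_simps poly_monom)
    have c: "vk c * d \<le> va (ev Q)"
    proof (cases "c = 0")
      case False
      have "e c * (ev (smult (inverse c) Q') + \<alpha> ^ n) = ev Q"
        using False by (simp add: evQ ev_simps algebra_simps e.hom_inverse)
      then have "va (ev Q) = vk c * va (ev (smult (inverse c) Q') + \<alpha> ^ n)"
        by (metis a.mult va_e)
      moreover have "d \<le> va (ev (smult (inverse c) Q') + \<alpha> ^ n)" by (rule d(2)) (use Q' in simp)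
      ultimately show ?thesis using k.nonneg[of c] by (simp add: mult_left_mono)
    qed (simp add: a.nonneg)
    then have c': "vk c \<le> 1 / d * va (ev Q)" using d(1) by (simp add: field_simps)
    show ?thesis
    proof (cases "i = n")
      case True
      then show ?thesis using c' D(2) a.nonneg[of "ev Q"]
        by (metis c_def mult_right_mono order_trans)
    next
      case False
      have "va (ev Q') \<le> va (ev Q) + va (e c * \<alpha> ^ n)"
        using a.v_add[of "ev Q" "- (e c * \<alpha> ^ n)"] by (simp add: evQ)
      also have "va (e c * \<alpha> ^ n) = vk c * va \<alpha> ^ n" by (simp add: a.mult va_e a.v_power)
      also have "\<dots> \<le> (1 / d * va (ev Q)) * va \<alpha> ^ n" using c' a.nonneg by (intro mult_right_mono) auto
      finally have "va (ev Q') \<le> (1 + A) * va (ev Q)" by (simp add: A_def algebra_simps)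
      then have "C * va (ev Q') \<le> C * ((1 + A) * va (ev Q))" using C(1) by (rule mult_left_mono)
      also have "\<dots> \<le> D * va (ev Q)" using D(3) a.nonneg[of "ev Q"]
        by (metis mult.assoc mult_right_mono)
      finally have "C * va (ev Q') \<le> D * va (ev Q)" .
      moreover have "coeff Q i = coeff Q' i" using False by (simp add: Q'_def)
      ultimately show ?thesis using C(2)[OF Q', of i] by simp
    qed
  qed
  then show ?case using D(1) by blast
qed

text \<open>A point that kills the minimal polynomial of \<open>\<alpha>\<close> is a norm on the field
  generated by \<open>\<alpha>\<close>. Up to a constant it is bounded by \<open>va\<close>,
  since coordinates are; applied to powers this removes the constant, and applied to inverses it
  gives equality. In particular the absolute value of an algebraic extension of a complete field
  is unique.\<close>

lemma point_over_root:
  assumes y: "y \<in> berkovich_points vk" and ym: "y m = 0"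
  shows "y Q = va (ev Q)"
proof -
  interpret y: berkovich_point vk y by unfold_locales (fact y)
  obtain C where C: "C \<ge> 0" "\<And>Q i. (\<forall>i\<ge>degree m. coeff Q i = 0) \<Longrightarrow> vk (coeff Q i) \<le> C * va (ev Q)"
    using coordinates_bounded[of "degree m"] by blast
  \<comment> \<open>Reduce modulo \<open>m\<close>, estimate the remainder by its coefficients and these by \<open>va\<close>.\<close>
  define K where "K = C * (\<Sum>i<degree m. y [:0, 1:] ^ i)"
  have bound: "y Q \<le> K * va (ev Q)" for Q
  proof -
    define R where "R = Q mod m"
    have QR: "Q = m * (Q div m) + R" by (simp add: R_def)
    then have "ev Q = ev R" using m\<alpha> by (metis add.left_neutral ev_simps(1,3) mult_zero_left)
    have "Q - R = m * (Q div m)" using QR by (metis add_diff_cancel_right')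
    then have "\<bar>y Q - y R\<bar> \<le> y (m * (Q div m))" using y.x_diff[of Q R] by simp
    then have yQ: "y Q = y R" by (simp add: y.x_mult ym)
    have R0: "\<forall>i\<ge>degree m. coeff R i = 0"
      using degree_mod_less[OF m0, of Q] by (auto simp: R_def intro: coeff_eq_0)
    have "y R \<le> k.poly_norm (y [:0, 1:]) R" by (rule y.x_le_poly_norm)
    also have "\<dots> \<le> C * va (ev R) * (\<Sum>i<degree m. y [:0, 1:] ^ i)"
      using y.x_nonneg by (intro k.poly_norm_bound C(2)[OF R0] R0)
    finally show ?thesis using yQ \<open>ev Q = ev R\<close> by (simp add: K_def mult_ac)
  qed
  have le: "y Q \<le> va (ev Q)" for Q
  proof (rule le_of_powers_le[where C = "\<bar>K\<bar>"])
    show "0 \<le> y Q" "0 \<le> va (ev Q)" by (rule y.x_nonneg a.nonneg)+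
    fix n
    have "ev (Q ^ n) = ev Q ^ n" by (induction n) (auto simp: ev_simps)
    then have "y Q ^ n \<le> K * va (ev Q) ^ n" using bound[of "Q ^ n"] by (simp add: y.x_power a.v_power)
    also have "\<dots> \<le> (\<bar>K\<bar> * (real n + 1)) * va (ev Q) ^ n"
    proof (rule mult_right_mono)
      have "K \<le> \<bar>K\<bar> * 1" by simp
      also have "\<dots> \<le> \<bar>K\<bar> * (real n + 1)" by (rule mult_left_mono) auto
      finally show "K \<le> \<bar>K\<bar> * (real n + 1)" .
    qed (use a.nonneg in simp)
    finally show "y Q ^ n \<le> \<bar>K\<bar> * (real n + 1) * va (ev Q) ^ n" .
  qed
  show ?thesis
  proof (cases "ev Q = 0")
    case True
    then show ?thesis using le[of Q] y.x_nonneg[of Q] by simp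
  next
    case False
    obtain p where p: "p \<noteq> 0" "poly (map_poly e p) (ev Q) = 0"
      using algebraic unfolding is_algebraic_extension_def by blast
    have "inverse (ev Q) \<in> range ev"
    proof (rule inverse_in_algebraic_subring[OF e.field_hom_axioms _ _ _ _ p])
      show "range e \<subseteq> range ev" using ev_simps(6) by (metis image_subsetI rangeI)
      show "a + b \<in> range ev" "a * b \<in> range ev" if "a \<in> range ev" "b \<in> range ev" for a b
        using that ev_simps(1,3) by (auto, metis rangeI)+
    qed simp
    then obtain Q' where Q': "inverse (ev Q) = ev Q'" by blast
    have "ev (Q * Q' - 1) = 0" using Q' False by (simp add: ev_simps flip: Q')
    then have "y (Q * Q' - 1) \<le> 0" using le[of "Q * Q' - 1"] by simp
    then have "y (Q * Q') = 1" using y.x_diff[of "Q * Q'" 1] by simp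
    then have 1: "y Q * y Q' = 1" by (simp add: y.x_mult)
    have 2: "va (ev Q) * va (ev Q') = 1" using Q' False by (simp flip: a.mult Q')
    have "1 \<le> y Q * va (ev Q')" using mult_left_mono[OF le[of Q'] y.x_nonneg[of Q]] 1 by simp
    then have "va (ev Q) \<le> va (ev Q) * (y Q * va (ev Q'))"
      using a.nonneg[of "ev Q"] by (metis mult.right_neutral mult_left_mono)
    also have "\<dots> = y Q" using 2 by (simp add: mult_ac)
    finally show ?thesis using le[of Q] by simp
  qed
qed

end
end

section \<open>Extending a norm by a maximal dominating ring\<close>

text \<open>A multiplicative ultrametric norm on a domain inside a field is to be extended to the field
  (the existence theorem of Chevalley, for norms with real values). The domain is embedded by
  \<open>\<iota>\<close>.\<close>

locale normed_subdomain =
  fixes \<iota> :: "'b::idom \<Rightarrow> 'f::field" and v :: "'b \<Rightarrow> real"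
  assumes hom: "inj_idom_hom \<iota>"
    and v_nonneg: "0 \<le> v b" and v_eq_0_iff: "v b = 0 \<longleftrightarrow> b = 0"
    and v_mult: "v (b * c) = v b * v c" and v_add: "v (b + c) \<le> max (v b) (v c)"
begin

sublocale \<iota>: inj_idom_hom \<iota> by (rule hom)

lemma v_1: "v 1 = 1"
  using v_mult[of 1 1] v_eq_0_iff[of 1] by simp

lemma v_minus: "v (- b) = v b"
proof -
  have "v (- 1) * v (- 1) = 1" using v_mult[of "-1" "-1"] v_1 by simp
  then have "v (- 1) = 1" using v_nonneg[of "-1"]
    by (metis abs_of_nonneg abs_square_eq_1 power2_eq_square)
  then show ?thesis using v_mult[of "-1" b] by simp
qed

lemma v_diff: "v (b - c) \<le> max (v b) (v c)"
  using v_add[of b "- c"] v_minus by simp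

lemma v_pos: "b \<noteq> 0 \<Longrightarrow> 0 < v b"
  using v_nonneg[of b] v_eq_0_iff[of b] by linarith

lemma v_power: "v (b ^ n) = v b ^ n"
  by (induction n) (auto simp: v_1 v_mult)

text \<open>The subrings whose intersection with the fraction field of the domain is exactly the unit ball
  there.\<close>

definition dominating :: "'f set \<Rightarrow> bool" where
  "dominating R \<longleftrightarrow> 1 \<in> R \<and> (\<forall>x\<in>R. \<forall>y\<in>R. x - y \<in> R \<and> x * y \<in> R) \<and>
    (\<forall>b c. c \<noteq> 0 \<longrightarrow> (\<iota> b / \<iota> c \<in> R \<longleftrightarrow> v b \<le> v c))"

lemma dominating_base: "dominating {\<iota> b / \<iota> c | b c. c \<noteq> 0 \<and> v b \<le> v c}"
  unfolding dominating_def
proof (intro conjI ballI allI impI)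
  show "1 \<in> {\<iota> b / \<iota> c | b c. c \<noteq> 0 \<and> v b \<le> v c}"
    by (intro CollectI exI[of _ 1]) auto
next
  fix x y assume "x \<in> {\<iota> b / \<iota> c | b c. c \<noteq> 0 \<and> v b \<le> v c}" "y \<in> {\<iota> b / \<iota> c | b c. c \<noteq> 0 \<and> v b \<le> v c}"
  then obtain b c b' c' where x: "x = \<iota> b / \<iota> c" "c \<noteq> 0" "v b \<le> v c"
    and y: "y = \<iota> b' / \<iota> c'" "c' \<noteq> 0" "v b' \<le> v c'" by blast
  have cc: "c * c' \<noteq> 0" using x y by simp
  have "x - y = \<iota> (b * c' - b' * c) / \<iota> (c * c')"
    unfolding x(1) y(1) using x(2) y(2) by (simp add: \<iota>.hom_minus \<iota>.hom_mult diff_frac_eq)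
  moreover have "v (b * c' - b' * c) \<le> v (c * c')"
  proof -
    have "v (b * c') \<le> v (c * c')" "v (b' * c) \<le> v (c * c')"
      using mult_right_mono[OF x(3) v_nonneg[of c']] mult_left_mono[OF y(3) v_nonneg[of c]]
      by (simp_all add: v_mult mult.commute)
    then show ?thesis using v_diff[of "b * c'" "b' * c"] by linarith
  qed
  ultimately show "x - y \<in> {\<iota> b / \<iota> c | b c. c \<noteq> 0 \<and> v b \<le> v c}" using cc by blast
  have "x * y = \<iota> (b * b') / \<iota> (c * c')" using x y by (simp add: \<iota>.hom_mult)
  moreover have "v (b * b') \<le> v (c * c')"
    unfolding v_mult using x y v_nonneg by (intro mult_mono) auto
  ultimately show "x * y \<in> {\<iota> b / \<iota> c | b c. c \<noteq> 0 \<and> v b \<le> v c}" using cc by blast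
next
  fix b c :: 'b assume c: "c \<noteq> 0"
  show "\<iota> b / \<iota> c \<in> {\<iota> b / \<iota> c | b c. c \<noteq> 0 \<and> v b \<le> v c} \<longleftrightarrow> v b \<le> v c"
  proof
    assume "\<iota> b / \<iota> c \<in> {\<iota> b / \<iota> c | b c. c \<noteq> 0 \<and> v b \<le> v c}"
    then obtain b' c' where e: "\<iota> b / \<iota> c = \<iota> b' / \<iota> c'" "c' \<noteq> 0" "v b' \<le> v c'" by blast
    then have "\<iota> (b * c') = \<iota> (b' * c)" using c by (simp add: \<iota>.hom_mult field_simps)
    then have "v b * v c' = v b' * v c" by (metis \<iota>.eq_iff v_mult)
    also have "\<dots> \<le> v c' * v c" using e v_nonneg by (intro mult_right_mono) auto
    finally show "v b \<le> v c" using v_pos[OF e(2)] by (simp add: mult.commute)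
  qed (use c in blast)
qed

lemma ex_maximal_dominating: "\<exists>R. dominating R \<and> (\<forall>R'. dominating R' \<longrightarrow> R \<subseteq> R' \<longrightarrow> R' = R)"
proof -
  have "\<exists>R\<in>{R. dominating R}. \<forall>X\<in>{R. dominating R}. R \<subseteq> X \<longrightarrow> X = R"
  proof (rule subset_Zorn_nonempty)
    show "{R. dominating R} \<noteq> {}" using dominating_base by blast
    fix \<C> assume ne: "\<C> \<noteq> {}" and ch: "subset.chain {R. dominating R} \<C>"
    have sub: "dominating R" if "R \<in> \<C>" for R using ch that by (auto simp: subset_chain_def)
    have pair: "\<exists>R\<in>\<C>. p \<in> R \<and> q \<in> R" if "p \<in> \<Union>\<C>" "q \<in> \<Union>\<C>" for p q
      using that ch unfolding subset_chain_def by blast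
    have "dominating (\<Union>\<C>)"
      unfolding dominating_def
    proof (intro conjI ballI allI impI)
      show "1 \<in> \<Union>\<C>" using ne sub unfolding dominating_def by blast
    next
      fix x y assume "x \<in> \<Union>\<C>" "y \<in> \<Union>\<C>"
      then obtain R where "R \<in> \<C>" "x \<in> R" "y \<in> R" using pair by metis
      then show "x - y \<in> \<Union>\<C>" "x * y \<in> \<Union>\<C>" using sub unfolding dominating_def by blast+
    next
      fix b c :: 'b assume "c \<noteq> 0"
      then have "\<iota> b / \<iota> c \<in> R \<longleftrightarrow> v b \<le> v c" if "R \<in> \<C>" for R
        using sub[OF that] unfolding dominating_def by blast
      then show "(\<iota> b / \<iota> c \<in> \<Union>\<C>) = (v b \<le> v c)" using ne by blast
    qed
    then show "\<Union>\<C> \<in> {R. dominating R}" by blast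
  qed
  then show ?thesis by blast
qed

end

locale maximal_dominating = normed_subdomain \<iota> v
  for \<iota> :: "'b::idom \<Rightarrow> 'f::field" and v :: "'b \<Rightarrow> real" +
  fixes R :: "'f set"
  assumes dom: "dominating R" and maximal: "\<And>R'. dominating R' \<Longrightarrow> R \<subseteq> R' \<Longrightarrow> R' = R"
begin

lemma R_1: "1 \<in> R" and R_diff: "x \<in> R \<Longrightarrow> y \<in> R \<Longrightarrow> x - y \<in> R"
  and R_mult: "x \<in> R \<Longrightarrow> y \<in> R \<Longrightarrow> x * y \<in> R"
  and R_quot: "c \<noteq> 0 \<Longrightarrow> \<iota> b / \<iota> c \<in> R \<longleftrightarrow> v b \<le> v c"
  using dom by (simp_all add: dominating_def)

lemma R_0: "0 \<in> R" using R_diff[OF R_1 R_1] by simp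

lemma R_add: "x \<in> R \<Longrightarrow> y \<in> R \<Longrightarrow> x + y \<in> R"
  using R_diff[of x "0 - y"] R_diff[OF R_0, of y] by simp

lemma R_power: "x \<in> R \<Longrightarrow> x ^ n \<in> R"
  by (induction n) (auto intro: R_1 R_mult)

text \<open>The ideal generated by the elements of the fraction field with norm less than 1. A single
  product suffices, because of two such elements one divides the other in \<open>R\<close>.\<close>

definition J :: "'f set" where
  "J = {\<iota> b / \<iota> c * r | b c r. v b < v c \<and> r \<in> R}"

lemma J_mult: "x \<in> J \<Longrightarrow> y \<in> R \<Longrightarrow> x * y \<in> J"
  unfolding J_def using R_mult by (clarsimp, metis mult.assoc times_divide_eq_left)

lemma J_0: "0 \<in> J"
  unfolding J_def using R_0 v_pos[of 1] v_eq_0_iff[of 0]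
  by (intro CollectI exI[of _ 0] exI[of _ 1]) auto

lemma J_subset: "x \<in> J \<Longrightarrow> x \<in> R"
  unfolding J_def using R_mult R_quot v_eq_0_iff v_nonneg by (auto, smt (verit) times_divide_eq_left)

lemma J_add_of_le:
  assumes "v b < v c" "v b' < v c'" "r \<in> R" "r' \<in> R" "v (b * c') \<le> v (b' * c)"
  shows "\<iota> b / \<iota> c * r + \<iota> b' / \<iota> c' * r' \<in> J"
proof (cases "b' = 0")
  case True
  then have "v (b * c') \<le> 0" using assms(5) v_eq_0_iff[of 0] by simp
  then have "b * c' = 0" using v_pos[of "b * c'"] by fastforce
  moreover have "c' \<noteq> 0" using assms(2) v_nonneg[of b'] v_eq_0_iff[of c'] by auto
  ultimately show ?thesis using True J_0 by simp
next
  case False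
  have c: "c \<noteq> 0" "c' \<noteq> 0"
    using assms(1,2) v_nonneg[of b'] v_nonneg[of b] v_eq_0_iff[of c] v_eq_0_iff[of c'] by auto
  have q: "\<iota> (b * c') / \<iota> (b' * c) \<in> R" using R_quot assms(5) False c by simp
  have "\<iota> b / \<iota> c * r + \<iota> b' / \<iota> c' * r' = \<iota> b' / \<iota> c' * (\<iota> (b * c') / \<iota> (b' * c) * r + r')"
    using c False by (simp add: \<iota>.hom_mult field_simps)
  moreover have "\<iota> (b * c') / \<iota> (b' * c) * r + r' \<in> R" using q assms R_add R_mult by blast
  ultimately show ?thesis unfolding J_def using assms(2) by blast
qed

lemma J_add: "x \<in> J \<Longrightarrow> y \<in> J \<Longrightarrow> x + y \<in> J"
proof -
  assume "x \<in> J" "y \<in> J"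
  then obtain b c r b' c' r' where x: "x = \<iota> b / \<iota> c * r" "v b < v c" "r \<in> R"
    and y: "y = \<iota> b' / \<iota> c' * r'" "v b' < v c'" "r' \<in> R"
    unfolding J_def by blast
  show "x + y \<in> J"
    using J_add_of_le[OF x(2) y(2) x(3) y(3)] J_add_of_le[OF y(2) x(2) y(3) x(3)] x(1) y(1)
    by (metis add.commute linear)
qed

lemma J_1: "1 \<notin> J"
proof
  assume "1 \<in> J"
  then obtain b c r where 1: "1 = \<iota> b / \<iota> c * r" "v b < v c" "r \<in> R" unfolding J_def by blast
  have bc: "b \<noteq> 0" "c \<noteq> 0" using 1 by auto
  then have "r = \<iota> c / \<iota> b" using 1(1) by (simp add: field_simps)
  then have "v c \<le> v b" using R_quot[of b c] bc 1 by simp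
  then show False using 1 by simp
qed

text \<open>By maximality the ring generated by \<open>z\<close> is not dominating, so it contains an
  element \<open>\<iota> b / \<iota> c\<close> of norm greater than 1, written as a polynomial in
  \<open>z\<close>; divide by this element.\<close>

lemma one_as_poly_in_J:
  assumes z: "z \<notin> R"
  shows "\<exists>q. (\<forall>n. coeff q n \<in> J) \<and> poly q z = 1"
proof -
  define R' where "R' = {poly p z | p. \<forall>n. coeff p n \<in> R}"
  have sub: "R \<subseteq> R'"
  proof
    fix r assume "r \<in> R"
    then have "\<forall>n. coeff [:r:] n \<in> R" using R_0 by (auto simp: coeff_pCons split: nat.split)
    then show "r \<in> R'" unfolding R'_def by (intro CollectI exI[of _ "[:r:]"]) auto
  qed
  have "\<forall>n. coeff [:0, 1:] n \<in> R" using R_0 R_1 by (auto simp: coeff_pCons split: nat.split)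
  then have zR': "z \<in> R'" unfolding R'_def by (intro CollectI exI[of _ "[:0, 1:]"]) auto
  have ring: "x - y \<in> R' \<and> x * y \<in> R'" if "x \<in> R'" "y \<in> R'" for x y
  proof -
    obtain p q where p: "x = poly p z" "\<forall>n. coeff p n \<in> R" and q: "y = poly q z" "\<forall>n. coeff q n \<in> R"
      using \<open>x \<in> R'\<close> \<open>y \<in> R'\<close> unfolding R'_def by auto
    have sumR: "sum f A \<in> R" if "\<And>x. x \<in> A \<Longrightarrow> f x \<in> R" for f and A :: "nat set"
      using that by (induction A rule: infinite_finite_induct) (auto intro: R_0 R_add)
    have "\<forall>n. coeff (p - q) n \<in> R" using p q R_diff by simp
    moreover have "\<forall>n. coeff (p * q) n \<in> R"
      unfolding coeff_mult using p q by (auto intro!: sumR R_mult)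
    moreover have "x - y = poly (p - q) z" "x * y = poly (p * q) z" using p q by simp_all
    ultimately show ?thesis unfolding R'_def by blast
  qed
  have "\<not> dominating R'" 
  proof
    assume "dominating R'"
    then have "R' = R" by (rule maximal[OF _ sub])
    then show False using zR' z by simp
  qed
  moreover have "1 \<in> R'" using R_1 sub by (rule subsetD[rotated])
  ultimately obtain b c where c: "c \<noteq> 0" and ne: "(\<iota> b / \<iota> c \<in> R') \<noteq> (v b \<le> v c)"
    using ring unfolding dominating_def by metis
  then have in': "\<iota> b / \<iota> c \<in> R'" "v c < v b" using R_quot[OF c, of b] sub by auto
  then obtain p where p: "\<iota> b / \<iota> c = poly p z" "\<forall>n. coeff p n \<in> R" unfolding R'_def by blast
  have b: "b \<noteq> 0" using in'(2) v_nonneg[of c] v_eq_0_iff[of b] by auto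
  define q where "q = smult (\<iota> c / \<iota> b) p"
  have "\<forall>n. coeff q n \<in> J" unfolding q_def J_def using p(2) in'(2) by auto
  moreover have "poly q z = 1" unfolding q_def using p(1)[symmetric] b c by simp
  ultimately show ?thesis by blast
qed

lemma poly_with_coeffs_in_J:
  assumes "\<forall>n. coeff q n \<in> J" "x \<in> R" shows "poly q x \<in> J"
  using assms
proof (induction q)
  case (pCons a q)
  have "coeff q n \<in> J" for n using pCons.prems(1) by (metis coeff_pCons_Suc)
  moreover have "a \<in> J" using pCons.prems(1) by (metis coeff_pCons_0)
  ultimately show ?case using pCons J_add[of a "x * poly q x"] J_mult[of "poly q x" x]
    by (simp add: mult.commute)
qed (simp add: J_0)

lemma reflect_poly_J: "\<forall>n. coeff q n \<in> J \<Longrightarrow> \<forall>n. coeff (reflect_poly q) n \<in> J"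
  by (simp add: coeff_reflect_poly J_0)

text \<open>If the inverse of \<open>u = 1 - a\<close> were missing, then 1 would be a polynomial in this
  inverse with coefficients in \<open>J\<close>; clearing denominators puts a power of
  \<open>u\<close>, which is congruent to 1, into \<open>J\<close>.\<close>

lemma inverse_one_minus_J:
  assumes a: "a \<in> J"
  shows "inverse (1 - a) \<in> R"
proof (rule ccontr)
  define u where "u = 1 - a"
  assume "inverse (1 - a) \<notin> R"
  then obtain q where q: "\<forall>n. coeff q n \<in> J" "poly q (inverse u) = 1"
    using one_as_poly_in_J unfolding u_def by blast
  have u0: "u \<noteq> 0" using a J_1 by (auto simp: u_def)
  have uR: "u \<in> R" unfolding u_def using a J_subset R_1 R_diff by blast
  have "u ^ degree q = poly (reflect_poly q) u" using poly_reflect_poly_nz[OF u0, of q] q(2) by simp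
  then have 1: "u ^ degree q \<in> J" using poly_with_coeffs_in_J[OF reflect_poly_J[OF q(1)] uR] by simp
  have 2: "1 - u ^ n \<in> J" for n
  proof (induction n)
    case (Suc n)
    have "1 - u ^ Suc n = (1 - u ^ n) * u + a" by (simp add: u_def algebra_simps)
    then show ?case using Suc uR a J_add J_mult by simp
  qed (simp add: J_0)
  have "1 \<in> J" using J_add[OF 1 2[of "degree q"]] by simp
  then show False using J_1 by simp
qed

text \<open>The relation for \<open>inverse z\<close>, made monic by inverting the unit \<open>1 - coeff q
  0\<close>, expresses \<open>z ^ degree q\<close> by lower powers of \<open>z\<close>, and this
  eliminates the leading term of \<open>p\<close>.\<close>

lemma lower_degree:
  assumes z: "z \<noteq> 0" and p: "\<forall>n. coeff p n \<in> J" "poly p z = 1"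
    and q: "\<forall>n. coeff q n \<in> J" "poly q (inverse z) = 1"
    and le: "degree q \<le> degree p"
  shows "\<exists>p'. (\<forall>n. coeff p' n \<in> J) \<and> poly p' z = 1 \<and> degree p' < degree p"
proof -
  obtain c q1 where qc: "q = pCons c q1" by (cases q)
  have cJ: "c \<in> J" using q(1) qc by (metis coeff_pCons_0)
  have q1J: "\<forall>n. coeff q1 n \<in> J" using q(1) qc by (metis coeff_pCons_Suc)
  have q10: "q1 \<noteq> 0" using q(2) qc cJ J_1 by auto
  define m where "m = degree q1"
  have degq: "degree q = Suc m" using qc q10 by (simp add: m_def)
  define u where "u = inverse (1 - c)"
  have uR: "u \<in> R" unfolding u_def using inverse_one_minus_J[OF cJ] .
  have u1: "u * (1 - c) = 1" unfolding u_def using cJ J_1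
    by (metis eq_iff_diff_eq_0 left_inverse)
  have "1 - c = inverse z * poly q1 (inverse z)" using q(2) qc by (simp add: algebra_simps)
  then have "z ^ Suc m * (1 - c) = z ^ m * poly q1 (inverse z)" using z by simp
  also have "\<dots> = poly (reflect_poly q1) z" using poly_reflect_poly_nz[OF z, of q1] by (simp add: m_def)
  finally have zm: "z ^ Suc m = u * poly (reflect_poly q1) z"
    using u1 by (metis mult.assoc mult.commute mult.right_neutral)
  define n where "n = degree p"
  define a where "a = coeff p n"
  define d where "d = n - Suc m"
  have nd: "n = d + Suc m" using le degq by (simp add: d_def n_def)
  define s where "s = monom (a * u) d * reflect_poly q1"
  define p' where "p' = p - monom a n + s"
  have sJ: "coeff s k \<in> J" for k
    unfolding s_def coeff_monom_mult using p(1) J_mult uR reflect_poly_J[OF q1J] J_subset J_0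
    by (auto simp: a_def)
  have "poly p' z = 1 - a * z ^ n + a * (z ^ d * (u * poly (reflect_poly q1) z))"
    using p(2) by (simp add: p'_def s_def poly_monom mult_ac)
  also have "\<dots> = 1" unfolding zm[symmetric] nd by (simp add: power_add mult_ac)
  finally have 1: "poly p' z = 1" .
  have 2: "\<forall>k. coeff p' k \<in> J"
  proof
    fix k
    have "coeff (p - monom a n) k \<in> J" using p(1) J_0 by (auto simp: a_def)
    then show "coeff p' k \<in> J" unfolding p'_def coeff_add using J_add sJ by blast
  qed
  have "coeff p' k = 0" if "k \<ge> n" for k
  proof -
    have "degree (reflect_poly q1) \<le> m" by (simp add: m_def degree_reflect_poly_le)
    moreover have "k - d > m" "\<not> k < d" using nd that by auto
    ultimately have "coeff s k = 0" unfolding s_def by (simp add: coeff_monom_mult coeff_eq_0)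
    moreover have "coeff (p - monom a n) k = 0"
      using that by (cases "k = n") (auto simp: a_def n_def coeff_eq_0)
    ultimately show ?thesis by (simp add: p'_def)
  qed
  moreover have "n > 0" using nd by simp
  ultimately have "degree p' < n" by (metis degree_0 leading_coeff_0_iff not_le)
  then show ?thesis using 1 2 n_def by blast
qed

text \<open>If neither \<open>z\<close> nor its inverse were in \<open>R\<close>, both would satisfy a
  relation as in \<open>one_as_poly_in_J\<close>, and the degrees of these relations could be
  lowered forever.\<close>

lemma valuation_ring: "z \<in> R \<or> inverse z \<in> R"
proof (cases "z = 0")
  case True
  then show ?thesis using R_0 by simp
next
  case z: False
  have no: "False" if "\<forall>n. coeff p n \<in> J" "poly p x = 1" "\<forall>n. coeff q n \<in> J" "poly q (inverse x) = 1"
     "x \<noteq> 0" for p q x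
    using that
  proof (induction "degree p + degree q" arbitrary: p q x rule: less_induct)
    case less
    show False
    proof (cases "degree q \<le> degree p")
      case True
      then show False using less lower_degree[of x p q] by (metis add_less_mono1)
    next
      case False
      then have "degree p \<le> degree q" by simp
      moreover have "inverse x \<noteq> 0" "poly p (inverse (inverse x)) = 1" using less.prems by auto
      ultimately obtain q' where "\<forall>n. coeff q' n \<in> J" "poly q' (inverse x) = 1" "degree q' < degree q"
        using lower_degree[of "inverse x" q p] less.prems by metis
      then show False using less.hyps[of p q' x] less.prems by simp
    qed
  qed
  show ?thesis
    using one_as_poly_in_J[of z] one_as_poly_in_J[of "inverse z"] no[of _ z] z by blast
qed

text \<open>Having the same value in the valuation defined by \<open>R\<close>, without naming its value
  group.\<close>

definition assoc :: "'f \<Rightarrow> 'f \<Rightarrow> bool" where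
  "assoc x y \<longleftrightarrow> x \<noteq> 0 \<and> y \<noteq> 0 \<and> x / y \<in> R \<and> y / x \<in> R"

lemma assoc_refl: "x \<noteq> 0 \<Longrightarrow> assoc x x"
  by (simp add: assoc_def R_1)

lemma assoc_sym: "assoc x y \<Longrightarrow> assoc y x"
  by (auto simp: assoc_def)

lemma assoc_trans: "assoc x y \<Longrightarrow> assoc y z \<Longrightarrow> assoc x z"
  using R_mult[of "x / y" "y / z"] R_mult[of "z / y" "y / x"] by (auto simp: assoc_def)

lemma assoc_mult: "assoc x y \<Longrightarrow> assoc x' y' \<Longrightarrow> assoc (x * x') (y * y')"
  using R_mult[of "x / y" "x' / y'"] R_mult[of "y / x" "y' / x'"] by (auto simp: assoc_def)

lemma assoc_inverse: "assoc x y \<Longrightarrow> assoc (inverse x) (inverse y)"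
  by (auto simp: assoc_def field_simps)

lemma assoc_power: "assoc x y \<Longrightarrow> assoc (x ^ n) (y ^ n)"
  using R_power[of "x / y" n] R_power[of "y / x" n] by (auto simp: assoc_def power_divide)

lemma assoc_R: "assoc x y \<Longrightarrow> x \<in> R \<longleftrightarrow> y \<in> R"
  using R_mult[of "x / y" y] R_mult[of "y / x" x] by (auto simp: assoc_def)

lemma assoc_iota:
  assumes "b \<noteq> 0" "c \<noteq> 0"
  shows "assoc (\<iota> b) (\<iota> c) \<longleftrightarrow> v b = v c"
  using R_quot[of c b] R_quot[of b c] assms by (auto simp: assoc_def)

lemma R_root: assumes "z ^ n \<in> R" "n > 0" shows "z \<in> R"
proof (rule ccontr)
  assume z: "z \<notin> R"
  then have z0: "z \<noteq> 0" using R_0 by auto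
  have "z = z ^ n * inverse z ^ (n - 1)"
    using z0 assms(2) by (cases n) (auto simp: field_simps)
  moreover have "z ^ n * inverse z ^ (n - 1) \<in> R"
    using valuation_ring[of z] z assms(1) R_power R_mult by blast
  ultimately show False using z by simp
qed

lemma dominant_term:
  assumes "finite I" "I \<noteq> {}" "\<And>i. i \<in> I \<Longrightarrow> f i \<noteq> (0::'f)"
  shows "\<exists>i\<^sub>0\<in>I. \<forall>i\<in>I. f i / f i\<^sub>0 \<in> R"
  using assms
proof (induction I rule: finite_ne_induct)
  case (singleton x)
  then show ?case using R_1 by simp
next
  case (insert x F)
  then obtain i0 where i0: "i0 \<in> F" "\<forall>i\<in>F. f i / f i0 \<in> R" by auto
  have nz: "f x \<noteq> 0" "f i0 \<noteq> 0" using insert i0 by auto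
  show ?case
  proof (cases "f x / f i0 \<in> R")
    case True
    then show ?thesis using i0 by blast
  next
    case False
    then have *: "f i0 / f x \<in> R" using valuation_ring[of "f x / f i0"] by simp
    have "f i / f x \<in> R" if "i \<in> F" for i
      using R_mult[OF i0(2)[rule_format, OF that] *] nz by simp
    then show ?thesis using R_1 nz by auto
  qed
qed

lemma nonunit_add:
  assumes "x \<in> R" "y \<in> R" "x \<noteq> 0 \<longrightarrow> inverse x \<notin> R" "y \<noteq> 0 \<longrightarrow> inverse y \<notin> R"
  shows "x + y \<noteq> 0 \<longrightarrow> inverse (x + y) \<notin> R"
proof (intro impI notI)
  assume s: "x + y \<noteq> 0" "inverse (x + y) \<in> R"
  have *: False if "a \<noteq> 0" "inverse a \<notin> R" "b / a \<in> R" "inverse (a + b) \<in> R" "a + b \<noteq> 0" for a b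
  proof -
    have "inverse a = (1 + b / a) * inverse (a + b)"
      using that by (simp add: field_simps)
    then show False using that R_mult R_add R_1 by metis
  qed
  consider "x = 0" | "y = 0" | "x \<noteq> 0" "y \<noteq> 0" by blast
  then show False
  proof cases
    case 3
    then show False using *[of x y] *[of y x] s assms valuation_ring[of "x / y"]
      by (auto simp: add.commute)
  qed (use s assms in auto)
qed

text \<open>In an ultrametric sum that vanishes, the largest value is attained twice.\<close>

lemma assoc_terms_of_zero_sum:
  assumes "finite I" "I \<noteq> {}" "\<And>i. i \<in> I \<Longrightarrow> f i \<noteq> (0::'f)" "(\<Sum>i\<in>I. f i) = 0"
  shows "\<exists>i\<in>I. \<exists>j\<in>I. i \<noteq> j \<and> assoc (f i) (f j)"
proof (rule ccontr)
  assume no: "\<not> ?thesis"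
  obtain j where j: "j \<in> I" "\<forall>i\<in>I. f i / f j \<in> R" 
    using dominant_term[of I f] assms(1-3) by metis
  have nu: "f i / f j \<in> R \<and> (f i / f j \<noteq> 0 \<longrightarrow> inverse (f i / f j) \<notin> R)" if "i \<in> I - {j}" for i
    using that no j assms(3) by (auto simp: assoc_def)
  have "sum (\<lambda>i. f i / f j) A \<in> R \<and> (sum (\<lambda>i. f i / f j) A \<noteq> 0 \<longrightarrow> inverse (sum (\<lambda>i. f i / f j) A) \<notin> R)"
    if "A \<subseteq> I - {j}" "finite A" for A
    using that(2,1)
  proof (induction A rule: finite_induct)
    case empty
    then show ?case using R_0 by simp
  next
    case (insert x F)
    then show ?case using nu[of x] nonunit_add[of "f x / f j" "sum (\<lambda>i. f i / f j) F"] R_add by auto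
  qed
  then have *: "sum (\<lambda>i. f i / f j) (I - {j}) \<noteq> 0 \<longrightarrow> inverse (sum (\<lambda>i. f i / f j) (I - {j})) \<notin> R"
    using assms(1) by blast
  have "sum (\<lambda>i. f i / f j) I = 0" using assms(4) by (simp add: sum_divide_distrib[symmetric])
  then have "sum (\<lambda>i. f i / f j) (I - {j}) = - 1"
    using sum.remove[OF assms(1) j(1), of "\<lambda>i. f i / f j"] assms(3)[OF j(1)]
    by (simp add: add_eq_0_iff)
  then show False using * R_diff[OF R_0 R_1] by simp
qed

text \<open>Some power of \<open>z\<close> has the value of an element of the fraction field, which
  determines what the norm of \<open>z\<close> has to be.\<close>

definition has_value :: "'f \<Rightarrow> real \<Rightarrow> bool" where
  "has_value z r \<longleftrightarrow> r > 0 \<and> (\<exists>n>0. \<exists>b c. b \<noteq> 0 \<and> c \<noteq> 0 \<and> assoc (z ^ n) (\<iota> b / \<iota> c) \<and> r ^ n = v b / v c)"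

lemma has_valueI:
  assumes "n > 0" "b \<noteq> 0" "c \<noteq> 0" "assoc (z ^ n) (\<iota> b / \<iota> c)"
  shows "\<exists>r. has_value z r"
proof -
  have pos: "v b / v c > 0" using assms v_pos by simp
  then have "root n (v b / v c) > 0" "root n (v b / v c) ^ n = v b / v c"
    using assms(1) real_root_pow_pos2[OF assms(1)] by auto
  then show ?thesis unfolding has_value_def using assms by blast
qed

text \<open>Two terms of an algebraic equation have the same value, so a power of \<open>z\<close> has the
  value of a quotient of coefficients.\<close>

lemma has_value_algebraic:
  assumes z: "z \<noteq> 0" and p: "p \<noteq> 0" "poly (map_poly \<iota> p) z = 0"
  shows "\<exists>r. has_value z r"
proof -
  define I where "I = {i. coeff p i \<noteq> 0}"
  define f where "f i = \<iota> (coeff p i) * z ^ i" for i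
  have I: "I \<subseteq> {..degree p}" unfolding I_def using le_degree by auto
  have fin: "finite I" using I finite_subset by blast
  have ne: "I \<noteq> {}" using p(1) by (auto simp: I_def intro: exI[of _ "degree p"])
  have "(\<Sum>i\<in>I. f i) = (\<Sum>i\<le>degree p. f i)"
    by (rule sum.mono_neutral_left) (use I in \<open>auto simp: I_def f_def\<close>)
  also have "\<dots> = 0" using p(2) by (simp add: poly_altdef f_def)
  finally have s: "(\<Sum>i\<in>I. f i) = 0" .
  have nz: "f i \<noteq> 0" if "i \<in> I" for i using that z by (simp add: I_def f_def)
  obtain i j where ij: "i \<in> I" "j \<in> I" "i \<noteq> j" "assoc (f i) (f j)"
    using assoc_terms_of_zero_sum[of I f] fin ne nz s by metis
  have *: "\<exists>r. has_value z r" if "i \<in> I" "j \<in> I" "i < j" "assoc (f i) (f j)" for i j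
  proof -
    have "\<iota> (coeff p j) * z ^ i \<noteq> 0" using that z by (simp add: I_def)
    have nz': "\<iota> (coeff p j) \<noteq> 0" "z ^ i \<noteq> 0" "\<iota> (coeff p i) \<noteq> 0" using that z by (auto simp: I_def)
    have "assoc (f j * inverse (\<iota> (coeff p j) * z ^ i)) (f i * inverse (\<iota> (coeff p j) * z ^ i))"
      by (rule assoc_mult[OF assoc_sym[OF that(4)] assoc_refl]) (use nz' in simp)
    moreover have "f j * inverse (\<iota> (coeff p j) * z ^ i) = z ^ (j - i)"
      using z nz'(1) that(3) by (simp add: f_def power_diff divide_inverse inverse_mult_distrib mult_ac)
    moreover have "f i * inverse (\<iota> (coeff p j) * z ^ i) = \<iota> (coeff p i) / \<iota> (coeff p j)"
      using z nz'(1) by (simp add: f_def field_simps)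
    ultimately show ?thesis
      using that by (intro has_valueI[of "j - i" "coeff p i" "coeff p j"]) (auto simp: I_def)
  qed
  show ?thesis using *[of i j] *[of j i] ij assoc_sym by (metis linorder_neqE_nat)
qed

lemma has_value_unique: assumes "has_value z r" "has_value z r'" shows "r = r'"
proof -
  obtain n b c n' b' c' where 1: "n > 0" "b \<noteq> 0" "c \<noteq> 0" "assoc (z ^ n) (\<iota> b / \<iota> c)" "r ^ n = v b / v c"
    and 2: "n' > 0" "b' \<noteq> 0" "c' \<noteq> 0" "assoc (z ^ n') (\<iota> b' / \<iota> c')" "r' ^ n' = v b' / v c'"
    and r: "r > 0" "r' > 0"
    using assms unfolding has_value_def by blast
  have "assoc ((\<iota> b / \<iota> c) ^ n') ((z ^ n) ^ n')" using assoc_sym[OF assoc_power[OF 1(4)]] .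
  moreover have "(z ^ n) ^ n' = (z ^ n') ^ n" by (simp add: power_mult[symmetric] mult.commute)
  ultimately have "assoc ((\<iota> b / \<iota> c) ^ n') ((\<iota> b' / \<iota> c') ^ n)"
    using assoc_power[OF 2(4), of n] assoc_trans by metis
  then have "assoc ((\<iota> b / \<iota> c) ^ n' * \<iota> (c ^ n' * c' ^ n)) ((\<iota> b' / \<iota> c') ^ n * \<iota> (c ^ n' * c' ^ n))"
    by (rule assoc_mult) (use 1 2 in \<open>auto intro!: assoc_refl\<close>)
  moreover have "(\<iota> b / \<iota> c) ^ n' * \<iota> (c ^ n' * c' ^ n) = \<iota> (b ^ n' * c' ^ n)"
    "(\<iota> b' / \<iota> c') ^ n * \<iota> (c ^ n' * c' ^ n) = \<iota> (b' ^ n * c ^ n')"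
    using 1 2 by (simp_all add: power_divide \<iota>.hom_mult \<iota>.hom_power)
  ultimately have "v (b ^ n' * c' ^ n) = v (b' ^ n * c ^ n')" using assoc_iota 1 2 by simp
  then have "v b ^ n' * v c' ^ n = v b' ^ n * v c ^ n'" by (simp add: v_mult v_power)
  then have "(v b / v c) ^ n' = (v b' / v c') ^ n"
    using v_pos[OF 1(3)] v_pos[OF 2(3)] by (simp add: power_divide frac_eq_eq)
  then have "r ^ (n * n') = r' ^ (n * n')"
    unfolding 1(5)[symmetric] 2(5)[symmetric] by (simp add: power_mult[symmetric] mult.commute)
  then show ?thesis using r 1(1) 2(1) by (intro power_eq_imp_eq_base[of r "n * n'" r']) auto
qed

lemma has_value_mult: assumes "has_value z r" "has_value z' r'" shows "has_value (z * z') (r * r')"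
proof -
  obtain n b c n' b' c' where 1: "n > 0" "b \<noteq> 0" "c \<noteq> 0" "assoc (z ^ n) (\<iota> b / \<iota> c)" "r ^ n = v b / v c"
    and 2: "n' > 0" "b' \<noteq> 0" "c' \<noteq> 0" "assoc (z' ^ n') (\<iota> b' / \<iota> c')" "r' ^ n' = v b' / v c'"
    and r: "r > 0" "r' > 0"
    using assms unfolding has_value_def by blast
  have "assoc ((z ^ n) ^ n' * (z' ^ n') ^ n) ((\<iota> b / \<iota> c) ^ n' * (\<iota> b' / \<iota> c') ^ n)"
    using assoc_mult[OF assoc_power[OF 1(4)] assoc_power[OF 2(4)]] .
  moreover have "(z ^ n) ^ n' * (z' ^ n') ^ n = (z * z') ^ (n * n')"
    by (simp add: power_mult[symmetric] power_mult_distrib mult.commute)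
  moreover have "(\<iota> b / \<iota> c) ^ n' * (\<iota> b' / \<iota> c') ^ n = \<iota> (b ^ n' * b' ^ n) / \<iota> (c ^ n' * c' ^ n)"
    by (simp add: power_divide \<iota>.hom_mult \<iota>.hom_power)
  moreover have "(r * r') ^ (n * n') = (r ^ n) ^ n' * (r' ^ n') ^ n"
    by (simp add: power_mult[symmetric] power_mult_distrib mult.commute)
  then have "(r * r') ^ (n * n') = v (b ^ n' * b' ^ n) / v (c ^ n' * c' ^ n)"
    unfolding 1(5) 2(5) by (simp add: v_mult v_power power_divide)
  ultimately show ?thesis unfolding has_value_def using 1 2 r
    by (intro conjI exI[of _ "n * n'"] exI[of _ "b ^ n' * b' ^ n"] exI[of _ "c ^ n' * c' ^ n"]) auto
qed

lemma has_value_inverse: assumes "has_value z r" shows "has_value (inverse z) (inverse r)"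
proof -
  obtain n b c where 1: "n > 0" "b \<noteq> 0" "c \<noteq> 0" "assoc (z ^ n) (\<iota> b / \<iota> c)" "r ^ n = v b / v c" "r > 0"
    using assms unfolding has_value_def by blast
  have "assoc (inverse z ^ n) (\<iota> c / \<iota> b)"
    using assoc_inverse[OF 1(4)] by (simp add: power_inverse)
  moreover have "inverse r ^ n = v c / v b" using 1(5) by (simp add: power_inverse)
  ultimately show ?thesis unfolding has_value_def using 1 by (metis positive_imp_inverse_positive)
qed

lemma has_value_iota: "b \<noteq> 0 \<Longrightarrow> has_value (\<iota> b) (v b)"
  unfolding has_value_def using v_pos
  by (intro conjI exI[of _ 1] exI[of _ b]) (auto intro!: exI[of _ 1] assoc_refl simp: v_1)

lemma has_value_le_1_iff: assumes "has_value z r" shows "r \<le> 1 \<longleftrightarrow> z \<in> R"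
proof -
  obtain n b c where 1: "n > 0" "b \<noteq> 0" "c \<noteq> 0" "assoc (z ^ n) (\<iota> b / \<iota> c)" "r ^ n = v b / v c" "r > 0"
    using assms unfolding has_value_def by blast
  have "r \<le> 1 \<longleftrightarrow> r ^ n \<le> 1" using power_le_one_iff[of r n] 1(1,6) by simp
  also have "\<dots> \<longleftrightarrow> v b \<le> v c" unfolding 1(5) using v_pos[OF 1(3)] by simp
  also have "\<dots> \<longleftrightarrow> z ^ n \<in> R" using R_quot[OF 1(3)] assoc_R[OF 1(4)] by simp
  also have "\<dots> \<longleftrightarrow> z \<in> R" using R_root[OF _ 1(1)] R_power by blast
  finally show ?thesis .
qed

lemma abs_value_extends:
  assumes ex: "\<And>z. z \<noteq> 0 \<Longrightarrow> \<exists>r. has_value z r"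
  shows "\<exists>w. nonarch_abs_value w \<and> (\<forall>b. w (\<iota> b) = v b)"
proof -
  define w where "w z = (if z = 0 then 0 else SOME r. has_value z r)" for z
  have hv: "has_value z (w z)" if "z \<noteq> 0" for z
    using ex[OF that] that by (auto simp: w_def intro: someI)
  have weq: "w z = r" if "has_value z r" "z \<noteq> 0" for z r
    using has_value_unique[OF hv[OF that(2)] that(1)] .
  have pos: "w z > 0" if "z \<noteq> 0" for z using hv[OF that] by (simp add: has_value_def)
  have w0: "w 0 = 0" by (simp add: w_def)
  have mult: "w (x * y) = w x * w y" for x y
    using weq[OF has_value_mult[OF hv hv], of x y] by (cases "x = 0 \<or> y = 0") (auto simp: w0)
  have le1: "w z \<le> 1 \<longleftrightarrow> z \<in> R" for z
    using has_value_le_1_iff[OF hv, of z] R_0 by (cases "z = 0") (auto simp: w0)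
  have ultra: "w (x + y) \<le> w y" if "w x \<le> w y" for x y
  proof (cases "y = 0")
    case True
    then show ?thesis using that pos[of x] by (cases "x = 0") (auto simp: w0)
  next
    case False
    have "w (x / y) * w y = w x" using mult[of "x / y" y] False by simp
    then have "w (x / y) \<le> 1" using that pos[OF False]
      by (metis mult.left_neutral mult_le_cancel_right_pos)
    then have "x / y + 1 \<in> R" using le1 R_add R_1 by blast
    then have "w (x / y + 1) * w y \<le> w y" using le1 pos[OF False] by simp
    moreover have "w (x / y + 1) * w y = w (x + y)"
      using mult[of "x / y + 1" y] False by (simp add: distrib_right)
    ultimately show ?thesis by simp
  qed
  have "nonarch_abs_value w"
  proof
    fix x y
    show "0 \<le> w x" using pos[of x] w0 by (cases "x = 0") auto
    show "w x = 0 \<longleftrightarrow> x = 0" using pos[of x] w0 by (cases "x = 0") auto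
    show "w (x * y) = w x * w y" by (rule mult)
    show "w (x + y) \<le> max (w x) (w y)"
      using ultra[of x y] ultra[of y x] by (cases "w x \<le> w y") (auto simp: add.commute max_def)
  qed
  moreover have "w (\<iota> b) = v b" for b
    using weq[OF has_value_iota, of b] v_eq_0_iff[of 0] by (cases "b = 0") (auto simp: w0)
  ultimately show ?thesis by blast
qed

end

section \<open>Points over a dense subfield\<close>

locale dense_valued_extension =
  a: nonarch_abs_value va + c: nonarch_abs_value vc + l: field_hom l
  for va :: "'a::field \<Rightarrow> real" and vc :: "'c::field \<Rightarrow> real" and l :: "'a \<Rightarrow> 'c" +
  assumes vc_l: "vc (l a) = va a"
    and dense: "\<epsilon> > 0 \<Longrightarrow> \<exists>a. vc (z - l a) < \<epsilon>"
begin

interpretation lp: map_poly_inj_idom_hom l ..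

lemma conv_approx: "\<exists>b. c.conv (\<lambda>n. l (b n)) z"
proof -
  have "\<exists>b. vc (z - l b) < 1 / (real n + 1)" for n :: nat by (rule dense) simp
  then obtain b where b: "\<And>n. vc (z - l (b n)) < 1 / (real n + 1)" by metis
  have "c.conv (\<lambda>n. l (b n)) z"
  proof (rule c.conv_comparison)
    show "vc (l (b n) - z) \<le> 1 / (real n + 1)" for n
      using less_imp_le[OF b[of n]] by (simp add: c.v_commute)
    show "(\<lambda>n. 1 / (real n + 1)) \<longlonglongrightarrow> 0" by real_asymp
  qed
  then show ?thesis by blast
qed

lemma poly_norm_map: "c.poly_norm r (map_poly l Q) = a.poly_norm r Q"
  by (induction Q) (auto simp: l.map_poly_pCons_hom vc_l)

lemma poly_approx:
  assumes "0 \<le> r" "\<epsilon> > 0"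
  shows "\<exists>Q. c.poly_norm r (P - map_poly l Q) < \<epsilon>"
  using assms(2)
proof (induction P arbitrary: \<epsilon>)
  case 0
  then show ?case by (intro exI[of _ 0]) auto
next
  case (pCons z P)
  have "\<epsilon> / (2 * (r + 1)) > 0" using assms(1) pCons.prems by simp
  then obtain Q where Q: "c.poly_norm r (P - map_poly l Q) < \<epsilon> / (2 * (r + 1))"
    using pCons.IH by blast
  obtain b where b: "vc (z - l b) < \<epsilon> / 2" using dense[of "\<epsilon> / 2" z] pCons.prems by auto
  have "r * c.poly_norm r (P - map_poly l Q) \<le> r * (\<epsilon> / (2 * (r + 1)))"
    using Q assms(1) by (intro mult_left_mono) auto
  also have "\<dots> \<le> \<epsilon> / 2" using assms(1) pCons.prems by (simp add: field_simps)
  finally have "c.poly_norm r (pCons z P - map_poly l (pCons b Q)) < \<epsilon>"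
    using b by (simp add: l.map_poly_pCons_hom)
  then show ?case by blast
qed

lemma poly_approx_seq:
  assumes "0 \<le> r"
  shows "\<exists>Q. (\<lambda>n. c.poly_norm r (P - map_poly l (Q n))) \<longlonglongrightarrow> 0"
proof -
  have "\<exists>Q. c.poly_norm r (P - map_poly l Q) < 1 / (real n + 1)" for n :: nat
    by (rule poly_approx[OF assms]) simp
  then obtain Q where Q: "\<And>n. c.poly_norm r (P - map_poly l (Q n)) < 1 / (real n + 1)" by metis
  have "(\<lambda>n. 1 / (real n + 1)) \<longlonglongrightarrow> 0" by real_asymp
  then have "(\<lambda>n. c.poly_norm r (P - map_poly l (Q n))) \<longlonglongrightarrow> 0"
  proof (rule tendsto_sandwich[rotated 3])
    show "(\<lambda>n. 0) \<longlonglongrightarrow> (0::real)" by simp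
    show "\<forall>\<^sub>F n in sequentially. 0 \<le> c.poly_norm r (P - map_poly l (Q n))"
      using c.poly_norm_nonneg[OF assms] by simp
    show "\<forall>\<^sub>F n in sequentially. c.poly_norm r (P - map_poly l (Q n)) \<le> 1 / (real n + 1)"
      using Q less_imp_le by (intro always_eventually) blast
  qed
  then show ?thesis by (intro exI[of _ Q])
qed

lemma point_tendsto:
  assumes "x \<in> berkovich_points vc"
    and Q: "(\<lambda>n. c.poly_norm (x [:0, 1:]) (P - map_poly l (Q n))) \<longlonglongrightarrow> 0"
  shows "(\<lambda>n. x (map_poly l (Q n))) \<longlonglongrightarrow> x P"
proof -
  interpret x: berkovich_point vc x by unfold_locales fact
  show ?thesis
    by (rule LIM_zero_cancel, rule Lim_null_comparison[OF always_eventually Q])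
      (metis x.x_diff_poly_norm abs_minus_commute real_norm_def)
qed

lemma points_eqI:
  assumes x: "x \<in> berkovich_points vc" and y: "y \<in> berkovich_points vc"
    and eq: "\<And>Q. x (map_poly l Q) = y (map_poly l Q)"
  shows "x = y"
proof
  fix P
  interpret x: berkovich_point vc x by unfold_locales fact
  have T: "x [:0, 1:] = y [:0, 1:]" using eq[of "[:0, 1:]"] by (simp add: l.map_poly_pCons_hom)
  obtain Q where Q: "(\<lambda>n. c.poly_norm (x [:0, 1:]) (P - map_poly l (Q n))) \<longlonglongrightarrow> 0"
    using poly_approx_seq[OF x.x_nonneg] by blast
  have 1: "(\<lambda>n. y (map_poly l (Q n))) \<longlonglongrightarrow> x P" using point_tendsto[OF x Q] by (simp only: eq)
  have 2: "(\<lambda>n. y (map_poly l (Q n))) \<longlonglongrightarrow> y P" by (rule point_tendsto[OF y]) (use Q T in simp)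
  show "x P = y P" by (rule LIMSEQ_unique[OF 1 2])
qed

text \<open>A point over the subfield is 1-Lipschitz for \<open>poly_norm r\<close> with \<open>r =
  x0(T)\<close>, so it extends to the closure. The extension is given by the explicit formula of
  McShane, which is 1-Lipschitz as well; its algebraic properties then follow from approximation
  by polynomials over the subfield.\<close>

lemma point_extends:
  assumes x0: "x0 \<in> berkovich_points va"
  shows "\<exists>x\<in>berkovich_points vc. \<forall>Q. x (map_poly l Q) = x0 Q"
proof -
  interpret x0: berkovich_point va x0 by unfold_locales fact
  define r where "r = x0 [:0, 1:]"
  have r: "0 \<le> r" unfolding r_def by (rule x0.x_nonneg)
  let ?N = "c.poly_norm r"
  \<comment> \<open>The McShane extension \<open>X\<close> is the infimum of the upper bounds that the Lipschitz property imposes.\<close>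
  define S where "S P = (\<lambda>Q. x0 Q + ?N (P - map_poly l Q)) ` UNIV" for P
  define X where "X P = Inf (S P)" for P
  have bdd: "bdd_below (S P)" for P
    unfolding S_def using x0.x_nonneg c.poly_norm_nonneg[OF r]
    by (intro bdd_belowI[of _ 0]) (auto intro!: add_nonneg_nonneg)
  have le: "X P \<le> x0 Q + ?N (P - map_poly l Q)" for P Q
    unfolding X_def by (rule cInf_lower[OF _ bdd]) (auto simp: S_def)
  have ge: "t \<le> X P" if "\<And>Q. t \<le> x0 Q + ?N (P - map_poly l Q)" for t P
    unfolding X_def by (rule cInf_greatest) (use that in \<open>auto simp: S_def\<close>)
  have lip0: "x0 Q \<le> x0 Q' + ?N (map_poly l Q - map_poly l Q')" for Q Q'
    using x0.x_diff_poly_norm[of Q Q'] poly_norm_map[of r "Q - Q'"] by (simp add: lp.hom_minus r_def)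
  have lip: "x0 Q - ?N (P - map_poly l Q) \<le> X P" for P Q
  proof (rule ge)
    fix Q'
    have "map_poly l Q - map_poly l Q' = (map_poly l Q - P) + (P - map_poly l Q')" by simp
    then have "?N (map_poly l Q - map_poly l Q') \<le> ?N (P - map_poly l Q) + ?N (P - map_poly l Q')"
      using c.poly_norm_add[OF r] c.poly_norm_commute by metis
    then show "x0 Q - ?N (P - map_poly l Q) \<le> x0 Q' + ?N (P - map_poly l Q')"
      using lip0[of Q Q'] by linarith
  qed
  have X_map: "X (map_poly l Q) = x0 Q" for Q
    using le[of "map_poly l Q" Q] lip[of Q "map_poly l Q"] by simp
  have lim: "(\<lambda>n. x0 (Q n)) \<longlonglongrightarrow> X P" if Q: "(\<lambda>n. ?N (P - map_poly l (Q n))) \<longlonglongrightarrow> 0" for P Q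
  proof (rule LIM_zero_cancel, rule Lim_null_comparison[OF always_eventually Q])
    show "\<forall>n. norm (x0 (Q n) - X P) \<le> ?N (P - map_poly l (Q n))"
      using le lip by (smt (verit, best) real_norm_def)
  qed
  have nonneg: "0 \<le> X P" for P
    by (rule ge) (simp add: x0.x_nonneg c.poly_norm_nonneg[OF r])
  have add: "X (P + P') \<le> X P + X P'" and mult: "X (P * P') = X P * X P'" for P P'
  proof -
    obtain Q where Q: "(\<lambda>n. ?N (P - map_poly l (Q n))) \<longlonglongrightarrow> 0" using poly_approx_seq[OF r] by blast
    obtain Q' where Q': "(\<lambda>n. ?N (P' - map_poly l (Q' n))) \<longlonglongrightarrow> 0" using poly_approx_seq[OF r] by blast
    have N0: "norm (?N R) = ?N R" for R using c.poly_norm_nonneg[OF r] by simp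
    have "(\<lambda>n. ?N (P - map_poly l (Q n)) + ?N (P' - map_poly l (Q' n))) \<longlonglongrightarrow> 0"
      using tendsto_add[OF Q Q'] by simp
    then have "(\<lambda>n. ?N (P + P' - map_poly l (Q n + Q' n))) \<longlonglongrightarrow> 0"
    proof (rule Lim_null_comparison[rotated], intro always_eventually allI)
      fix n
      have "P + P' - map_poly l (Q n + Q' n) = (P - map_poly l (Q n)) + (P' - map_poly l (Q' n))"
        by (simp add: lp.hom_add)
      then show "norm (?N (P + P' - map_poly l (Q n + Q' n))) \<le> ?N (P - map_poly l (Q n)) + ?N (P' - map_poly l (Q' n))"
        unfolding N0 using c.poly_norm_add[OF r] by metis
    qed
    then have "(\<lambda>n. x0 (Q n + Q' n)) \<longlonglongrightarrow> X (P + P')" by (rule lim)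
    moreover have "(\<lambda>n. x0 (Q n) + x0 (Q' n)) \<longlonglongrightarrow> X P + X P'" by (intro tendsto_add lim Q Q')
    ultimately show "X (P + P') \<le> X P + X P'"
      by (rule LIMSEQ_le) (use x0.x_add in blast)
    have "(\<lambda>n. ?N P * ?N (P' - map_poly l (Q' n)) + ?N (P - map_poly l (Q n)) * (?N P' + ?N (P' - map_poly l (Q' n))))
        \<longlonglongrightarrow> ?N P * 0 + 0 * (?N P' + 0)"
      by (intro tendsto_add tendsto_mult tendsto_const Q Q')
    then have "(\<lambda>n. ?N P * ?N (P' - map_poly l (Q' n)) + ?N (P - map_poly l (Q n)) * (?N P' + ?N (P' - map_poly l (Q' n))))
        \<longlonglongrightarrow> 0" by simp
    then have "(\<lambda>n. ?N (P * P' - map_poly l (Q n * Q' n))) \<longlonglongrightarrow> 0"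
    proof (rule Lim_null_comparison[rotated], intro always_eventually allI)
      fix n
      define A where "A = map_poly l (Q n)"
      define B where "B = map_poly l (Q' n)"
      have "P * P' - map_poly l (Q n * Q' n) = P * (P' - B) + (P - A) * B"
        by (simp add: lp.hom_mult A_def B_def algebra_simps)
      then have "?N (P * P' - map_poly l (Q n * Q' n)) \<le> ?N (P * (P' - B)) + ?N ((P - A) * B)"
        using c.poly_norm_add[OF r] by metis
      also have "\<dots> \<le> ?N P * ?N (P' - B) + ?N (P - A) * ?N B"
        by (intro add_mono c.poly_norm_mult r)
      also have "?N B \<le> ?N P' + ?N (P' - B)"
        using c.poly_norm_diff[OF r, of P' "P' - B"] by simp
      finally show "norm (?N (P * P' - map_poly l (Q n * Q' n))) \<le>
          ?N P * ?N (P' - map_poly l (Q' n)) + ?N (P - map_poly l (Q n)) * (?N P' + ?N (P' - map_poly l (Q' n)))"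
        unfolding N0 A_def[symmetric] B_def[symmetric]
        using c.poly_norm_nonneg[OF r, of "P - A"] by (simp add: mult_left_mono)
    qed
    then have "(\<lambda>n. x0 (Q n * Q' n)) \<longlonglongrightarrow> X (P * P')" by (rule lim)
    moreover have "(\<lambda>n. x0 (Q n * Q' n)) \<longlonglongrightarrow> X P * X P'"
      unfolding x0.x_mult by (intro tendsto_mult lim Q Q')
    ultimately show "X (P * P') = X P * X P'" by (rule LIMSEQ_unique)
  qed
  have const: "X [:z:] = vc z" for z
  proof -
    obtain b where b: "c.conv (\<lambda>n. l (b n)) z" using conv_approx by blast
    then have "(\<lambda>n. ?N ([:z:] - map_poly l [:b n:])) \<longlonglongrightarrow> 0"
      by (simp add: l.map_poly_pCons_hom c.conv_def c.v_commute)
    then have "(\<lambda>n. x0 [:b n:]) \<longlonglongrightarrow> X [:z:]" by (rule lim)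
    moreover have "(\<lambda>n. x0 [:b n:]) \<longlonglongrightarrow> vc z"
      using c.conv_v[OF b] by (simp add: x0.x_const vc_l)
    ultimately show ?thesis by (rule LIMSEQ_unique)
  qed
  have "X \<in> berkovich_points vc" unfolding berkovich_points_def using nonneg add mult const by blast
  then show ?thesis using X_map by blast
qed

end

lemma (in field_hom) map_poly_prod_linear:
  "map_poly hom (smult a (\<Prod>b\<in>#A. [:- b, 1:])) = smult (hom a) (\<Prod>b\<in>#image_mset hom A. [:- b, 1:])"
proof -
  interpret p: map_poly_inj_idom_hom hom ..
  show ?thesis
    by (simp add: map_poly_hom_smult p.hom_prod_mset image_mset.compositionality comp_def
        map_poly_pCons_hom hom_uminus)
qed

lemma (in berkovich_point) point_prod_linear:
  "x (smult c (\<Prod>b\<in>#A. [:- b, 1:])) = v c * prod_mset (image_mset (\<lambda>b. x [:- b, 1:]) A)"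
proof -
  have "x (\<Prod>b\<in>#A. [:- b, 1:]) = prod_mset (image_mset (\<lambda>b. x [:- b, 1:]) A)"
    by (induction A) (auto simp: x_mult simp del: mult_pCons_left)
  then show ?thesis by (simp add: x_smult)
qed

text \<open>Polynomials over the algebraically closed dense subfield split into linear factors.\<close>

lemma points_eqI_linear:
  fixes va :: "'a::alg_closed_field \<Rightarrow> real"
  assumes d: "dense_valued_extension va vc l"
    and x: "x \<in> berkovich_points vc" and y: "y \<in> berkovich_points vc"
    and eq: "\<And>b. x [:- l b, 1:] = y [:- l b, 1:]"
  shows "x = y"
proof (rule dense_valued_extension.points_eqI[OF d x y])
  interpret dense_valued_extension va vc l by fact
  interpret x: berkovich_point vc x by unfold_locales fact
  interpret y: berkovich_point vc y by unfold_locales fact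
  fix Q
  show "x (map_poly l Q) = y (map_poly l Q)"
  proof (cases "Q = 0")
    case False
    then obtain A where "Q = smult (lead_coeff Q) (\<Prod>b\<in>#A. [:- b, 1:])"
      using alg_closed_imp_factorization by blast
    then have "map_poly l Q = map_poly l (smult (lead_coeff Q) (\<Prod>b\<in>#A. [:- b, 1:]))" by simp
    also have "\<dots> = smult (l (lead_coeff Q)) (\<Prod>b\<in>#image_mset l A. [:- b, 1:])"
      by (rule l.map_poly_prod_linear)
    finally have "map_poly l Q = smult (l (lead_coeff Q)) (\<Prod>b\<in>#image_mset l A. [:- b, 1:])" .
    then have "x (map_poly l Q) = vc (l (lead_coeff Q)) * (\<Prod>b\<in>#image_mset l A. x [:- b, 1:])"
      and "y (map_poly l Q) = vc (l (lead_coeff Q)) * (\<Prod>b\<in>#image_mset l A. y [:- b, 1:])"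
      by (simp_all only: x.point_prod_linear y.point_prod_linear)
    then show ?thesis using eq by (simp add: image_mset.compositionality comp_def)
  qed simp
qed

section \<open>The topology of the Berkovich line\<close>

context nonarch_abs_value
begin

lemma continuous_map_eval: "continuous_map (berkovich_line v) euclideanreal (\<lambda>x. x P)"
  unfolding continuous_map_def
proof (intro conjI allI impI)
  fix U :: "real set" assume "openin euclideanreal U"
  then have "openin (berkovich_line v) {x \<in> berkovich_points v. x P \<in> U}"
    unfolding berkovich_line_def by (intro topology_generated_by_Basis) auto
  then show "openin (berkovich_line v) {x \<in> topspace (berkovich_line v). x P \<in> U}"
    by (simp add: topspace_berkovich_line)
qed simp

lemma continuous_map_into_berkovich_line:
  assumes "\<And>t. t \<in> topspace X \<Longrightarrow> f t \<in> berkovich_points v"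
    and "\<And>P. continuous_map X euclideanreal (\<lambda>t. f t P)"
  shows "continuous_map X (berkovich_line v) f"
  unfolding berkovich_line_def
proof (rule continuous_on_generated_topo)
  show "f ` topspace X \<subseteq> \<Union> {{x \<in> berkovich_points v. x P \<in> U} |P U. open U}"
    using assms(1) by (auto intro!: exI[of _ UNIV])
  fix U assume "U \<in> {{x \<in> berkovich_points v. x P \<in> U} |P U. open U}"
  then obtain P V where U: "U = {x \<in> berkovich_points v. x P \<in> V}" "open V" by blast
  have "f -` U \<inter> topspace X = {t \<in> topspace X. f t P \<in> V}" using assms(1) U by auto
  then show "openin X (f -` U \<inter> topspace X)"
    using assms(2)[of P] U(2) by (simp add: openin_continuous_map_preimage)
qed

lemma Hausdorff_berkovich_line: "Hausdorff_space (berkovich_line v)"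
proof (rule Hausdorff_space_injective_preimage)
  show "Hausdorff_space (product_topology (\<lambda>_. euclideanreal) (UNIV :: 'a poly set))"
    by (simp add: Hausdorff_space_product_topology)
  show "continuous_map (berkovich_line v) (product_topology (\<lambda>_. euclideanreal) UNIV) (\<lambda>x. x)"
    by (simp add: continuous_map_componentwise_UNIV continuous_map_eval)
qed auto

text \<open>A bound for \<open>x(T)\<close> bounds \<open>x(P)\<close> for every \<open>P\<close>, so the
  ball embeds into a product of compact intervals, and all conditions that define points are
  closed.\<close>

lemma compactin_ball: "compactin (berkovich_line v) {x \<in> berkovich_points v. x [:0, 1:] \<le> r}"
proof -
  let ?B = "{x \<in> berkovich_points v. x [:0, 1:] \<le> r}"
  let ?X = "product_topology (\<lambda>_. euclideanreal) (UNIV :: 'a poly set)"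
  have cont: "continuous_on UNIV (\<lambda>x :: 'a poly \<Rightarrow> real. x P)" for P
    by (rule continuous_on_product_coordinates)
  have "?B = {x. (\<forall>P. 0 \<le> x P) \<and> (\<forall>P Q. x (P + Q) \<le> x P + x Q) \<and> (\<forall>P Q. x (P * Q) = x P * x Q) \<and>
      (\<forall>a. x [:a:] = v a) \<and> x [:0, 1:] \<le> r}"
    unfolding berkovich_points_def by blast
  also have "closed \<dots>"
    by (intro closed_Collect_conj closed_Collect_all closed_Collect_le closed_Collect_eq
        continuous_intros cont)
  finally have "closedin ?X ?B" by (simp add: euclidean_product_topology)
  moreover have "compactin ?X (PiE UNIV (\<lambda>P. {0..poly_norm r P}))"
    by (simp add: compactin_PiE)
  moreover have "?B \<subseteq> PiE UNIV (\<lambda>P. {0..poly_norm r P})"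
  proof
    fix x assume x: "x \<in> ?B"
    interpret berkovich_point v x using x by unfold_locales auto
    have "x P \<le> poly_norm r P" for P
      using x_le_poly_norm[of P] poly_norm_mono[OF x_nonneg, of "[:0, 1:]" r P] x by simp
    then show "x \<in> PiE UNIV (\<lambda>P. {0..poly_norm r P})" using x_nonneg by auto
  qed
  ultimately have "compactin ?X ?B" by (rule closed_compactin[rotated 2])
  then have "compact_space (subtopology ?X ?B)" by (simp add: compact_space_subtopology)
  moreover have "continuous_map ?X euclideanreal (\<lambda>t. t P)" for P
    using continuous_map_product_projection[of P UNIV "\<lambda>_. euclideanreal"] by simp
  then have "continuous_map (subtopology ?X ?B) (berkovich_line v) (\<lambda>x. x)"
    by (intro continuous_map_into_berkovich_line continuous_map_from_subtopology) auto
  ultimately have "compactin (berkovich_line v) ((\<lambda>x. x) ` topspace (subtopology ?X ?B))"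
    by (intro image_compactin) (auto simp: compact_space_def)
  then show ?thesis by simp
qed

lemma locally_compact_berkovich_line: "locally_compact_space (berkovich_line v)"
  unfolding locally_compact_space_def
proof (intro ballI)
  fix x assume "x \<in> topspace (berkovich_line v)"
  then have x: "x \<in> berkovich_points v" by (simp add: topspace_berkovich_line)
  define r where "r = x [:0, 1:] + 1"
  have "openin (berkovich_line v) {y \<in> topspace (berkovich_line v). y [:0, 1:] \<in> {..<r}}"
    by (rule openin_continuous_map_preimage[OF continuous_map_eval]) simp
  then have "openin (berkovich_line v) {y \<in> berkovich_points v. y [:0, 1:] < r}"
    by (simp add: topspace_berkovich_line)
  moreover have "x \<in> {y \<in> berkovich_points v. y [:0, 1:] < r}" using x by (simp add: r_def)
  moreover have "{y \<in> berkovich_points v. y [:0, 1:] < r} \<subseteq> {y \<in> berkovich_points v. y [:0, 1:] \<le> r}" by auto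
  ultimately show "\<exists>U K. openin (berkovich_line v) U \<and> compactin (berkovich_line v) K \<and> x \<in> U \<and> U \<subseteq> K"
    using compactin_ball by blast
qed

text \<open>Every compact subset of the line lies in a ball, as the value at \<open>T\<close> is
  continuous; and for maps into a locally compact Hausdorff space properness can be tested on
  compact sets.\<close>

lemma proper_map_into_berkovich_line:
  assumes f: "continuous_map X (berkovich_line v) f"
    and comp: "\<And>r. compactin X {t \<in> topspace X. f t [:0, 1:] \<le> r}"
  shows "proper_map X (berkovich_line v) f"
proof -
  have "compactin X {t \<in> topspace X. f t \<in> K}" if K: "compactin (berkovich_line v) K" for K
  proof -
    have "compactin euclideanreal ((\<lambda>x. x [:0, 1:]) ` K)"
      by (rule image_compactin[OF K continuous_map_eval])
    then have "bounded ((\<lambda>x. x [:0, 1:]) ` K)" by (simp add: compact_imp_bounded)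
    then obtain r where "\<forall>y\<in>(\<lambda>x. x [:0, 1:]) ` K. \<bar>y\<bar> \<le> r" unfolding bounded_real by blast
    then have r: "x [:0, 1:] \<le> r" if "x \<in> K" for x using that by auto
    have "closedin (berkovich_line v) K"
      using compactin_imp_closedin[OF Hausdorff_berkovich_line K] .
    then have "closedin X {t \<in> topspace X. f t \<in> K}" by (rule closedin_continuous_map_preimage[OF f])
    then show ?thesis using r by (intro closed_compactin[OF comp[of r]]) auto
  qed
  moreover have "f \<in> topspace X \<rightarrow> topspace (berkovich_line v)"
    using f by (simp add: continuous_map_def)
  ultimately show ?thesis
    using f locally_compact_imp_k_space[OF locally_compact_berkovich_line]
      Hausdorff_imp_kc_space[OF Hausdorff_berkovich_line]
    by (simp add: proper_eq_compact_map)
qed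

end

section \<open>Separability and endomorphisms of algebraic extensions\<close>

text \<open>A nonzero combination of least degree divides both polynomials. The Bezout identity is what
  makes separability survive base change.\<close>

lemma coprime_imp_bezout:
  fixes p q :: "'k::field poly"
  assumes "coprime p q"
  shows "\<exists>u w. u * p + w * q = 1"
proof -
  define I where "I = {u * p + w * q | u w. True}"
  have "p \<noteq> 0 \<or> q \<noteq> 0" using assms by auto
  moreover have "1 * p + 0 * q \<in> I" "0 * p + 1 * q \<in> I" unfolding I_def by blast+
  then have pI: "p \<in> I" and qI: "q \<in> I" by simp_all
  ultimately obtain d0 where "d0 \<in> I \<and> d0 \<noteq> 0" by blast
  then obtain d where d: "d \<in> I" "d \<noteq> 0" and min: "\<And>r. r \<in> I \<Longrightarrow> r \<noteq> 0 \<Longrightarrow> degree d \<le> degree r"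
    using ex_has_least_nat[of "\<lambda>d. d \<in> I \<and> d \<noteq> 0" d0 degree] by blast
  obtain u w where uw: "d = u * p + w * q" using d(1) I_def by blast
  have dvd: "d dvd r" if rI: "r \<in> I" for r
  proof (rule ccontr)
    assume n: "\<not> d dvd r"
    obtain u' w' where r: "r = u' * p + w' * q" using rI unfolding I_def by blast
    have "r mod d = r - r div d * d" by (simp add: minus_div_mult_eq_mod)
    also have "\<dots> = (u' - r div d * u) * p + (w' - r div d * w) * q"
      by (subst (2) uw, subst r) (simp add: algebra_simps)
    finally have "r mod d \<in> I" unfolding I_def by blast
    moreover have "r mod d \<noteq> 0" using n by (simp add: mod_eq_0_iff_dvd)
    ultimately show False using min[of "r mod d"] degree_mod_less[OF d(2), of r] by fastforce
  qed
  have "d dvd p" "d dvd q" using dvd[OF pI] dvd[OF qI] .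
  then have "is_unit d" using assms by (rule coprime_common_divisor[rotated])
  then obtain d' where "1 = d * d'" by (rule dvdE)
  then have "(d' * u) * p + (d' * w) * q = 1" using uw by (simp add: algebra_simps)
  then show ?thesis by blast
qed

lemma separable_poly_factor:
  fixes p q r :: "'k::field poly"
  assumes "separable_poly p" "p = q * r"
  shows "separable_poly r"
  unfolding separable_poly_def
proof (rule coprimeI)
  fix d assume d: "d dvd r" "d dvd pderiv r"
  then have "d dvd pderiv p" unfolding assms(2) pderiv_mult by (metis dvd_add dvd_mult dvd_mult2)
  moreover have "d dvd p" unfolding assms(2) using d by simp
  ultimately show "is_unit d"
    using assms(1) unfolding separable_poly_def by (metis coprime_common_divisor)
qed

text \<open>Split off one root at a time: the cofactor of a separable polynomial is again separable and so
  has a root unless it is constant.\<close>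

lemma roots_of_separable_poly:
  fixes j :: "'s::field \<Rightarrow> 'a::field"
  assumes closed: "\<forall>p :: 's poly. 0 < degree p \<and> separable_poly p \<longrightarrow> (\<exists>x. poly p x = 0)"
    and j: "field_hom j" and sep: "separable_poly p" and root: "poly (map_poly j p) x = 0"
  shows "x \<in> range j"
  using sep root
proof (induction "degree p" arbitrary: p rule: less_induct)
  case less
  interpret j: field_hom j by fact
  interpret jp: map_poly_inj_idom_hom j ..
  have p0: "p \<noteq> 0" using less.prems(1) by (auto simp: separable_poly_def)
  have "degree p > 0"
  proof (rule ccontr)
    assume "\<not> degree p > 0"
    then obtain c where "p = [:c:]" using degree_eq_zeroE by blast
    then show False using p0 less.prems(2) by (simp add: j.map_poly_pCons_hom)
  qed
  then obtain s where "poly p s = 0" using closed less.prems(1) by blast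
  then obtain q where q: "p = [:- s, 1:] * q" using poly_eq_0_iff_dvd by (metis dvdE)
  have "map_poly j p = map_poly j [:- s, 1:] * map_poly j q" unfolding q by (rule jp.hom_mult)
  then have "poly (map_poly j p) x = (x - j s) * poly (map_poly j q) x"
    by (simp add: j.map_poly_pCons_hom j.hom_uminus del: mult_pCons_left)
  then consider "x = j s" | "poly (map_poly j q) x = 0" using less.prems(2) by auto
  then show ?case
  proof cases
    case 2
    have "q \<noteq> 0" using q p0 by auto
    then have "degree q < degree p" unfolding q by (subst degree_mult_eq) auto
    then show ?thesis using less.hyps separable_poly_factor[OF less.prems(1) q] 2 by blast
  qed simp
qed

lemma power_CHAR_inj:
  fixes u w :: "'f::field"
  assumes "prime CHAR('f)" "u ^ (CHAR('f) ^ n) = w ^ (CHAR('f) ^ n)"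
  shows "u = w"
proof -
  have "u ^ (CHAR('f) ^ n) = ((u - w) + w) ^ (CHAR('f) ^ n)" by simp
  also have "\<dots> = (u - w) ^ (CHAR('f) ^ n) + w ^ (CHAR('f) ^ n)"
    by (rule freshmans_dream'[OF assms(1) refl])
  finally have "(u - w) ^ (CHAR('f) ^ n) = 0" using assms(2) by simp
  then show ?thesis by simp
qed

lemma CHAR_eq_of_field_hom:
  fixes h :: "'a::field \<Rightarrow> 'b::field"
  assumes "field_hom h"
  shows "CHAR('b) = CHAR('a)"
proof (rule CHAR_eqI)
  interpret field_hom h by fact
  have "of_nat n = (0::'b) \<longleftrightarrow> of_nat n = (0::'a)" for n
    using hom_of_nat[of n] hom_0_iff[of "of_nat n"] by simp
  then show "of_nat CHAR('a) = (0::'b)" "of_nat n = (0::'b) \<Longrightarrow> CHAR('a) dvd n" for n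
    by (simp_all add: of_nat_eq_0_iff_char_dvd)
qed

text \<open>Only coefficients at multiples of the characteristic survive, so \<open>p\<close> is
  \<open>q\<close> evaluated at that power of the variable.\<close>

lemma pderiv_0_imp_poly_in_CHAR_power:
  fixes p :: "'s::field poly"
  assumes "pderiv p = 0" "degree p > 0"
  shows "prime CHAR('s)" "\<exists>q. q \<noteq> 0 \<and> degree q < degree p \<and> (\<forall>n. coeff p n = (if CHAR('s) dvd n then coeff q (n div CHAR('s)) else 0))"
proof -
  let ?P = "CHAR('s)"
  have ch: "?P dvd n" if "coeff p n \<noteq> 0" for n
  proof (cases n)
    case (Suc m)
    have "of_nat (Suc m) * coeff p (Suc m) = 0" using assms(1) coeff_pderiv[of p m] by simp
    then have "of_nat n = (0::'s)" using that Suc by simp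
    then show ?thesis by (simp add: of_nat_eq_0_iff_char_dvd)
  qed simp
  have lc: "coeff p (degree p) \<noteq> 0" using assms(2) by auto
  then have d: "?P dvd degree p" by (rule ch)
  then have pos: "?P > 0" using assms(2) by (metis dvd_0_left_iff gr0I)
  then show prime: "prime ?P" by (rule prime_CHAR_semidom)
  have P1: "?P > 1" using prime prime_gt_1_nat by blast
  define q where "q = (\<Sum>k\<le>degree p div ?P. monom (coeff p (k * ?P)) k)"
  have cq: "coeff q k = coeff p (k * ?P)" for k
  proof (cases "k \<le> degree p div ?P")
    case True
    then show ?thesis by (simp add: q_def coeff_sum coeff_monom)
  next
    case False
    then have "degree p < k * ?P" using pos by (simp add: div_less_iff_less_mult not_le)
    then show ?thesis using False by (simp add: q_def coeff_sum coeff_monom coeff_eq_0)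
  qed
  have "coeff q (degree p div ?P) \<noteq> 0" using d lc by (simp add: cq)
  then have "q \<noteq> 0" by auto
  moreover have "degree q \<le> degree p div ?P"
    unfolding q_def by (rule degree_sum_le) (auto intro: order_trans[OF degree_monom_le])
  then have "degree q < degree p" using P1 assms(2) by (meson div_less_dividend le_less_trans)
  moreover have "\<forall>n. coeff p n = (if ?P dvd n then coeff q (n div ?P) else 0)"
    using ch by (auto simp: cq)
  ultimately show "\<exists>q. q \<noteq> 0 \<and> degree q < degree p \<and> (\<forall>n. coeff p n = (if ?P dvd n then coeff q (n div ?P) else 0))"
    by blast
qed

text \<open>A minimal polynomial with nonzero derivative is separable, so its roots are already in the
  separably closed field. Otherwise it is a polynomial in the \<open>p\<close>-th power of the
  variable, where \<open>p\<close> is the characteristic, and the claim for the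
  \<open>p\<close>-th power of \<open>x\<close> follows by induction on the degree.\<close>

lemma purely_inseparable:
  fixes j :: "'s::field \<Rightarrow> 'a::field"
  assumes closed: "\<forall>p :: 's poly. 0 < degree p \<and> separable_poly p \<longrightarrow> (\<exists>x. poly p x = 0)"
    and j: "field_hom j" and p: "p \<noteq> 0" "poly (map_poly j p) x = 0"
  shows "x \<in> range j \<or> prime CHAR('s) \<and> (\<exists>n. x ^ (CHAR('s) ^ n) \<in> range j)"
  using p
proof (induction "degree p" arbitrary: p x rule: less_induct)
  case less
  interpret j: field_hom j by fact
  interpret jp: map_poly_inj_idom_hom j ..
  show ?case
  proof (cases "\<exists>q. q \<noteq> 0 \<and> poly (map_poly j q) x = 0 \<and> degree q < degree p")
    case True
    then obtain q where "q \<noteq> 0" "poly (map_poly j q) x = 0" "degree q < degree p" by blast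
    then show ?thesis using less.hyps[of q x] by simp
  next
    case False
    then have min: "degree p \<le> degree q" if "q \<noteq> 0" "poly (map_poly j q) x = 0" for q
      using that not_le by blast
    have deg: "degree p > 0"
    proof (rule ccontr)
      assume "\<not> degree p > 0"
      then obtain c where "p = [:c:]" using degree_eq_zeroE by blast
      then show False using less.prems by (simp add: j.map_poly_pCons_hom)
    qed
    show ?thesis
    proof (cases "pderiv p = 0")
      case True
      note pd = pderiv_0_imp_poly_in_CHAR_power[OF True deg]
      let ?P = "CHAR('s)"
      have P0: "?P > 0" using pd(1) prime_gt_0_nat by blast
      obtain q where q: "q \<noteq> 0" "degree q < degree p"
        and cp: "\<And>n. coeff p n = (if ?P dvd n then coeff q (n div ?P) else 0)" using pd(2) by blast
      \<comment> \<open>A common range of summation for \<open>p\<close> and for \<open>q\<close> evaluated at a \<open>?P\<close>-th power.\<close>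
      define N where "N = degree p + ?P * degree q"
      have "poly (map_poly j p) x = (\<Sum>n\<le>N. j (coeff p n) * x ^ n)"
        unfolding poly_altdef by (rule sum.mono_neutral_cong_left) (auto simp: N_def coeff_eq_0)
      also have "\<dots> = (\<Sum>n | n \<le> N \<and> ?P dvd n. j (coeff q (n div ?P)) * x ^ n)"
        by (rule sum.mono_neutral_cong_right) (auto simp: cp)
      also have "\<dots> = (\<Sum>m\<le>N div ?P. j (coeff q m) * x ^ (?P * m))"
        by (rule sum.reindex_bij_witness[of _ "\<lambda>m. ?P * m" "\<lambda>n. n div ?P"])
          (use P0 in \<open>auto simp: div_le_mono less_eq_div_iff_mult_less_eq mult.commute\<close>)
      also have "\<dots> = (\<Sum>m\<le>N div ?P. j (coeff q m) * (x ^ ?P) ^ m)" by (simp add: power_mult)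
      also have "\<dots> = poly (map_poly j q) (x ^ ?P)"
      proof -
        have "degree q \<le> N div ?P" using P0 by (simp add: N_def div_add1_eq less_eq_div_iff_mult_less_eq mult.commute)
        then show ?thesis unfolding poly_altdef
          by (intro sum.mono_neutral_cong_right) (auto simp: coeff_eq_0)
      qed
      finally have "poly (map_poly j q) (x ^ ?P) = 0" using less.prems(2) by simp
      then have "x ^ ?P \<in> range j \<or> prime ?P \<and> (\<exists>n. (x ^ ?P) ^ (?P ^ n) \<in> range j)"
        using less.hyps[OF q(2) q(1)] by blast
      then have "\<exists>n. x ^ (?P ^ n) \<in> range j"
        by (metis power_Suc power_mult power_one_right)
      then show ?thesis using pd(1) by blast
    next
      case nz: False
      have "separable_poly p"
        unfolding separable_poly_def
      proof (rule coprimeI)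
        fix d assume d: "d dvd p" "d dvd pderiv p"
        then obtain r where r: "p = d * r" by (metis dvdE)
        have dr: "d \<noteq> 0" "r \<noteq> 0" using r less.prems(1) by auto
        then have degs: "degree p = degree d + degree r" unfolding r by (rule degree_mult_eq)
        have "degree d \<le> degree (pderiv p)" using d(2) nz by (rule dvd_imp_degree_le)
        also have "\<dots> \<le> degree p - 1" by (rule degree_pderiv_le)
        finally have lt: "degree d < degree p" using deg by linarith
        have "poly (map_poly j d) x * poly (map_poly j r) x = 0"
          using less.prems(2) unfolding r jp.hom_mult by simp
        then have "poly (map_poly j r) x = 0" using min[OF dr(1)] lt by auto
        then have "degree d = 0" using min[OF dr(2)] degs by simp
        then show "is_unit d" using dr(1) by (simp add: is_unit_iff_degree)
      qed
      then show ?thesis using roots_of_separable_poly[OF closed j _ less.prems(2)] by blast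
    qed
  qed
qed

text \<open>The endomorphism injects the finite set of roots of each equation over the base field into
  itself.\<close>

lemma algebraic_endomorphism_surj:
  fixes e :: "'k::field \<Rightarrow> 'a::field"
  assumes alg: "is_algebraic_extension e" and \<phi>: "field_hom \<phi>" and base: "\<And>c. \<phi> (e c) = e c"
  shows "surj \<phi>"
proof -
  interpret \<phi>: field_hom \<phi> by fact
  interpret e: field_hom e using alg unfolding is_algebraic_extension_def by blast
  show ?thesis
    unfolding surj_def
  proof
    fix x
    obtain p where p: "p \<noteq> 0" "poly (map_poly e p) x = 0"
      using alg unfolding is_algebraic_extension_def by blast
    define Z where "Z = {w. poly (map_poly e p) w = 0}"
    have fin: "finite Z" unfolding Z_def using p(1) by (intro poly_roots_finite) simp
    have mp: "map_poly \<phi> (map_poly e p) = map_poly e p"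
      by (simp add: poly_eq_iff base)
    have "\<phi> ` Z \<subseteq> Z"
    proof
      fix y assume "y \<in> \<phi> ` Z"
      then obtain w where w: "y = \<phi> w" "poly (map_poly e p) w = 0" unfolding Z_def by blast
      have "poly (map_poly \<phi> (map_poly e p)) (\<phi> w) = 0" using w(2) by simp
      then show "y \<in> Z" unfolding Z_def w(1) mp by simp
    qed
    then have "\<phi> ` Z = Z" using fin \<phi>.inj_f by (intro endo_inj_surj) (auto intro: inj_on_subset)
    moreover have "x \<in> Z" using p unfolding Z_def by simp
    ultimately show "\<exists>y. x = \<phi> y" by blast
  qed
qed

lemma (in valued_extension) minimal_poly_exists:
  "\<exists>m. m \<noteq> 0 \<and> poly (map_poly e m) \<alpha> = 0 \<and> (\<forall>q. q \<noteq> 0 \<longrightarrow> poly (map_poly e q) \<alpha> = 0 \<longrightarrow> degree m \<le> degree q)"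
proof -
  obtain p where "p \<noteq> 0 \<and> poly (map_poly e p) \<alpha> = 0"
    using algebraic unfolding is_algebraic_extension_def by blast
  then show ?thesis
    using ex_has_least_nat[of "\<lambda>p. p \<noteq> 0 \<and> poly (map_poly e p) \<alpha> = 0" p degree] by blast
qed

lemma (in valued_extension) eval_point:
  "(\<lambda>Q. va (poly (map_poly e Q) \<beta>)) \<in> berkovich_points vk"
proof -
  interpret h: map_poly_inj_idom_hom e ..
  show ?thesis unfolding berkovich_points_def
    by (auto simp: a.nonneg h.hom_add h.hom_mult a.mult a.v_add e.map_poly_pCons_hom va_e)
qed

text \<open>Evaluation at \<open>\<phi> x\<close> is a point that kills the minimal polynomial of
  \<open>x\<close>, so it agrees with evaluation at \<open>x\<close>.\<close>

lemma (in valued_extension) endomorphism_isometric: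
  assumes \<phi>: "field_hom \<phi>" and base: "\<And>c. \<phi> (e c) = e c"
  shows "va (\<phi> x) = va x"
proof -
  interpret \<phi>: field_hom \<phi> by fact
  obtain m where m: "m \<noteq> 0" "poly (map_poly e m) x = 0"
    "\<And>q. q \<noteq> 0 \<Longrightarrow> poly (map_poly e q) x = 0 \<Longrightarrow> degree m \<le> degree q"
    using minimal_poly_exists by blast
  have mp: "map_poly \<phi> (map_poly e p) = map_poly e p" for p
    by (simp add: poly_eq_iff base)
  have ev: "poly (map_poly e p) (\<phi> x) = \<phi> (poly (map_poly e p) x)" for p
    using \<phi>.poly_map_poly[of "map_poly e p" x] by (simp only: mp)
  have "va (poly (map_poly e m) (\<phi> x)) = 0" unfolding ev m(2) by simp
  from point_over_root[OF m eval_point[of "\<phi> x"] this, of "[:0, 1:]"]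
  show ?thesis by (simp add: e.map_poly_pCons_hom)
qed

section \<open>The Galois action on the completed algebraic closure\<close>

lemma field_hom_comp:
  fixes f :: "'b::field \<Rightarrow> 'c::field" and g :: "'a::field \<Rightarrow> 'b"
  assumes "field_hom f" "field_hom g"
  shows "field_hom (f \<circ> g)"
proof -
  interpret f: field_hom f by fact
  interpret g: field_hom g by fact
  show ?thesis by unfold_locales (simp_all add: f.hom_add g.hom_add f.hom_mult g.hom_mult)
qed

context nonarch_abs_value
begin

lemma Hausdorff_valued_field: "Hausdorff_space (valued_field_topology v)"
  unfolding valued_field_topology_def
  by (rule Metric_space.Hausdorff_space_mtopology[OF Metric_space])

lemma topspace_valued_field: "topspace (valued_field_topology v) = UNIV"
  unfolding valued_field_topology_def
  by (rule Metric_space.topspace_mtopology[OF Metric_space])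

lemma isometry_continuous:
  assumes "\<And>x y. v (\<tau> x - \<tau> y) = v (x - y)"
  shows "continuous_map (valued_field_topology v) (valued_field_topology v) \<tau>"
proof -
  interpret M: Metric_space UNIV "\<lambda>x y. v (x - y)" by (rule Metric_space)
  show ?thesis
    unfolding continuous_map_def topspace_valued_field
  proof (intro conjI allI impI)
    fix U assume U: "openin (valued_field_topology v) U"
    show "openin (valued_field_topology v) {x \<in> UNIV. \<tau> x \<in> U}"
      unfolding valued_field_topology_def M.openin_mtopology
    proof (intro conjI allI impI)
      fix x assume "x \<in> {x \<in> UNIV. \<tau> x \<in> U}"
      then obtain r where "r > 0" "M.mball (\<tau> x) r \<subseteq> U"
        using U unfolding valued_field_topology_def M.openin_mtopology by blast
      then show "\<exists>r>0. M.mball x r \<subseteq> {x \<in> UNIV. \<tau> x \<in> U}"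
        using assms by (intro exI[of _ r]) (auto simp: subset_iff)
    qed simp
  qed simp
qed

end

text \<open>The extension maps the limit of \<open>l (b n)\<close> to the limit of \<open>l (\<phi> (b
  n))\<close>; it is first a relation, and the isometry property shows that it is a function.\<close>

lemma (in dense_valued_extension) isometric_automorphism_extends:
  assumes complete: "complete_nonarch_field vc"
    and \<phi>: "field_hom \<phi>" "surj \<phi>" and iso: "\<And>x. va (\<phi> x) = va x"
  shows "\<exists>\<tau>. field_hom \<tau> \<and> bij \<tau> \<and> (\<forall>z. vc (\<tau> z) = vc z) \<and> (\<forall>x. \<tau> (l x) = l (\<phi> x))"
proof -
  interpret \<phi>: field_hom \<phi> by fact
  define rel where "rel z w \<longleftrightarrow> (\<exists>b. c.conv (\<lambda>n. l (b n)) z \<and> c.conv (\<lambda>n. l (\<phi> (b n))) w)" for z w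
  have dist: "vc (l (\<phi> x) - l (\<phi> y)) = vc (l x - l y)" for x y
    using iso[of "x - y"] vc_l[of "x - y"] vc_l[of "\<phi> (x - y)"] by (simp add: l.hom_minus \<phi>.hom_minus)
  have limit: "\<exists>w. c.conv s w" if "\<And>\<epsilon>. \<epsilon> > 0 \<Longrightarrow> \<exists>N. \<forall>m n. N \<le> m \<longrightarrow> N \<le> n \<longrightarrow> vc (s m - s n) < \<epsilon>" for s
    using complete_nonarch_field_limit[OF complete that] unfolding c.conv_def by blast
  have total: "\<exists>w. rel z w" for z
  proof -
    obtain b where b: "c.conv (\<lambda>n. l (b n)) z" using conv_approx by blast
    have "\<exists>w. c.conv (\<lambda>n. l (\<phi> (b n))) w"
      by (rule limit) (use conv_Cauchy[OF c.nonarch_abs_value_axioms b] dist in simp)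
    then show ?thesis using b unfolding rel_def by blast
  qed
  have onto: "\<exists>z. rel z w" for w
  proof -
    obtain b where b: "c.conv (\<lambda>n. l (b n)) w" using conv_approx by blast
    define b' where "b' n = inv_into UNIV \<phi> (b n)" for n
    have b': "b n = \<phi> (b' n)" for n unfolding b'_def using \<phi>(2) by (simp add: surj_f_inv_f)
    have "\<exists>z. c.conv (\<lambda>n. l (b' n)) z"
      by (rule limit) (use conv_Cauchy[OF c.nonarch_abs_value_axioms b] dist in \<open>simp add: b'\<close>)
    then show ?thesis using b unfolding rel_def b' by blast
  qed
  have rel_dist: "vc (w - w') = vc (z - z')" if r: "rel z w" "rel z' w'" for z w z' w'
  proof -
    obtain b b' where b: "c.conv (\<lambda>n. l (b n)) z" "c.conv (\<lambda>n. l (\<phi> (b n))) w"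
      and b': "c.conv (\<lambda>n. l (b' n)) z'" "c.conv (\<lambda>n. l (\<phi> (b' n))) w'"
      using r unfolding rel_def by blast
    have "(\<lambda>n. vc (l (b n) - l (b' n))) \<longlonglongrightarrow> vc (z - z')" by (intro c.conv_v c.conv_diff b b')
    moreover have "(\<lambda>n. vc (l (\<phi> (b n)) - l (\<phi> (b' n)))) \<longlonglongrightarrow> vc (w - w')" by (intro c.conv_v c.conv_diff b b')
    ultimately show ?thesis unfolding dist by (rule LIMSEQ_unique[symmetric])
  qed
  define \<tau> where "\<tau> z = (SOME w. rel z w)" for z
  have \<tau>: "rel z (\<tau> z)" for z unfolding \<tau>_def using total by (rule someI_ex)
  have \<tau>I: "\<tau> z = w" if "rel z w" for z w
    using rel_dist[OF \<tau>[of z] that] by (simp add: c.eq_0_iff)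
  have rel_l: "rel (l x) (l (\<phi> x))" for x
    unfolding rel_def by (intro exI[of _ "\<lambda>_. x"]) (simp add: c.conv_const)
  have ops: "rel (z + z') (\<tau> z + \<tau> z')" "rel (z * z') (\<tau> z * \<tau> z')" for z z'
  proof -
    obtain b b' where b: "c.conv (\<lambda>n. l (b n)) z" "c.conv (\<lambda>n. l (\<phi> (b n))) (\<tau> z)"
      and b': "c.conv (\<lambda>n. l (b' n)) z'" "c.conv (\<lambda>n. l (\<phi> (b' n))) (\<tau> z')"
      using \<tau> unfolding rel_def by blast
    show "rel (z + z') (\<tau> z + \<tau> z')" unfolding rel_def
      using c.conv_add[OF b(1) b'(1)] c.conv_add[OF b(2) b'(2)]
      by (intro exI[of _ "\<lambda>n. b n + b' n"]) (simp add: l.hom_add \<phi>.hom_add)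
    show "rel (z * z') (\<tau> z * \<tau> z')" unfolding rel_def
      using c.conv_mult[OF b(1) b'(1)] c.conv_mult[OF b(2) b'(2)]
      by (intro exI[of _ "\<lambda>n. b n * b' n"]) (simp add: l.hom_mult \<phi>.hom_mult)
  qed
  have \<tau>l: "\<tau> (l x) = l (\<phi> x)" for x by (rule \<tau>I[OF rel_l])
  have "field_hom \<tau>"
  proof
    show "\<tau> 0 = 0" "\<tau> 1 = 1" using \<tau>l[of 0] \<tau>l[of 1] by simp_all
    show "\<tau> (x + y) = \<tau> x + \<tau> y" "\<tau> (x * y) = \<tau> x * \<tau> y" for x y by (rule \<tau>I[OF ops(1)] \<tau>I[OF ops(2)])+
  qed
  moreover have "bij \<tau>"
    unfolding bij_def
  proof
    show "inj \<tau>"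
    proof (rule injI)
      fix x y assume "\<tau> x = \<tau> y"
      then have "vc (x - y) = 0" using rel_dist[OF \<tau>[of x] \<tau>[of y]] by simp
      then show "x = y" by (simp add: c.eq_0_iff)
    qed
    show "surj \<tau>" unfolding surj_def using onto \<tau>I by metis
  qed
  moreover have "vc (\<tau> z) = vc z" for z
    using rel_dist[OF \<tau>[of z] \<tau>[of 0]] \<tau>l[of 0] by simp
  ultimately show ?thesis using \<tau>l by blast
qed

locale berkovich_galois =
  fixes vk :: "'k::field \<Rightarrow> real"
    and va :: "'a::alg_closed_field \<Rightarrow> real"
    and vc :: "'c::field \<Rightarrow> real"
    and i :: "'k \<Rightarrow> 's::field"
    and j :: "'s \<Rightarrow> 'a"
    and l :: "'a \<Rightarrow> 'c"
  assumes k_complete: "complete_nonarch_field vk"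
    and sep_closure: "is_separable_closure i"
    and j_hom: "field_hom j"
    and alg_closure: "is_algebraic_closure (j \<circ> i)"
    and va_abs: "nonarch_abs_value va"
    and va_k: "\<forall>a. va (j (i a)) = vk a"
    and completion: "is_completion va vc l"
begin

sublocale k: complete_nonarch_field vk by (rule k_complete)
sublocale c: complete_nonarch_field vc using completion by (simp add: is_completion_def)
sublocale a: nonarch_abs_value va by (rule va_abs)
sublocale i: field_hom i
  using sep_closure by (simp add: is_separable_closure_def is_separable_extension_def)
sublocale j: field_hom j by (rule j_hom)
sublocale l: field_hom l using completion by (simp add: is_completion_def)

sublocale ext: valued_extension vk va "j \<circ> i"
proof
  show "is_algebraic_extension (j \<circ> i)" using alg_closure by (simp add: is_algebraic_closure_def)
qed (auto simp: va_k i.hom_add i.hom_mult j.hom_add j.hom_mult)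

sublocale dn: dense_valued_extension va vc l
proof
  show "vc (l a) = va a" for a using completion by (simp add: is_completion_def)
  interpret M: Metric_space UNIV "\<lambda>x y. vc (x - y)" by (rule c.Metric_space)
  fix \<epsilon> :: real and z assume "\<epsilon> > 0"
  moreover have "z \<in> M.mtopology closure_of range l"
    using completion by (simp add: is_completion_def valued_field_topology_def)
  ultimately show "\<exists>a. vc (z - l a) < \<epsilon>" unfolding M.metric_closure_of by auto
qed

text \<open>The property by which \<open>galois_extend\<close> is defined, separated in order to prove that
  exactly one map has it.\<close>

definition extends :: "('s \<Rightarrow> 's) \<Rightarrow> ('c \<Rightarrow> 'c) \<Rightarrow> bool" where
  "extends \<sigma> \<tau> \<longleftrightarrow> field_hom \<tau> \<and> bij \<tau> \<and>
    continuous_map (valued_field_topology vc) (valued_field_topology vc) \<tau> \<and>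
    (\<forall>x. \<tau> ((l \<circ> j) x) = (l \<circ> j) (\<sigma> x))"

text \<open>The exponent is 1 or a power of the characteristic; its purpose is that elements of
  \<open>'a\<close> and \<open>'c\<close> are determined by this power, so that homomorphisms are
  determined on \<open>'a\<close> by their restriction to \<open>'s\<close>.\<close>

lemma power_in_separable_closure:
  "\<exists>q. x ^ q \<in> range j \<and> (\<forall>u w :: 'a. u ^ q = w ^ q \<longrightarrow> u = w) \<and> (\<forall>u w :: 'c. u ^ q = w ^ q \<longrightarrow> u = w)"
proof -
  have closed: "\<forall>p :: 's poly. 0 < degree p \<and> separable_poly p \<longrightarrow> (\<exists>x. poly p x = 0)"
    using sep_closure by (simp add: is_separable_closure_def)
  obtain p where p: "p \<noteq> 0" "poly (map_poly (j \<circ> i) p) x = 0"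
    using ext.algebraic unfolding is_algebraic_extension_def by blast
  have "map_poly j (map_poly i p) = map_poly (j \<circ> i) p" by (simp add: poly_eq_iff)
  then have "map_poly i p \<noteq> 0" "poly (map_poly j (map_poly i p)) x = 0" using p by simp_all
  from purely_inseparable[OF closed j_hom this]
  have disj: "x \<in> range j \<or> prime CHAR('s) \<and> (\<exists>n. x ^ (CHAR('s) ^ n) \<in> range j)" .
  show ?thesis
  proof (cases "x \<in> range j")
    case True
    then show ?thesis by (intro exI[of _ 1]) simp
  next
    case False
    with disj obtain n where 2: "prime CHAR('s)" "x ^ (CHAR('s) ^ n) \<in> range j" by blast
    have "CHAR('a) = CHAR('s)" "CHAR('c) = CHAR('a)"
      by (rule CHAR_eq_of_field_hom[OF j_hom], rule CHAR_eq_of_field_hom[OF l.field_hom_axioms])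
    then have "u = w" if "u ^ (CHAR('s) ^ n) = w ^ (CHAR('s) ^ n)" for u w :: 'a
      using power_CHAR_inj[of u n w] that 2(1) by simp
    moreover have "u = w" if "u ^ (CHAR('s) ^ n) = w ^ (CHAR('s) ^ n)" for u w :: 'c
      using power_CHAR_inj[of u n w] that 2(1) \<open>CHAR('a) = CHAR('s)\<close> \<open>CHAR('c) = CHAR('a)\<close> by simp
    ultimately show ?thesis using 2(2) by blast
  qed
qed

lemma extends_unique:
  assumes \<tau>: "extends \<sigma> \<tau>" and \<tau>': "extends \<sigma> \<tau>'"
  shows "\<tau> = \<tau>'"
proof
  fix z
  interpret t: field_hom \<tau> using \<tau> by (simp add: extends_def)
  interpret t': field_hom \<tau>' using \<tau>' by (simp add: extends_def)
  have l: "\<tau> (l x) = \<tau>' (l x)" for x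
  proof -
    obtain q s where q: "x ^ q = j s" "\<And>u w :: 'c. u ^ q = w ^ q \<Longrightarrow> u = w"
      using power_in_separable_closure[of x] by blast
    have "\<tau> (l x) ^ q = \<tau> (l (j s))" by (simp flip: t.hom_power l.hom_power q(1))
    also have "\<dots> = \<tau>' (l (j s))" using \<tau> \<tau>' by (simp add: extends_def)
    also have "\<dots> = \<tau>' (l x) ^ q" by (simp flip: t'.hom_power l.hom_power q(1))
    finally show ?thesis by (rule q(2))
  qed
  have "z \<in> valued_field_topology vc closure_of range l"
    using completion by (simp add: is_completion_def)
  then show "\<tau> z = \<tau>' z"
    by (rule forall_in_closure_of_eq[OF _ c.Hausdorff_valued_field])
      (use \<tau> \<tau>' l in \<open>auto simp: extends_def\<close>)
qed

lemma galois_extend_eqI: "extends \<sigma> \<tau> \<Longrightarrow> galois_extend vc (l \<circ> j) \<sigma> = \<tau>"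
  unfolding galois_extend_def
  by (rule the_equality) (use extends_unique in \<open>auto simp: extends_def\<close>)

lemma endomorphism_of_galois:
  assumes \<sigma>: "\<sigma> \<in> galois_group i"
  shows "\<exists>\<phi>. field_hom \<phi> \<and> (\<forall>s. \<phi> (j s) = j (\<sigma> s))"
proof -
  interpret s: field_hom \<sigma> using \<sigma> by (simp add: galois_group_def)
  define \<Gamma> where "\<Gamma> = {(j s, j (\<sigma> s)) | s. True}"
  have \<Gamma>I: "(j s, j (\<sigma> s)) \<in> \<Gamma>" for s unfolding \<Gamma>_def by blast
  have "partial_hom \<Gamma>"
    unfolding partial_hom_def
  proof (intro conjI allI impI)
    show "(1, 1) \<in> \<Gamma>" using \<Gamma>I[of 1] by simp
    fix a b c d assume "(a, b) \<in> \<Gamma>" "(c, d) \<in> \<Gamma>"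
    then obtain s t where "a = j s" "b = j (\<sigma> s)" "c = j t" "d = j (\<sigma> t)" unfolding \<Gamma>_def by blast
    then show "(a - c, b - d) \<in> \<Gamma>" "(a * c, b * d) \<in> \<Gamma>"
      using \<Gamma>I[of "s - t"] \<Gamma>I[of "s * t"] by (simp_all add: j.hom_minus s.hom_minus j.hom_mult s.hom_mult)
  next
    fix b assume "(0, b) \<in> \<Gamma>"
    then show "b = 0" unfolding \<Gamma>_def by auto
  qed
  moreover have "range (j \<circ> i) \<subseteq> Domain \<Gamma>" unfolding \<Gamma>_def by auto
  ultimately obtain \<phi> where "field_hom \<phi>" "\<forall>(a, b) \<in> \<Gamma>. \<phi> a = b"
    using partial_hom_extends[OF ext.algebraic, of \<Gamma>] by blast
  then have "field_hom \<phi> \<and> (\<forall>s. \<phi> (j s) = j (\<sigma> s))" using \<Gamma>I by fast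
  then show ?thesis by blast
qed

lemma algebraic_i: "is_algebraic_extension i"
  unfolding is_algebraic_extension_def
  using sep_closure i.field_hom_axioms
  unfolding is_separable_closure_def is_separable_extension_def by (metis not_irreducible_zero)

text \<open>Conversely, an endomorphism over the base field permutes the roots of separable polynomials,
  and these lie in the separable closure.\<close>

lemma galois_of_endomorphism:
  assumes \<phi>: "field_hom \<phi>" and base: "\<And>a. \<phi> (j (i a)) = j (i a)"
  shows "\<exists>\<sigma>\<in>galois_group i. \<forall>s. \<phi> (j s) = j (\<sigma> s)"
proof -
  interpret \<phi>: field_hom \<phi> by fact
  have closed: "\<forall>p :: 's poly. 0 < degree p \<and> separable_poly p \<longrightarrow> (\<exists>x. poly p x = 0)"
    using sep_closure by (simp add: is_separable_closure_def)
  have "\<exists>t. \<phi> (j s) = j t" for s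
  proof -
    obtain p where p: "separable_poly p" "poly (map_poly i p) s = 0"
      using sep_closure unfolding is_separable_closure_def is_separable_extension_def by blast
    interpret ip: map_poly_inj_idom_hom i ..
    obtain u w where "u * p + w * pderiv p = 1"
      using p(1) coprime_imp_bezout unfolding separable_poly_def by blast
    then have "map_poly i (u * p + w * pderiv p) = 1" by simp
    then have bez: "map_poly i u * map_poly i p + map_poly i w * pderiv (map_poly i p) = 1"
      by (simp add: ip.hom_add ip.hom_mult i.map_poly_pderiv)
    have "separable_poly (map_poly i p)"
      unfolding separable_poly_def
    proof (rule coprimeI)
      fix d assume "d dvd map_poly i p" "d dvd pderiv (map_poly i p)"
      then show "is_unit d" unfolding bez[symmetric] by simp
    qed
    moreover have "poly (map_poly j (map_poly i p)) (\<phi> (j s)) = 0"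
    proof -
      have "map_poly \<phi> (map_poly j (map_poly i p)) = map_poly j (map_poly i p)"
        by (simp add: poly_eq_iff base)
      then have "poly (map_poly j (map_poly i p)) (\<phi> (j s)) = \<phi> (j (poly (map_poly i p) s))"
        by (metis \<phi>.poly_map_poly j.poly_map_poly)
      then show ?thesis using p(2) by simp
    qed
    ultimately have "\<phi> (j s) \<in> range j" by (rule roots_of_separable_poly[OF closed j_hom])
    then show ?thesis by blast
  qed
  then obtain \<sigma> where \<sigma>: "\<And>s. \<phi> (j s) = j (\<sigma> s)" by metis
  have hom: "field_hom \<sigma>"
  proof
    show "\<sigma> 0 = 0" "\<sigma> 1 = 1" "\<sigma> (x + y) = \<sigma> x + \<sigma> y" "\<sigma> (x * y) = \<sigma> x * \<sigma> y" for x y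
      by (rule j.injectivity, simp flip: \<sigma> add: j.hom_add j.hom_mult \<phi>.hom_add \<phi>.hom_mult,
          (simp add: j.hom_add j.hom_mult \<sigma>)?)+
  qed
  interpret \<sigma>: field_hom \<sigma> by fact
  have fixes_k: "\<sigma> (i a) = i a" for a using \<sigma>[of "i a"] base[of a] by simp
  have "surj \<sigma>" by (rule algebraic_endomorphism_surj[OF algebraic_i hom fixes_k])
  then have "\<sigma> \<in> galois_group i"
    using hom fixes_k \<sigma>.inj_f by (simp add: galois_group_def bij_def)
  then show ?thesis using \<sigma> by blast
qed

lemma galois_extend_of_endomorphism:
  assumes \<sigma>: "\<sigma> \<in> galois_group i" and \<phi>: "field_hom \<phi>" "\<And>s. \<phi> (j s) = j (\<sigma> s)"
  defines "\<tau> \<equiv> galois_extend vc (l \<circ> j) \<sigma>"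
  shows "extends \<sigma> \<tau>" "\<And>z. vc (\<tau> z) = vc z" "\<And>x. \<tau> (l x) = l (\<phi> x)"
proof -
  have base: "\<phi> ((j \<circ> i) a) = (j \<circ> i) a" for a using \<phi>(2)[of "i a"] \<sigma> by (simp add: galois_group_def)
  obtain \<tau>' where \<tau>': "field_hom \<tau>'" "bij \<tau>'" "\<And>z. vc (\<tau>' z) = vc z" "\<And>x. \<tau>' (l x) = l (\<phi> x)"
    using dn.isometric_automorphism_extends[OF c.complete_nonarch_field_axioms \<phi>(1)
        algebraic_endomorphism_surj[OF ext.algebraic \<phi>(1) base]
        ext.endomorphism_isometric[OF \<phi>(1) base]] by blast
  interpret t: field_hom \<tau>' by fact
  have "extends \<sigma> \<tau>'"
    unfolding extends_def using \<tau>' \<phi>(2)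
    by (auto intro!: c.isometry_continuous simp flip: t.hom_minus)
  then have "\<tau> = \<tau>'" unfolding \<tau>_def by (rule galois_extend_eqI)
  then show "extends \<sigma> \<tau>" "\<And>z. vc (\<tau> z) = vc z" "\<And>x. \<tau> (l x) = l (\<phi> x)"
    using \<open>extends \<sigma> \<tau>'\<close> \<tau>' by auto
qed

end

section \<open>Compactness of the Galois group\<close>

lemma continuous_map_realI:
  assumes "\<And>t \<epsilon>. t \<in> topspace X \<Longrightarrow> \<epsilon> > 0 \<Longrightarrow> \<exists>U. openin X U \<and> t \<in> U \<and> (\<forall>s\<in>U. \<bar>f s - f t\<bar> < \<epsilon>)"
  shows "continuous_map X euclideanreal f"
  unfolding continuous_map_def
proof (intro conjI allI impI)
  fix V :: "real set" assume "openin euclideanreal V"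
  then have V: "open V" by simp
  show "openin X {t \<in> topspace X. f t \<in> V}"
  proof (subst openin_subopen, intro ballI)
    fix t assume "t \<in> {t \<in> topspace X. f t \<in> V}"
    then have t: "t \<in> topspace X" "f t \<in> V" by auto
    then obtain \<epsilon> where \<epsilon>: "\<epsilon> > 0" "\<And>y. dist y (f t) < \<epsilon> \<Longrightarrow> y \<in> V" using V unfolding open_dist by blast
    obtain U where U: "openin X U" "t \<in> U" "\<forall>s\<in>U. \<bar>f s - f t\<bar> < \<epsilon>" using assms[OF t(1) \<epsilon>(1)] by blast
    have "U \<subseteq> {t \<in> topspace X. f t \<in> V}"
      using U openin_subset[OF U(1)] \<epsilon>(2) by (auto simp: dist_real_def)
    then show "\<exists>T. openin X T \<and> t \<in> T \<and> T \<subseteq> {t \<in> topspace X. f t \<in> V}" using U by blast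
  qed
qed simp

text \<open>Reduction modulo any equation of \<open>s\<close> shows that finitely many powers of
  \<open>s\<close> span the ring of polynomial expressions in \<open>s\<close>.\<close>

lemma simple_finite_subextension:
  fixes i :: "'k::field \<Rightarrow> 's::field"
  assumes alg: "is_algebraic_extension i"
  shows "\<exists>L. finite_subextension i L \<and> s \<in> L"
proof -
  interpret i: field_hom i using alg by (simp add: is_algebraic_extension_def)
  interpret ip: map_poly_inj_idom_hom i ..
  define L where "L = range (\<lambda>p. poly (map_poly i p) s)"
  have LI: "poly (map_poly i p) s \<in> L" for p unfolding L_def by blast
  have const: "range i \<subseteq> L" using LI[of "[:_:]"] by (auto simp: i.map_poly_pCons_hom)
  have add: "a + b \<in> L" and diff: "a - b \<in> L" and mult: "a * b \<in> L" if ab: "a \<in> L" "b \<in> L" for a b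
  proof -
    obtain p q where "a = poly (map_poly i p) s" "b = poly (map_poly i q) s"
      using ab unfolding L_def by blast
    then show "a + b \<in> L" "a - b \<in> L" "a * b \<in> L"
      using LI[of "p + q"] LI[of "p - q"] LI[of "p * q"] by (simp_all add: ip.hom_add ip.hom_minus ip.hom_mult)
  qed
  have inv: "inverse a \<in> L" if a: "a \<in> L" for a
  proof -
    obtain p where "p \<noteq> 0" "poly (map_poly i p) a = 0"
      using alg unfolding is_algebraic_extension_def by blast
    then show ?thesis by (intro inverse_in_algebraic_subring[OF i.field_hom_axioms const add mult a])
  qed
  obtain m where m: "m \<noteq> 0" "poly (map_poly i m) s = 0"
    using alg unfolding is_algebraic_extension_def by blast
  define B where "B = (\<lambda>n. s ^ n) ` {..<degree m}"
  have B: "finite B" by (simp add: B_def)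
  have "L = {\<Sum>b\<in>B. i (c b) * b | c. True}"
  proof (intro equalityI subsetI)
    fix x assume "x \<in> L"
    then obtain p where p: "x = poly (map_poly i p) s" unfolding L_def by blast
    define r where "r = p mod m"
    have "p = m * (p div m) + r" by (simp add: r_def)
    then have "x = poly (map_poly i (m * (p div m) + r)) s" using p by simp
    then have x: "x = poly (map_poly i r) s" using m(2) by (simp add: ip.hom_add ip.hom_mult)
    have zero: "coeff r n = 0" if "n \<ge> degree m" for n
      using degree_mod_less[OF m(1), of p] that by (auto simp: r_def intro: coeff_eq_0)
    have "x = (\<Sum>n<degree m. i (coeff r n) * s ^ n)"
    proof -
      define N where "N = degree m + degree r"
      have "x = (\<Sum>n\<le>N. i (coeff r n) * s ^ n)"
        unfolding x poly_altdef by (rule sum.mono_neutral_cong_left) (auto simp: N_def coeff_eq_0)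
      also have "\<dots> = (\<Sum>n<degree m. i (coeff r n) * s ^ n)"
        by (rule sum.mono_neutral_cong_right) (auto simp: N_def zero)
      finally show ?thesis .
    qed
    \<comment> \<open>The powers of \<open>s\<close> need not be distinct, so the coefficients are collected by value.\<close>
    also have "\<dots> = (\<Sum>b\<in>B. \<Sum>n\<in>{n\<in>{..<degree m}. s ^ n = b}. i (coeff r n) * s ^ n)"
      unfolding B_def by (rule sum.image_gen) simp
    also have "\<dots> = (\<Sum>b\<in>B. i (\<Sum>n\<in>{n\<in>{..<degree m}. s ^ n = b}. coeff r n) * b)"
      by (intro sum.cong refl) (simp add: i.hom_sum sum_distrib_right)
    finally have "x = (\<Sum>b\<in>B. i ((\<lambda>b. \<Sum>n\<in>{n\<in>{..<degree m}. s ^ n = b}. coeff r n) b) * b)" by simp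
    then show "x \<in> {\<Sum>b\<in>B. i (c b) * b | c. True}" by (intro CollectI exI conjI TrueI)
  next
    fix x assume "x \<in> {\<Sum>b\<in>B. i (c b) * b | c. True}"
    then obtain c where x: "x = (\<Sum>b\<in>B. i (c b) * b)" by blast
    have BL: "b \<in> L" if bB: "b \<in> B" for b
    proof -
      obtain n where "b = s ^ n" using bB unfolding B_def by blast
      then show ?thesis using LI[of "monom 1 n"] by (simp add: poly_monom)
    qed
    have zL: "0 \<in> L" using LI[of 0] by simp
    show "x \<in> L" unfolding x using B BL
    proof (induction B rule: finite_induct)
      case (insert b F)
      then show ?case using const by (auto intro!: add mult)
    qed (simp add: zL)
  qed
  then have "finite_subextension i L"
    unfolding finite_subextension_def using const diff mult inv B by blast
  moreover have "s \<in> L" using LI[of "[:0, 1:]"] by (simp add: i.map_poly_pCons_hom)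
  ultimately show ?thesis by blast
qed

lemma topspace_galois_topology:
  assumes "is_algebraic_extension i"
  shows "topspace (galois_topology i) = galois_group i"
proof -
  obtain L where "finite_subextension i L" using simple_finite_subextension[OF assms] by blast
  then show ?thesis
    unfolding galois_topology_def topology_generated_by_topspace by blast
qed

lemma openin_galois_fixing:
  assumes "is_algebraic_extension i" "\<sigma> \<in> galois_group i"
  shows "\<exists>U. openin (galois_topology i) U \<and> \<sigma> \<in> U \<and> (\<forall>\<tau>\<in>U. \<tau> \<in> galois_group i \<and> \<tau> s = \<sigma> s)"
proof -
  obtain L where L: "finite_subextension i L" "s \<in> L"
    using simple_finite_subextension[OF assms(1)] by blast
  define U where "U = {\<tau> \<in> galois_group i. \<forall>x\<in>L. \<tau> x = \<sigma> x}"
  have "openin (galois_topology i) U"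
    unfolding galois_topology_def U_def using assms(2) L(1) by (intro topology_generated_by_Basis) blast
  then show ?thesis using assms(2) L(2) unfolding U_def by (intro exI[of _ U]) (auto simp: U_def)
qed

text \<open>An automorphism maps each element to one of the finitely many roots of an equation of that
  element. So the group is a subset of a product of finite discrete spaces, closed because being
  a homomorphism over the base field is a condition on finitely many coordinates at a time. The
  profinite topology is coarser than the product topology since finite extensions have finite
  bases.\<close>

lemma compact_galois_topology:
  fixes i :: "'k::field \<Rightarrow> 's::field"
  assumes alg: "is_algebraic_extension i"
  shows "compact_space (galois_topology i)"
proof -
  interpret i: field_hom i using alg by (simp add: is_algebraic_extension_def)
  obtain p where p: "\<And>x. p x \<noteq> 0" "\<And>x. poly (map_poly i (p x)) x = 0"
    using alg unfolding is_algebraic_extension_def by metis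
  define Z where "Z x = {y. poly (map_poly i (p x)) y = 0}" for x
  have finZ: "finite (Z x)" for x unfolding Z_def using p(1) by (intro poly_roots_finite) simp
  let ?X = "product_topology (\<lambda>x. discrete_topology (Z x)) UNIV"
  let ?G = "galois_group i"
  have X: "topspace ?X = PiE UNIV Z" by simp
  have compX: "compact_space ?X"
    unfolding compact_space_product_topology by (simp add: finZ compact_space_discrete_topology)
  have proj: "openin ?X {\<sigma> \<in> topspace ?X. \<sigma> a \<in> V}" for a V
  proof -
    have "continuous_map ?X (discrete_topology (Z a)) (\<lambda>\<sigma>. \<sigma> a)"
      by (rule continuous_map_product_projection) simp
    from openin_continuous_map_preimage[OF this, of "V \<inter> Z a"]
    have "openin ?X {\<sigma> \<in> topspace ?X. \<sigma> a \<in> V \<inter> Z a}" by simp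
    moreover have "{\<sigma> \<in> topspace ?X. \<sigma> a \<in> V \<inter> Z a} = {\<sigma> \<in> topspace ?X. \<sigma> a \<in> V}" by auto
    ultimately show ?thesis by simp
  qed
  have rel: "closedin ?X {\<sigma> \<in> topspace ?X. R (\<sigma> a) (\<sigma> b) (\<sigma> c)}" for R a b c
  proof -
    have "openin ?X {\<sigma> \<in> topspace ?X. \<not> R (\<sigma> a) (\<sigma> b) (\<sigma> c)}"
    proof (subst openin_subopen, intro ballI)
      fix \<sigma> assume s: "\<sigma> \<in> {\<sigma> \<in> topspace ?X. \<not> R (\<sigma> a) (\<sigma> b) (\<sigma> c)}"
      let ?T = "{\<rho> \<in> topspace ?X. \<rho> a \<in> {\<sigma> a}} \<inter> {\<rho> \<in> topspace ?X. \<rho> b \<in> {\<sigma> b}} \<inter> {\<rho> \<in> topspace ?X. \<rho> c \<in> {\<sigma> c}}"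
      have "openin ?X ?T" by (intro openin_Int proj)
      moreover have "\<sigma> \<in> ?T" "?T \<subseteq> {\<sigma> \<in> topspace ?X. \<not> R (\<sigma> a) (\<sigma> b) (\<sigma> c)}" using s by auto
      ultimately show "\<exists>T. openin ?X T \<and> \<sigma> \<in> T \<and> T \<subseteq> {\<sigma> \<in> topspace ?X. \<not> R (\<sigma> a) (\<sigma> b) (\<sigma> c)}" by blast
    qed
    moreover have "topspace ?X - {\<sigma> \<in> topspace ?X. R (\<sigma> a) (\<sigma> b) (\<sigma> c)} = {\<sigma> \<in> topspace ?X. \<not> R (\<sigma> a) (\<sigma> b) (\<sigma> c)}"
      by blast
    ultimately show ?thesis unfolding closedin_def by auto
  qed
  define F where "F = {\<sigma> \<in> topspace ?X. \<forall>a b. \<sigma> (a + b) = \<sigma> a + \<sigma> b} \<inter> {\<sigma> \<in> topspace ?X. \<forall>a b. \<sigma> (a * b) = \<sigma> a * \<sigma> b}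
     \<inter> {\<sigma> \<in> topspace ?X. \<forall>a. \<sigma> (i a) = i a}"
  have closedF: "closedin ?X F"
  proof -
    have "closedin ?X (\<Inter>a. \<Inter>b. {\<sigma> \<in> topspace ?X. \<sigma> (a + b) = \<sigma> a + \<sigma> b})"
      using rel[of "\<lambda>u v w. u = v + w"] by (intro closedin_INT) auto
    moreover have "closedin ?X (\<Inter>a. \<Inter>b. {\<sigma> \<in> topspace ?X. \<sigma> (a * b) = \<sigma> a * \<sigma> b})"
      using rel[of "\<lambda>u v w. u = v * w"] by (intro closedin_INT) auto
    moreover have "closedin ?X (\<Inter>a. {\<sigma> \<in> topspace ?X. \<sigma> (i a) = i a})"
      using rel[of "\<lambda>u v w. u = i _"] by (intro closedin_INT) auto
    moreover have "F = (\<Inter>a. \<Inter>b. {\<sigma> \<in> topspace ?X. \<sigma> (a + b) = \<sigma> a + \<sigma> b}) \<inter> (\<Inter>a. \<Inter>b. {\<sigma> \<in> topspace ?X. \<sigma> (a * b) = \<sigma> a * \<sigma> b})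
       \<inter> (\<Inter>a. {\<sigma> \<in> topspace ?X. \<sigma> (i a) = i a})"
      unfolding F_def by auto
    ultimately show ?thesis by (simp only: closedin_Int)
  qed
  have "F = ?G"
  proof (intro equalityI subsetI)
    fix \<sigma> assume \<sigma>: "\<sigma> \<in> F"
    have hom: "field_hom \<sigma>"
    proof
      have "\<sigma> (i 0) = i 0" "\<sigma> (i 1) = i 1" using \<sigma> unfolding F_def by blast+
      then show "\<sigma> 0 = 0" "\<sigma> 1 = 1" by simp_all
    qed (use \<sigma> in \<open>auto simp: F_def\<close>)
    interpret s: field_hom \<sigma> by fact
    have base: "\<sigma> (i a) = i a" for a using \<sigma> unfolding F_def by blast
    have "surj \<sigma>" by (rule algebraic_endomorphism_surj[OF alg hom base])
    then show "\<sigma> \<in> ?G" using s.inj_f hom base by (simp add: galois_group_def bij_def)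
  next
    fix \<sigma> assume \<sigma>: "\<sigma> \<in> ?G"
    interpret s: field_hom \<sigma> using \<sigma> by (simp add: galois_group_def)
    have base: "\<sigma> (i a) = i a" for a using \<sigma> by (simp add: galois_group_def)
    have "\<sigma> x \<in> Z x" for x
    proof -
      have "map_poly \<sigma> (map_poly i (p x)) = map_poly i (p x)" by (simp add: poly_eq_iff base)
      then have "poly (map_poly i (p x)) (\<sigma> x) = \<sigma> (poly (map_poly i (p x)) x)"
        by (metis s.poly_map_poly)
      then show ?thesis using p(2) by (simp add: Z_def)
    qed
    then show "\<sigma> \<in> F" unfolding F_def X using base by (auto simp: s.hom_add s.hom_mult)
  qed
  then have "compactin ?X ?G" using closedin_compact_space[OF compX closedF] by simp
  then have comp: "compact_space (subtopology ?X ?G)" by (rule compact_space_subtopology)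
  have GX: "?G \<subseteq> topspace ?X" using closedin_subset[OF closedF] \<open>F = ?G\<close> by simp
  have "continuous_map (subtopology ?X ?G) (galois_topology i) (\<lambda>\<sigma>. \<sigma>)"
    unfolding galois_topology_def
  proof (rule continuous_on_generated_topo)
    show "(\<lambda>\<sigma>. \<sigma>) ` topspace (subtopology ?X ?G) \<subseteq>
      \<Union> {{\<tau> \<in> galois_group i. \<forall>x\<in>L. \<tau> x = \<sigma> x} | \<sigma> L. \<sigma> \<in> galois_group i \<and> finite_subextension i L}"
      using topspace_galois_topology[OF alg] unfolding galois_topology_def topology_generated_by_topspace by auto
    fix U assume "U \<in> {{\<tau> \<in> galois_group i. \<forall>x\<in>L. \<tau> x = \<sigma> x} | \<sigma> L. \<sigma> \<in> galois_group i \<and> finite_subextension i L}"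
    then obtain \<sigma> L where U: "U = {\<tau> \<in> ?G. \<forall>x\<in>L. \<tau> x = \<sigma> x}" "\<sigma> \<in> ?G" "finite_subextension i L" by blast
    then obtain B where B: "finite B" "L = {\<Sum>b\<in>B. i (c b) * b | c. True}" unfolding finite_subextension_def by blast
    have "U = ?G \<inter> (topspace ?X \<inter> (\<Inter>b\<in>B. {\<tau> \<in> topspace ?X. \<tau> b \<in> {\<sigma> b}}))"
    proof (intro equalityI subsetI)
      fix \<tau> assume t: "\<tau> \<in> U"
      have "b \<in> L" if "b \<in> B" for b
      proof -
        have "b = (\<Sum>b'\<in>B. i (if b' = b then 1 else 0) * b')"
          using B(1) that by (simp add: if_distrib[of i] if_distrib[of "\<lambda>x. x * _"] cong: if_cong)
        then show ?thesis unfolding B(2)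
          by (intro CollectI exI[of _ "\<lambda>b'. if b' = b then 1 else 0"] conjI TrueI)
      qed
      then show "\<tau> \<in> ?G \<inter> (topspace ?X \<inter> (\<Inter>b\<in>B. {\<tau> \<in> topspace ?X. \<tau> b \<in> {\<sigma> b}}))"
        using t GX unfolding U(1) by auto
    next
      fix \<tau> assume t: "\<tau> \<in> ?G \<inter> (topspace ?X \<inter> (\<Inter>b\<in>B. {\<tau> \<in> topspace ?X. \<tau> b \<in> {\<sigma> b}}))"
      interpret t: field_hom \<tau> using t by (simp add: galois_group_def)
      interpret s: field_hom \<sigma> using U(2) by (simp add: galois_group_def)
      have base: "\<tau> (i a) = i a" "\<sigma> (i a) = i a" for a using t U(2) by (auto simp: galois_group_def)
      have "\<tau> x = \<sigma> x" if x: "x \<in> L" for x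
      proof -
        obtain c where c: "x = (\<Sum>b\<in>B. i (c b) * b)" using x unfolding B(2) by blast
        show ?thesis unfolding c using t
          by (auto simp: t.hom_sum s.hom_sum t.hom_mult s.hom_mult base intro!: sum.cong)
      qed
      then show "\<tau> \<in> U" using t unfolding U(1) by simp
    qed
    moreover have "openin ?X (topspace ?X \<inter> (\<Inter>b\<in>B. {\<tau> \<in> topspace ?X. \<tau> b \<in> {\<sigma> b}}))"
      using B(1)
    proof (induction B rule: finite_induct)
      case (insert b F)
      have "topspace ?X \<inter> (\<Inter>b\<in>insert b F. {\<tau> \<in> topspace ?X. \<tau> b \<in> {\<sigma> b}}) =
         {\<tau> \<in> topspace ?X. \<tau> b \<in> {\<sigma> b}} \<inter> (topspace ?X \<inter> (\<Inter>b\<in>F. {\<tau> \<in> topspace ?X. \<tau> b \<in> {\<sigma> b}}))" by blast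
      then show ?case by (simp only: openin_Int[OF proj insert.IH])
    qed (simp only: INT_empty Int_UNIV_right openin_topspace)
    ultimately have "openin (subtopology ?X ?G) U" unfolding openin_subtopology by blast
    moreover have "U \<subseteq> topspace (subtopology ?X ?G)" using GX U(1) by auto
    then have "(\<lambda>\<sigma>. \<sigma>) -` U \<inter> topspace (subtopology ?X ?G) = U" by auto
    ultimately show "openin (subtopology ?X ?G) ((\<lambda>\<sigma>. \<sigma>) -` U \<inter> topspace (subtopology ?X ?G))" by simp
  qed
  then have "compactin (galois_topology i) ((\<lambda>\<sigma>. \<sigma>) ` topspace (subtopology ?X ?G))"
    using comp by (intro image_compactin) (auto simp: compact_space_def)
  moreover have "(\<lambda>\<sigma>. \<sigma>) ` topspace (subtopology ?X ?G) = topspace (galois_topology i)"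
    using GX by (auto simp: topspace_galois_topology[OF alg])
  ultimately show ?thesis by (simp add: compact_space_def)
qed

section \<open>Points with the same restriction are conjugate\<close>

lemma prod_mset_strict_mono:
  fixes f g :: "'z \<Rightarrow> real"
  assumes "b \<in># A" "f b < g b" "\<And>a. a \<in># A \<Longrightarrow> 0 \<le> f a \<and> f a \<le> g a \<and> 0 < g a"
  shows "prod_mset (image_mset f A) < prod_mset (image_mset g A)"
proof -
  obtain B where A: "A = add_mset b B" using assms(1) by (metis multi_member_split)
  have "0 \<le> prod_mset (image_mset f B) \<and> prod_mset (image_mset f B) \<le> prod_mset (image_mset g B)
      \<and> 0 < prod_mset (image_mset g B)"
    using assms(3) unfolding A
  proof (induction B)
    case (add x B)
    have x: "0 \<le> f x" "f x \<le> g x" "0 < g x" using add.prems[of x] by auto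
    have "0 \<le> prod_mset (image_mset f B) \<and> prod_mset (image_mset f B) \<le> prod_mset (image_mset g B)
      \<and> 0 < prod_mset (image_mset g B)"
      using add.prems by (intro add.IH) auto
    then show ?case using x by (auto intro!: mult_mono)
  qed simp
  then have "f b * prod_mset (image_mset f B) \<le> f b * prod_mset (image_mset g B)"
    "f b * prod_mset (image_mset g B) < g b * prod_mset (image_mset g B)"
    using assms(2,3) A by (auto intro: mult_left_mono)
  then show ?thesis by (simp add: A)
qed

text \<open>When \<open>z\<close> is at least as close to \<open>x\<close> as \<open>w\<close> is, the
  value at \<open>T - w\<close> depends only on the value at \<open>T - z\<close> and on the
  distance of \<open>z\<close> and \<open>w\<close>.\<close>

lemma (in berkovich_point) shift_linear:
  assumes "x [:- z, 1:] \<le> x [:- w, 1:]"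
  shows "x [:- w, 1:] = max (x [:- z, 1:]) (v (z - w))"
proof (rule antisym)
  have "x ([:- z, 1:] + [:z - w:]) \<le> max (x [:- z, 1:]) (x [:z - w:])" by (rule x_ultrametric)
  then show "x [:- w, 1:] \<le> max (x [:- z, 1:]) (v (z - w))" by (simp add: x_const)
  have "x ([:- w, 1:] + - [:- z, 1:]) \<le> max (x [:- w, 1:]) (x (- [:- z, 1:]))" by (rule x_ultrametric)
  then have "v (z - w) \<le> x [:- w, 1:]" using assms by (simp only: x_minus) (simp add: x_const)
  then show "max (x [:- z, 1:]) (v (z - w)) \<le> x [:- w, 1:]" using assms by simp
qed

context berkovich_galois
begin

abbreviation G where "G \<equiv> galois_group i"
abbreviation E where "E \<equiv> galois_extend vc (l \<circ> j)"
abbreviation act where "act \<equiv> galois_act vc (l \<circ> j)"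
abbreviation proj where "proj \<equiv> berkovich_projection (l \<circ> j \<circ> i)"
abbreviation pts where "pts \<equiv> berkovich_points vc"
abbreviation ev where "ev P b \<equiv> poly (map_poly (j \<circ> i) P) b"

lemma E_extends:
  assumes "\<sigma> \<in> G"
  shows "extends \<sigma> (E \<sigma>)" "field_hom (E \<sigma>)" "vc (E \<sigma> z) = vc z" "E \<sigma> (l (j s)) = l (j (\<sigma> s))"
    "E \<sigma> (l (j (i a))) = l (j (i a))" "\<exists>b'. E \<sigma> (l b) = l b'"
proof -
  obtain \<phi> where \<phi>: "field_hom \<phi>" "\<And>s. \<phi> (j s) = j (\<sigma> s)" using endomorphism_of_galois[OF assms] by blast
  note * = galois_extend_of_endomorphism[OF assms \<phi>]
  show 1: "extends \<sigma> (E \<sigma>)" by (rule *(1))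
  then show "field_hom (E \<sigma>)" "E \<sigma> (l (j s)) = l (j (\<sigma> s))" for s by (simp_all add: extends_def)
  then show "E \<sigma> (l (j (i a))) = l (j (i a))" using assms by (simp add: galois_group_def)
  show "vc (E \<sigma> z) = vc z" by (rule *(2))
  show "\<exists>b'. E \<sigma> (l b) = l b'" using *(3) by blast
qed

lemma inverse_in_G:
  assumes "\<sigma> \<in> G"
  shows "inv_into UNIV \<sigma> \<in> G"
proof -
  interpret s: field_hom \<sigma> using assms by (simp add: galois_group_def)
  have bij: "bij \<sigma>" using assms by (simp add: galois_group_def)
  have inv: "\<sigma> (inv_into UNIV \<sigma> x) = x" for x using bij by (simp add: bij_is_surj surj_f_inv_f)
  have "field_hom (inv_into UNIV \<sigma>)"
    by unfold_locales (rule s.injectivity, simp add: inv s.hom_add s.hom_mult)+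
  moreover have "inv_into UNIV \<sigma> (i a) = i a" for a
    by (rule s.injectivity) (use assms in \<open>simp add: inv galois_group_def\<close>)
  ultimately show ?thesis using bij_imp_bij_inv[OF bij] by (simp add: galois_group_def)
qed

lemma extends_comp: "extends \<sigma> \<tau> \<Longrightarrow> extends \<rho> \<tau>' \<Longrightarrow> extends (\<sigma> \<circ> \<rho>) (\<tau> \<circ> \<tau>')"
  unfolding extends_def by (auto intro: field_hom_comp bij_comp continuous_map_compose)

lemma extends_id: "extends id id"
proof -
  have "field_hom (id :: 'c \<Rightarrow> 'c)" by unfold_locales simp_all
  then show ?thesis unfolding extends_def by simp
qed

lemma E_inverse:
  assumes "\<sigma> \<in> G"
  shows "E \<sigma> (E (inv_into UNIV \<sigma>) z) = z" "E (inv_into UNIV \<sigma>) (E \<sigma> z) = z"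
proof -
  have bij: "bij \<sigma>" using assms by (simp add: galois_group_def)
  have s: "\<sigma> \<circ> inv_into UNIV \<sigma> = id" "inv_into UNIV \<sigma> \<circ> \<sigma> = id"
    using bij by (simp_all add: fun_eq_iff bij_is_surj surj_f_inv_f bij_is_inj inv_f_f)
  have "extends id (E \<sigma> \<circ> E (inv_into UNIV \<sigma>))" "extends id (E (inv_into UNIV \<sigma>) \<circ> E \<sigma>)"
    using extends_comp[OF E_extends(1)[OF assms] E_extends(1)[OF inverse_in_G[OF assms]]]
      extends_comp[OF E_extends(1)[OF inverse_in_G[OF assms]] E_extends(1)[OF assms]] by (simp_all only: s)
  from this[THEN extends_unique, OF extends_id]
  show "E \<sigma> (E (inv_into UNIV \<sigma>) z) = z" "E (inv_into UNIV \<sigma>) (E \<sigma> z) = z"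
    by (metis comp_apply id_apply)+
qed

lemma act_in_pts:
  assumes "\<sigma> \<in> G" "x \<in> pts"
  shows "act \<sigma> x \<in> pts"
proof -
  interpret t: field_hom "E \<sigma>" by (rule E_extends(2)[OF assms(1)])
  interpret tp: map_poly_inj_idom_hom "E \<sigma>" ..
  show ?thesis using assms(2) E_extends(3)[OF assms(1)]
    unfolding berkovich_points_def galois_act_def
    by (simp add: tp.hom_add tp.hom_mult t.map_poly_pCons_hom)
qed

lemma act_linear:
  assumes "\<sigma> \<in> G"
  shows "act \<sigma> x [:- z, 1:] = x [:- E \<sigma> z, 1:]" "act \<sigma> x [:0, 1:] = x [:0, 1:]"
proof -
  interpret t: field_hom "E \<sigma>" by (rule E_extends(2)[OF assms(1)])
  show "act \<sigma> x [:- z, 1:] = x [:- E \<sigma> z, 1:]" "act \<sigma> x [:0, 1:] = x [:0, 1:]"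
    unfolding galois_act_def by (simp_all add: t.map_poly_pCons_hom t.hom_uminus)
qed

lemma proj_act:
  assumes "\<sigma> \<in> G"
  shows "proj (act \<sigma> x) = proj x"
proof -
  interpret t: field_hom "E \<sigma>" by (rule E_extends(2)[OF assms])
  have "map_poly (E \<sigma>) (map_poly (l \<circ> j \<circ> i) P) = map_poly (l \<circ> j \<circ> i) P" for P
    by (simp add: poly_eq_iff coeff_map_poly E_extends(5)[OF assms])
  then show ?thesis unfolding galois_act_def berkovich_projection_def by simp
qed

lemma proj_in_points:
  assumes "x \<in> pts"
  shows "proj x \<in> berkovich_points vk"
proof -
  have "field_hom (l \<circ> j \<circ> i)"
    by unfold_locales (auto simp: i.hom_add i.hom_mult j.hom_add j.hom_mult l.hom_add l.hom_mult)
  then interpret h: field_hom "l \<circ> j \<circ> i" .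
  interpret hp: map_poly_inj_idom_hom "l \<circ> j \<circ> i" ..
  have "vc ((l \<circ> j \<circ> i) a) = vk a" for a using ext.va_e[of a] by (simp add: dn.vc_l)
  then show ?thesis using assms unfolding berkovich_points_def berkovich_projection_def
    by (simp add: hp.hom_add hp.hom_mult h.map_poly_pCons_hom)
qed

lemma proj_eq: "proj x P = x (map_poly l (map_poly (j \<circ> i) P))"
proof -
  have "map_poly l (map_poly (j \<circ> i) P) = map_poly (l \<circ> j \<circ> i) P"
    by (simp add: poly_eq_iff coeff_map_poly)
  then show ?thesis by (simp add: berkovich_projection_def)
qed

text \<open>The homomorphism that is the identity on the base field and maps \<open>\<alpha>\<close> to
  \<open>\<beta>\<close> is defined on the field generated by \<open>\<alpha>\<close>; extend it
  to the algebraic closure and restrict it to the separable closure.\<close>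

lemma conjugate:
  assumes m: "m \<noteq> 0" "ev m \<alpha> = 0"
    and min: "\<And>q. q \<noteq> 0 \<Longrightarrow> ev q \<alpha> = 0 \<Longrightarrow> degree m \<le> degree q"
    and root: "ev m \<beta> = 0"
  shows "\<exists>\<sigma>\<in>G. E \<sigma> (l \<alpha>) = l \<beta>"
proof -
  define \<Gamma> where "\<Gamma> = {((j \<circ> i) a, (j \<circ> i) a) | a. True}"
  have \<Gamma>I: "((j \<circ> i) a, (j \<circ> i) a) \<in> \<Gamma>" for a unfolding \<Gamma>_def by blast
  have ph: "partial_hom \<Gamma>"
    unfolding partial_hom_def
  proof (intro conjI allI impI)
    show "(1, 1) \<in> \<Gamma>" using \<Gamma>I[of 1] by simp
    fix a b c d assume "(a, b) \<in> \<Gamma>" "(c, d) \<in> \<Gamma>"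
    then obtain s t where "a = (j \<circ> i) s" "b = (j \<circ> i) s" "c = (j \<circ> i) t" "d = (j \<circ> i) t" unfolding \<Gamma>_def by blast
    then show "(a - c, b - d) \<in> \<Gamma>" "(a * c, b * d) \<in> \<Gamma>"
      using \<Gamma>I[of "s - t"] \<Gamma>I[of "s * t"] by (simp_all add: i.hom_minus j.hom_minus i.hom_mult j.hom_mult)
  next
    fix b assume "(0, b) \<in> \<Gamma>"
    then show "b = 0" unfolding \<Gamma>_def by auto
  qed
  have "partial_hom (adjoin_pair \<Gamma> \<alpha> \<beta>)"
  proof (rule partial_hom_adjoin_pair[OF ph])
    show "\<exists>c. (inverse a, c) \<in> \<Gamma>" if ab: "(a, b) \<in> \<Gamma>" for a b
    proof -
      obtain s where "a = (j \<circ> i) s" using ab unfolding \<Gamma>_def by blast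
      then have "inverse a = (j \<circ> i) (inverse s)" by (simp add: i.hom_inverse j.hom_inverse)
      then show ?thesis using \<Gamma>I[of "inverse s"] by auto
    qed
    show "map_poly (j \<circ> i) m \<noteq> 0" using m(1) by simp
    show "(coeff (map_poly (j \<circ> i) m) n, coeff (map_poly (j \<circ> i) m) n) \<in> \<Gamma>" for n
      using \<Gamma>I by (simp add: coeff_map_poly)
    show "ev m \<beta> = 0" "ev m \<alpha> = 0" by fact+
    fix p :: "'a poly" assume p: "poly p \<alpha> = 0" "p \<noteq> 0" "\<forall>n. coeff p n \<in> Domain \<Gamma>"
    have "\<forall>n. \<exists>a. coeff p n = (j \<circ> i) a" using p(3) unfolding \<Gamma>_def by auto
    then obtain c where c: "\<And>n. coeff p n = (j \<circ> i) (c n)" by metis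
    define q where "q = (\<Sum>n\<le>degree p. monom (c n) n)"
    have "map_poly (j \<circ> i) q = p"
    proof (rule poly_eqI)
      fix n
      have "(j \<circ> i) (c n) = 0" if "n > degree p" using c[of n] that by (simp add: coeff_eq_0)
      then have "(j \<circ> i) (coeff q n) = (j \<circ> i) (c n)"
        by (auto simp: q_def coeff_sum coeff_monom not_le)
      then show "coeff (map_poly (j \<circ> i) q) n = coeff p n" using c by (simp add: coeff_map_poly)
    qed
    then show "degree (map_poly (j \<circ> i) m) \<le> degree p"
      using min[of q] p by (metis ext.e.degree_map_poly_hom map_poly_0)
  qed
  moreover have sub: "\<Gamma> \<subseteq> adjoin_pair \<Gamma> \<alpha> \<beta>"
  proof
    fix ab assume "ab \<in> \<Gamma>"
    then have "\<forall>n. (coeff [:fst ab:] n, coeff [:snd ab:] n) \<in> \<Gamma>"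
      using partial_hom_zero[OF ph] by (auto simp: coeff_pCons split: nat.split)
    then show "ab \<in> adjoin_pair \<Gamma> \<alpha> \<beta>"
      unfolding adjoin_pair_def
      by (intro CollectI exI[of _ "[:fst ab:]"] exI[of _ "[:snd ab:]"]) auto
  qed
  then have "range (j \<circ> i) \<subseteq> Domain (adjoin_pair \<Gamma> \<alpha> \<beta>)" using \<Gamma>I by blast
  ultimately obtain \<phi> where \<phi>: "field_hom \<phi>" "\<forall>(a, b) \<in> adjoin_pair \<Gamma> \<alpha> \<beta>. \<phi> a = b"
    using partial_hom_extends[OF ext.algebraic, of "adjoin_pair \<Gamma> \<alpha> \<beta>"] by blast
  have base: "\<phi> (j (i a)) = j (i a)" for a using \<phi>(2) sub \<Gamma>I[of a] by fastforce
  have "\<forall>n. (coeff [:0, 1:] n, coeff [:0, 1:] n) \<in> \<Gamma>"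
    using partial_hom_zero[OF ph] partial_hom_one[OF ph] by (auto simp: coeff_pCons split: nat.split)
  then have "(\<alpha>, \<beta>) \<in> adjoin_pair \<Gamma> \<alpha> \<beta>"
    unfolding adjoin_pair_def by (intro CollectI exI[of _ "[:0, 1:]"]) auto
  then have \<phi>\<alpha>: "\<phi> \<alpha> = \<beta>" using \<phi>(2) by fastforce
  obtain \<sigma> where \<sigma>: "\<sigma> \<in> G" "\<And>s. \<phi> (j s) = j (\<sigma> s)" using galois_of_endomorphism[OF \<phi>(1) base] by blast
  show ?thesis using galois_extend_of_endomorphism(3)[OF \<sigma>(1) \<phi>(1) \<sigma>(2)] \<sigma>(1) \<phi>\<alpha> by blast
qed

lemma E_root:
  assumes "\<sigma> \<in> G" "E \<sigma> (l b) = l b'" "ev M b = 0"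
  shows "ev M b' = 0"
proof -
  interpret t: field_hom "E \<sigma>" by (rule E_extends(2)[OF assms(1)])
  let ?M = "map_poly l (map_poly (j \<circ> i) M)"
  have "map_poly (E \<sigma>) ?M = ?M"
    by (simp add: poly_eq_iff coeff_map_poly E_extends(5)[OF assms(1)])
  then have "poly ?M (E \<sigma> (l b)) = E \<sigma> (poly ?M (l b))" by (metis t.poly_map_poly)
  also have "poly ?M (l b) = l 0" using assms(3) by (metis l.poly_map_poly)
  also have "E \<sigma> (l 0) = 0" by (simp only: l.hom_zero t.hom_zero)
  finally have "poly ?M (l b') = 0" unfolding assms(2) .
  then have "l (ev M b') = 0" by (simp only: l.poly_map_poly)
  then show ?thesis by (rule l.hom_0)
qed

text \<open>The heart of the description of the fibres. Let \<open>r\<close> be the value of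
  \<open>y\<close> at \<open>T - a\<close>, and conjugate \<open>x\<close> such that its value
  \<open>r'\<close> at \<open>T - a\<close> is minimal among the values at \<open>T - b\<close>
  for conjugates \<open>b\<close> of \<open>a\<close>. By minimality the values at these \<open>T
  - b\<close> are \<open>max r d\<close> for \<open>y\<close> and \<open>max r' d\<close> for
  \<open>x\<close>, where \<open>d\<close> is the distance of \<open>a\<close> and
  \<open>b\<close>. Multiplied over all \<open>b\<close> they give the values at the minimal
  polynomial of \<open>a\<close>, which are equal because it has coefficients in the base field.
  As \<open>r \<le> r'\<close>, this forces \<open>r = r'\<close>, and now the same formula gives
  equal values at all roots of \<open>M\<close>.\<close>

lemma conjugate_on_roots:
  assumes x: "x \<in> pts" and y: "y \<in> pts" and eq: "proj x = proj y"
    and M: "M \<noteq> 0" and a: "ev M a = 0"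
    and le: "\<And>b. ev M b = 0 \<Longrightarrow> y [:- l a, 1:] \<le> x [:- l b, 1:] \<and> y [:- l a, 1:] \<le> y [:- l b, 1:]"
  shows "\<exists>\<sigma>\<in>G. \<forall>b. ev M b = 0 \<longrightarrow> x [:- E \<sigma> (l b), 1:] = y [:- l b, 1:]"
proof -
  obtain m where m: "m \<noteq> 0" "ev m a = 0"
    and min: "\<And>q. q \<noteq> 0 \<Longrightarrow> ev q a = 0 \<Longrightarrow> degree m \<le> degree q"
    using ext.minimal_poly_exists[of a] by blast
  \<comment> \<open>The multiset of conjugates of \<open>a\<close>, with multiplicities.\<close>
  define A where "A = (SOME A. map_poly (j \<circ> i) m = smult (lead_coeff (map_poly (j \<circ> i) m)) (\<Prod>b\<in>#A. [:- b, 1:]))"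
  have em0: "map_poly (j \<circ> i) m \<noteq> 0" using m(1) by simp
  have A: "map_poly (j \<circ> i) m = smult (lead_coeff (map_poly (j \<circ> i) m)) (\<Prod>b\<in>#A. [:- b, 1:])"
    unfolding A_def by (rule someI_ex) (use alg_closed_imp_factorization[OF em0] in blast)
  define c where "c = lead_coeff (map_poly (j \<circ> i) m)"
  have c0: "c \<noteq> 0" using em0 by (simp add: c_def)
  have rootA: "ev m b = 0 \<longleftrightarrow> b \<in># A" for b
  proof -
    have "poly (\<Prod>b\<in>#A. [:- b, 1:]) b = prod_mset (image_mset (\<lambda>d. b - d) A)"
      by (induction A) (auto simp: algebra_simps)
    then have "ev m b = c * prod_mset (image_mset (\<lambda>d. b - d) A)"
      by (subst A) (simp add: c_def)
    then show ?thesis using c0 by (auto simp: prod_mset_zero_iff)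
  qed
  have aA: "a \<in># A" using rootA m(2) by blast
  obtain b\<^sub>0 where b0: "b\<^sub>0 \<in># A" "\<And>b. b \<in># A \<Longrightarrow> x [:- l b\<^sub>0, 1:] \<le> x [:- l b, 1:]"
    using ex_is_arg_min_if_finite[of "set_mset A" "\<lambda>b. x [:- l b, 1:]"] aA
    unfolding is_arg_min_linorder by (metis empty_iff finite_set_mset)
  obtain \<sigma> where \<sigma>: "\<sigma> \<in> G" "E \<sigma> (l a) = l b\<^sub>0" using conjugate[OF m min] b0(1) rootA by blast
  define x' where "x' = act \<sigma> x"
  have x': "x' \<in> pts" unfolding x'_def by (rule act_in_pts[OF \<sigma>(1) x])
  interpret x': berkovich_point vc x' by unfold_locales (fact x')
  interpret y: berkovich_point vc y by unfold_locales (fact y)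
  have x'l: "x' [:- z, 1:] = x [:- E \<sigma> z, 1:]" for z unfolding x'_def by (rule act_linear(1)[OF \<sigma>(1)])
  define r where "r = y [:- l a, 1:]"
  define r' where "r' = x' [:- l a, 1:]"
  have r0: "0 \<le> r" unfolding r_def by (rule y.x_nonneg)
  have leS: "r \<le> x' [:- l b, 1:] \<and> r \<le> y [:- l b, 1:]" if "ev M b = 0" for b
  proof -
    obtain b' where b': "E \<sigma> (l b) = l b'" using E_extends(6)[OF \<sigma>(1)] by blast
    have "ev M b' = 0" by (rule E_root[OF \<sigma>(1) b' that])
    then show ?thesis using le[of b'] le[OF that] by (simp add: x'l b' r_def)
  qed
  have leA: "r' \<le> x' [:- l b, 1:]" if "b \<in># A" for b
  proof -
    obtain b' where b': "E \<sigma> (l b) = l b'" using E_extends(6)[OF \<sigma>(1)] by blast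
    have "b' \<in># A" using E_root[OF \<sigma>(1) b', of m] that rootA by blast
    then show ?thesis using b0(2)[of b'] by (simp add: r'_def x'l b' \<sigma>(2))
  qed
  have AM: "ev M b = 0" if bA: "b \<in># A" for b
  proof -
    have "ev m b = 0" using bA rootA by blast
    from conjugate[OF m min this] obtain \<rho> where "\<rho> \<in> G" "E \<rho> (l a) = l b" by blast
    then show ?thesis using E_root[of \<rho> a b M] a by blast
  qed
  have prods: "prod_mset (image_mset (\<lambda>b. x' [:- l b, 1:]) A) = prod_mset (image_mset (\<lambda>b. y [:- l b, 1:]) A)"
  proof -
    have "map_poly l (map_poly (j \<circ> i) m) = map_poly l (smult c (\<Prod>b\<in>#A. [:- b, 1:]))"
      by (rule arg_cong[where f = "map_poly l"]) (unfold c_def, rule A)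
    also have "\<dots> = smult (l c) (\<Prod>b\<in>#image_mset l A. [:- b, 1:])"
      by (rule l.map_poly_prod_linear)
    finally have lm: "map_poly l (map_poly (j \<circ> i) m) = smult (l c) (\<Prod>b\<in>#image_mset l A. [:- b, 1:])" .
    have "proj x' = proj y" unfolding x'_def proj_act[OF \<sigma>(1)] by (rule eq)
    then have "x' (map_poly l (map_poly (j \<circ> i) m)) = y (map_poly l (map_poly (j \<circ> i) m))"
      by (metis proj_eq)
    then have "vc (l c) * prod_mset (image_mset (\<lambda>b. x' [:- b, 1:]) (image_mset l A))
        = vc (l c) * prod_mset (image_mset (\<lambda>b. y [:- b, 1:]) (image_mset l A))"
      unfolding lm x'.point_prod_linear y.point_prod_linear .
    moreover have "vc (l c) \<noteq> 0" using c0 by (simp add: c.eq_0_iff)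
    ultimately show ?thesis by (simp add: image_mset.compositionality comp_def)
  qed
  have "r' = r"
  proof (rule ccontr)
    assume "r' \<noteq> r"
    then have lt: "r < r'" using leS[OF a] by (simp add: r'_def)
    have "prod_mset (image_mset (\<lambda>b. y [:- l b, 1:]) A) < prod_mset (image_mset (\<lambda>b. x' [:- l b, 1:]) A)"
    proof (rule prod_mset_strict_mono[OF aA])
      show "y [:- l a, 1:] < x' [:- l a, 1:]" using lt by (simp add: r_def r'_def)
      fix b assume b: "b \<in># A"
      have "y [:- l b, 1:] = max r (vc (l a - l b))"
        unfolding r_def by (rule y.shift_linear) (use leS[OF AM[OF b]] r_def in simp)
      moreover have "x' [:- l b, 1:] = max r' (vc (l a - l b))"
        unfolding r'_def by (rule x'.shift_linear) (use leA[OF b] r'_def in simp)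
      ultimately show "0 \<le> y [:- l b, 1:] \<and> y [:- l b, 1:] \<le> x' [:- l b, 1:] \<and> 0 < x' [:- l b, 1:]"
        using lt r0 by auto
    qed
    then show False using prods by simp
  qed
  have "x [:- E \<sigma> (l b), 1:] = y [:- l b, 1:]" if b: "ev M b = 0" for b
  proof -
    have "y [:- l b, 1:] = max r (vc (l a - l b))"
      unfolding r_def by (rule y.shift_linear) (use leS[OF b] r_def in simp)
    moreover have "x' [:- l b, 1:] = max r' (vc (l a - l b))"
      unfolding r'_def by (rule x'.shift_linear) (use leS[OF b] \<open>r' = r\<close> r'_def in simp)
    ultimately show ?thesis using \<open>r' = r\<close> by (simp add: x'l)
  qed
  then show ?thesis using \<sigma>(1) by blast
qed

text \<open>Enlarge \<open>F\<close> to the set of all roots of a polynomial over the base field. If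
  \<open>y\<close> attains the smallest of all values of \<open>x\<close> and \<open>y\<close> on
  this set, the previous lemma applies directly; if \<open>x\<close> does, exchange the points
  and invert the automorphism.\<close>

lemma conjugate_on_finite_set:
  assumes x: "x \<in> pts" and y: "y \<in> pts" and eq: "proj x = proj y" and F: "finite F"
  shows "\<exists>\<sigma>\<in>G. \<forall>b\<in>F. x [:- E \<sigma> (l b), 1:] = y [:- l b, 1:]"
proof (cases "F = {}")
  case True
  have "field_hom (id :: 's \<Rightarrow> 's)" by unfold_locales simp_all
  then have "id \<in> G" unfolding galois_group_def by simp
  then show ?thesis using True by blast
next
  case False
  obtain p where p: "\<And>b. p b \<noteq> 0" "\<And>b. ev (p b) b = 0"
    using ext.algebraic unfolding is_algebraic_extension_def by metis
  define M where "M = (\<Prod>b\<in>F. p b)"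
  interpret ep: map_poly_inj_idom_hom "j \<circ> i" ..
  have M0: "M \<noteq> 0" using p(1) F by (simp add: M_def)
  define S where "S = {b. ev M b = 0}"
  have finS: "finite S" unfolding S_def using M0 by (intro poly_roots_finite) simp
  have FS: "F \<subseteq> S"
    unfolding S_def M_def using F p(2) by (auto simp: ep.hom_prod poly_prod)
  then have neS: "S \<noteq> {}" using False by blast
  obtain a1 where a1: "a1 \<in> S" "\<And>b. b \<in> S \<Longrightarrow> x [:- l a1, 1:] \<le> x [:- l b, 1:]"
    using ex_is_arg_min_if_finite[OF finS neS, of "\<lambda>b. x [:- l b, 1:]"]
    unfolding is_arg_min_linorder by blast
  obtain a2 where a2: "a2 \<in> S" "\<And>b. b \<in> S \<Longrightarrow> y [:- l a2, 1:] \<le> y [:- l b, 1:]"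
    using ex_is_arg_min_if_finite[OF finS neS, of "\<lambda>b. y [:- l b, 1:]"]
    unfolding is_arg_min_linorder by blast
  show ?thesis
  proof (cases "y [:- l a2, 1:] \<le> x [:- l a1, 1:]")
    case True
    then have "\<exists>\<sigma>\<in>G. \<forall>b. ev M b = 0 \<longrightarrow> x [:- E \<sigma> (l b), 1:] = y [:- l b, 1:]"
      using a1(2) a2 by (intro conjugate_on_roots[OF x y eq M0, of a2]) (force simp: S_def)+
    then show ?thesis using FS unfolding S_def by blast
  next
    case le: False
    then have "\<exists>\<sigma>\<in>G. \<forall>b. ev M b = 0 \<longrightarrow> y [:- E \<sigma> (l b), 1:] = x [:- l b, 1:]"
      using a2(2) a1 by (intro conjugate_on_roots[OF y x eq[symmetric] M0, of a1]) (force simp: S_def)+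
    then obtain \<sigma> where \<sigma>: "\<sigma> \<in> G" "\<And>b. b \<in> S \<Longrightarrow> y [:- E \<sigma> (l b), 1:] = x [:- l b, 1:]"
      unfolding S_def by blast
    have "x [:- E (inv_into UNIV \<sigma>) (l b), 1:] = y [:- l b, 1:]" if "b \<in> S" for b
    proof -
      obtain b' where b': "E (inv_into UNIV \<sigma>) (l b) = l b'"
        using E_extends(6)[OF inverse_in_G[OF \<sigma>(1)]] by blast
      have "b' \<in> S" using E_root[OF inverse_in_G[OF \<sigma>(1)] b'] that by (simp add: S_def)
      then have "y [:- E \<sigma> (l b'), 1:] = x [:- l b', 1:]" by (rule \<sigma>(2))
      then show ?thesis unfolding b'[symmetric] E_inverse(1)[OF \<sigma>(1)] by simp
    qed
    then show ?thesis using FS inverse_in_G[OF \<sigma>(1)] by blast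
  qed
qed

section \<open>Lifting points to the completed algebraic closure\<close>

text \<open>The kernel contains the minimal polynomial of some \<open>\<alpha>\<close>, and then the point
  is evaluation at \<open>\<alpha>\<close>.\<close>

lemma degenerate_point_lifts:
  assumes y: "y \<in> berkovich_points vk" and P: "P \<noteq> 0" "y P = 0"
  shows "\<exists>x\<^sub>0\<in>berkovich_points va. \<forall>Q. x\<^sub>0 (map_poly (j \<circ> i) Q) = y Q"
proof -
  interpret y: berkovich_point vk y by unfold_locales fact
  obtain P where P: "P \<noteq> 0" "y P = 0" and minP: "\<And>Q. Q \<noteq> 0 \<Longrightarrow> y Q = 0 \<Longrightarrow> degree P \<le> degree Q"
    using ex_has_least_nat[of "\<lambda>P. P \<noteq> 0 \<and> y P = 0" P degree] P by blast
  have "degree P > 0"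
  proof (rule ccontr)
    assume "\<not> degree P > 0"
    then obtain c where "P = [:c:]" using degree_eq_zeroE by blast
    then show False using P by (simp add: y.x_const k.eq_0_iff)
  qed
  then have "degree (map_poly (j \<circ> i) P) > 0" by (simp only: ext.e.degree_map_poly_hom)
  then obtain \<alpha> where \<alpha>: "ev P \<alpha> = 0" using alg_closed_imp_poly_has_root by blast
  obtain m where m: "m \<noteq> 0" "ev m \<alpha> = 0"
    and min: "\<And>q. q \<noteq> 0 \<Longrightarrow> ev q \<alpha> = 0 \<Longrightarrow> degree m \<le> degree q"
    using ext.minimal_poly_exists[of \<alpha>] by blast
  interpret ep: map_poly_inj_idom_hom "j \<circ> i" ..
  have "P mod m = 0"
  proof (rule ccontr)
    assume nz: "P mod m \<noteq> 0"
    have "map_poly (j \<circ> i) (P mod m) = map_poly (j \<circ> i) P - map_poly (j \<circ> i) m * map_poly (j \<circ> i) (P div m)"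
      by (simp only: ep.hom_minus[symmetric] ep.hom_mult[symmetric] minus_mult_div_eq_mod)
    then have "ev (P mod m) \<alpha> = 0" using \<alpha> m(2) by simp
    then show False using min[OF nz] degree_mod_less[OF m(1), of P] nz by linarith
  qed
  then obtain u where u: "P = m * u" by (metis mod_0_imp_dvd dvdE)
  have u0: "u \<noteq> 0" using P u by auto
  have "y u \<noteq> 0"
  proof
    assume "y u = 0"
    then have "degree m = 0" using minP[OF u0] degree_mult_eq[OF m(1) u0] u by simp
    then obtain c where "m = [:c:]" using degree_eq_zeroE by blast
    then show False using m by (simp add: ext.e.map_poly_pCons_hom)
  qed
  then have "y m = 0" using P(2) u by (simp add: y.x_mult)
  then have eq: "va (ev Q \<alpha>) = y Q" for Q
    using ext.point_over_root[OF m min y] by simp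
  have "(\<lambda>Q. va (poly Q \<alpha>)) \<in> berkovich_points va"
    unfolding berkovich_points_def by (simp add: a.nonneg a.mult a.v_add)
  then show ?thesis using eq by (intro bexI[of _ "\<lambda>Q. va (poly Q \<alpha>)"]) auto
qed

text \<open>Now \<open>y\<close> is a norm on the polynomial ring, which extends to the rational functions
  over the algebraic closure, because these are generated by the constants and the linear
  polynomials, all algebraic over the original ring. On constants the extension is the given
  absolute value by uniqueness.\<close>

lemma nondegenerate_point_lifts:
  assumes y: "y \<in> berkovich_points vk" and y0: "\<And>P. y P = 0 \<Longrightarrow> P = 0"
  shows "\<exists>x\<^sub>0\<in>berkovich_points va. \<forall>Q. x\<^sub>0 (map_poly (j \<circ> i) Q) = y Q"
proof -
  interpret y: berkovich_point vk y by unfold_locales fact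
  interpret ep: map_poly_inj_idom_hom "j \<circ> i" ..
  define h :: "'a \<Rightarrow> 'a poly fract" where "h c = to_fract [:c:]" for c
  define \<iota> :: "'k poly \<Rightarrow> 'a poly fract" where "\<iota> Q = to_fract (map_poly (j \<circ> i) Q)" for Q
  interpret h: field_hom h
    by unfold_locales (simp_all add: h_def flip: to_fract_add to_fract_mult one_pCons)
  have \<iota>_hom: "inj_idom_hom \<iota>"
    by unfold_locales (simp_all add: \<iota>_def ep.hom_add ep.hom_mult)
  have "normed_subdomain \<iota> y"
  proof (intro normed_subdomain.intro \<iota>_hom)
    show "0 \<le> y b" "y (b * c) = y b * y c" "y (b + c) \<le> max (y b) (y c)" for b c
      by (rule y.x_nonneg y.x_mult y.x_ultrametric)+
    show "y b = 0 \<longleftrightarrow> b = 0" for b using y0 by auto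
  qed
  then interpret n: normed_subdomain \<iota> y .
  obtain R where "n.dominating R" "\<forall>R'. n.dominating R' \<longrightarrow> R \<subseteq> R' \<longrightarrow> R' = R"
    using n.ex_maximal_dominating by blast
  then interpret R: maximal_dominating \<iota> y R by unfold_locales auto
  have \<iota>h: "\<iota> [:a:] = h ((j \<circ> i) a)" for a by (simp add: \<iota>_def h_def ext.e.map_poly_pCons_hom)
  have alg: "\<exists>p. p \<noteq> 0 \<and> poly (map_poly \<iota> p) (h c) = 0" for c
  proof -
    obtain q where q: "q \<noteq> 0" "ev q c = 0"
      using ext.algebraic unfolding is_algebraic_extension_def by blast
    define p where "p = map_poly (\<lambda>a. [:a:]) q"
    have cp: "coeff p n = [:coeff q n:]" for n unfolding p_def by (simp add: coeff_map_poly)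
    have "lead_coeff q \<noteq> 0" using q(1) by simp
    then have "coeff p (degree q) \<noteq> 0" by (simp only: cp pCons_eq_0_iff simp_thms)
    then have "p \<noteq> 0" by auto
    moreover have "map_poly \<iota> p = map_poly h (map_poly (j \<circ> i) q)"
      by (rule poly_eqI) (simp only: n.\<iota>.coeff_map_poly_hom h.coeff_map_poly_hom ext.e.coeff_map_poly_hom cp \<iota>h)
    then have "poly (map_poly \<iota> p) (h c) = h (ev q c)"
      by (simp only: h.poly_map_poly)
    then have "poly (map_poly \<iota> p) (h c) = 0" by (simp only: q(2) h.hom_zero)
    ultimately show ?thesis by blast
  qed
  have value_const: "\<exists>r. R.has_value (h c) r" if "c \<noteq> 0" for c
    using alg[of c] R.has_value_algebraic[of "h c"] that by auto
  have value_linear: "\<exists>r. R.has_value (to_fract [:- b, 1:]) r" for b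
  proof -
    obtain p where p: "p \<noteq> 0" "poly (map_poly \<iota> p) (h b) = 0" using alg by blast
    \<comment> \<open>If \<open>p\<close> annihilates the constant \<open>b\<close>, then \<open>p(T - Z)\<close> annihilates \<open>T - b\<close>.\<close>
    define q where "q = pcompose p [:[:0, 1:], - 1:]"
    define z where "z = to_fract [:- b, 1:]"
    have "q \<noteq> 0"
    proof
      assume "q = 0"
      then have "p = 0" unfolding q_def by (rule pcompose_eq_0) simp
      then show False using p(1) by simp
    qed
    moreover have "poly (map_poly \<iota> q) z = 0"
    proof -
      have "map_poly \<iota> q = pcompose (map_poly \<iota> p) (map_poly \<iota> [:[:0, 1:], - 1:])"
        unfolding q_def by (rule n.\<iota>.map_poly_pcompose)
      then have "poly (map_poly \<iota> q) z = poly (map_poly \<iota> p) (\<iota> [:0, 1:] - z)"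
        by (simp add: poly_pcompose n.\<iota>.map_poly_pCons_hom n.\<iota>.hom_uminus)
      also have "\<iota> [:0, 1:] - z = h b"
        by (simp add: \<iota>_def z_def h_def ext.e.map_poly_pCons_hom flip: to_fract_diff)
      finally show ?thesis using p(2) by simp
    qed
    moreover have "z \<noteq> 0" unfolding z_def by simp
    ultimately show ?thesis unfolding z_def[symmetric] by (intro R.has_value_algebraic)
  qed
  have value_poly: "\<exists>r. R.has_value (to_fract f) r" if f: "f \<noteq> 0" for f
  proof -
    obtain A where A: "f = smult (lead_coeff f) (\<Prod>b\<in>#A. [:- b, 1:])"
      using alg_closed_imp_factorization[OF f] by blast
    have 1: "\<exists>r. R.has_value 1 r" using R.has_value_iota[of 1] by auto
    have "\<exists>r. R.has_value (to_fract (\<Prod>b\<in>#A. [:- b, 1:])) r"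
    proof (induction A)
      case (add b A)
      have "to_fract (\<Prod>b\<in>#add_mset b A. [:- b, 1:]) = to_fract [:- b, 1:] * to_fract (\<Prod>b\<in>#A. [:- b, 1:])"
        by (simp only: image_mset_add_mset prod_mset.add_mset to_fract_mult)
      then show ?case using R.has_value_mult value_linear[of b] add.IH by metis
    qed (simp add: 1)
    moreover have "\<exists>r. R.has_value (h (lead_coeff f)) r" using f by (intro value_const) simp
    ultimately have "\<exists>r. R.has_value (h (lead_coeff f) * to_fract (\<Prod>b\<in>#A. [:- b, 1:])) r"
      using R.has_value_mult by blast
    moreover have "h (lead_coeff f) * to_fract (\<Prod>b\<in>#A. [:- b, 1:]) = to_fract f"
      by (subst (2) A) (simp add: h_def flip: to_fract_mult)
    ultimately show ?thesis by simp
  qed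
  have "\<exists>r. R.has_value z r" if z: "z \<noteq> 0" for z
  proof -
    obtain f g where fg: "z = Fract f g" "g \<noteq> 0" by (cases z) auto
    then have eq: "z = to_fract f * inverse (to_fract g)" by (simp add: Fract_conv_to_fract divide_inverse)
    have "f \<noteq> 0" using z eq by auto
    then show ?thesis unfolding eq using fg(2) R.has_value_mult R.has_value_inverse value_poly by metis
  qed
  then obtain w where w: "nonarch_abs_value w" "\<And>Q. w (\<iota> Q) = y Q" using R.abs_value_extends by blast
  interpret w: nonarch_abs_value w by fact
  have const: "w (h c) = va c" for c
  proof -
    obtain m where m: "m \<noteq> 0" "ev m c = 0"
      and min: "\<And>q. q \<noteq> 0 \<Longrightarrow> ev q c = 0 \<Longrightarrow> degree m \<le> degree q"
      using ext.minimal_poly_exists[of c] by blast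
    \<comment> \<open>The extension, restricted to the field generated by \<open>c\<close>, is a point that kills \<open>m\<close>.\<close>
    define y' where "y' Q = w (h (ev Q c))" for Q
    have "w (h ((j \<circ> i) a)) = vk a" for a using w(2)[of "[:a:]"] by (simp only: \<iota>h y.x_const)
    then have y'1: "y' \<in> berkovich_points vk"
      unfolding berkovich_points_def y'_def
      by (simp add: w.nonneg ep.hom_add ep.hom_mult h.hom_add h.hom_mult w.mult w.v_add ext.e.map_poly_pCons_hom)
    have y'2: "y' m = 0" unfolding y'_def m(2) by simp
    have "y' [:0, 1:] = va (ev [:0, 1:] c)"
      using ext.point_over_root[OF m min y'1 y'2] .
    then show ?thesis by (simp add: y'_def ext.e.map_poly_pCons_hom)
  qed
  have "(\<lambda>f. w (to_fract f)) \<in> berkovich_points va"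
    unfolding berkovich_points_def using const by (simp add: w.nonneg w.mult w.v_add h_def)
  moreover have "w (to_fract (map_poly (j \<circ> i) Q)) = y Q" for Q using w(2)[of Q] by (simp only: \<iota>_def)
  ultimately show ?thesis by (intro bexI[of _ "\<lambda>f. w (to_fract f)"]) auto
qed

lemma proj_surj: "proj ` pts = berkovich_points vk"
proof (intro equalityI subsetI)
  fix y assume "y \<in> proj ` pts"
  then show "y \<in> berkovich_points vk" using proj_in_points by blast
next
  fix y assume y: "y \<in> berkovich_points vk"
  obtain x0 where x0: "x0 \<in> berkovich_points va" "\<And>Q. x0 (map_poly (j \<circ> i) Q) = y Q"
    using degenerate_point_lifts[OF y] nondegenerate_point_lifts[OF y] by blast
  obtain x where "x \<in> pts" "\<And>Q. x (map_poly l Q) = x0 Q" using dn.point_extends[OF x0(1)] by blast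
  then have "x \<in> pts" "proj x = y" using x0(2) by (auto simp: fun_eq_iff proj_eq)
  then show "y \<in> proj ` pts" by blast
qed

section \<open>The quotient by the Galois group\<close>

abbreviation GT where "GT \<equiv> galois_topology i"
abbreviation LC where "LC \<equiv> berkovich_line vc"
abbreviation LK where "LK \<equiv> berkovich_line vk"

lemma topspace_GT: "topspace GT = G"
  by (rule topspace_galois_topology[OF algebraic_i])

text \<open>A power of \<open>b\<close> that determines \<open>b\<close> lies in the separable closure,
  where automorphisms close to \<open>\<sigma>\<^sub>0\<close> agree with it.\<close>

lemma E_locally_constant:
  assumes \<sigma>\<^sub>0: "\<sigma>\<^sub>0 \<in> G"
  shows "\<exists>U. openin GT U \<and> \<sigma>\<^sub>0 \<in> U \<and> (\<forall>\<sigma>\<in>U. E \<sigma> (l b) = E \<sigma>\<^sub>0 (l b))"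
proof -
  obtain q s where q: "b ^ q = j s" "\<And>u w :: 'c. u ^ q = w ^ q \<Longrightarrow> u = w"
    using power_in_separable_closure[of b] by blast
  obtain U where U: "openin GT U" "\<sigma>\<^sub>0 \<in> U" "\<And>\<tau>. \<tau> \<in> U \<Longrightarrow> \<tau> \<in> G \<and> \<tau> s = \<sigma>\<^sub>0 s"
    using openin_galois_fixing[OF algebraic_i \<sigma>\<^sub>0, of s] by blast
  have pow: "E \<tau> (l b) ^ q = l (j (\<tau> s))" if "\<tau> \<in> G" for \<tau>
  proof -
    interpret t: field_hom "E \<tau>" by (rule E_extends(2)[OF that])
    show ?thesis using E_extends(4)[OF that, of s] by (simp flip: t.hom_power l.hom_power q(1))
  qed
  have "E \<sigma> (l b) = E \<sigma>\<^sub>0 (l b)" if "\<sigma> \<in> U" for \<sigma>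
    by (rule q(2)) (use pow U(3)[OF that] \<sigma>\<^sub>0 in simp)
  then show ?thesis using U by blast
qed

text \<open>The automorphisms are isometric and locally constant on a dense subset.\<close>

lemma E_continuous:
  assumes \<sigma>\<^sub>0: "\<sigma>\<^sub>0 \<in> G" and \<epsilon>: "\<epsilon> > 0"
  shows "\<exists>U. openin GT U \<and> \<sigma>\<^sub>0 \<in> U \<and> (\<forall>\<sigma>\<in>U. vc (E \<sigma> z - E \<sigma>\<^sub>0 z) < \<epsilon>)"
proof -
  obtain b where b: "vc (z - l b) < \<epsilon>" using dn.dense[OF \<epsilon>] by blast
  obtain U where U: "openin GT U" "\<sigma>\<^sub>0 \<in> U" "\<And>\<sigma>. \<sigma> \<in> U \<Longrightarrow> E \<sigma> (l b) = E \<sigma>\<^sub>0 (l b)"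
    using E_locally_constant[OF \<sigma>\<^sub>0, of b] by blast
  have near: "vc (E \<sigma> z - E \<sigma> (l b)) < \<epsilon>" if "\<sigma> \<in> G" for \<sigma>
  proof -
    interpret t: field_hom "E \<sigma>" by (rule E_extends(2)[OF that])
    show ?thesis using b E_extends(3)[OF that, of "z - l b"] by (simp add: t.hom_minus)
  qed
  have "vc (E \<sigma> z - E \<sigma>\<^sub>0 z) < \<epsilon>" if "\<sigma> \<in> U" for \<sigma>
  proof -
    have "\<sigma> \<in> G" using openin_subset[OF U(1)] that topspace_GT by blast
    have "E \<sigma> z - E \<sigma>\<^sub>0 z = (E \<sigma> z - E \<sigma> (l b)) - (E \<sigma>\<^sub>0 z - E \<sigma>\<^sub>0 (l b))" using U(3)[OF that] by simp
    then have "vc (E \<sigma> z - E \<sigma>\<^sub>0 z) \<le> max (vc (E \<sigma> z - E \<sigma> (l b))) (vc (E \<sigma>\<^sub>0 z - E \<sigma>\<^sub>0 (l b)))"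
      using c.v_diff by metis
    then show ?thesis using near[OF \<open>\<sigma> \<in> G\<close>] near[OF \<sigma>\<^sub>0] by linarith
  qed
  then show ?thesis using U by blast
qed

lemma E_poly_continuous:
  assumes \<sigma>\<^sub>0: "\<sigma>\<^sub>0 \<in> G" and r: "0 \<le> r" and \<epsilon>: "\<epsilon> > 0"
  shows "\<exists>U. openin GT U \<and> \<sigma>\<^sub>0 \<in> U \<and> (\<forall>\<sigma>\<in>U. c.poly_norm r (map_poly (E \<sigma>) P - map_poly (E \<sigma>\<^sub>0) P) < \<epsilon>)"
  using \<epsilon>
proof (induction P arbitrary: \<epsilon>)
  case 0
  then show ?case using \<sigma>\<^sub>0 openin_topspace[of GT] by (intro exI[of _ G]) (simp add: topspace_GT)
next
  case (pCons z P)
  have "\<epsilon> / (2 * (r + 1)) > 0" using r pCons.prems by simp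
  then obtain U where U: "openin GT U" "\<sigma>\<^sub>0 \<in> U"
    "\<And>\<sigma>. \<sigma> \<in> U \<Longrightarrow> c.poly_norm r (map_poly (E \<sigma>) P - map_poly (E \<sigma>\<^sub>0) P) < \<epsilon> / (2 * (r + 1))"
    using pCons.IH[of "\<epsilon> / (2 * (r + 1))"] by blast
  have "\<epsilon> / 2 > 0" using pCons.prems by simp
  then obtain V where V: "openin GT V" "\<sigma>\<^sub>0 \<in> V" "\<And>\<sigma>. \<sigma> \<in> V \<Longrightarrow> vc (E \<sigma> z - E \<sigma>\<^sub>0 z) < \<epsilon> / 2"
    using E_continuous[OF \<sigma>\<^sub>0, of "\<epsilon> / 2" z] by blast
  have "c.poly_norm r (map_poly (E \<sigma>) (pCons z P) - map_poly (E \<sigma>\<^sub>0) (pCons z P)) < \<epsilon>"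
    if s: "\<sigma> \<in> U \<inter> V" for \<sigma>
  proof -
    have "\<sigma> \<in> G" using openin_subset[OF U(1)] s topspace_GT by blast
    interpret t: field_hom "E \<sigma>" by (rule E_extends(2)[OF \<open>\<sigma> \<in> G\<close>])
    interpret t0: field_hom "E \<sigma>\<^sub>0" by (rule E_extends(2)[OF \<sigma>\<^sub>0])
    have "r * c.poly_norm r (map_poly (E \<sigma>) P - map_poly (E \<sigma>\<^sub>0) P) \<le> r * (\<epsilon> / (2 * (r + 1)))"
      using U(3)[of \<sigma>] s r by (intro mult_left_mono) auto
    also have "\<dots> \<le> \<epsilon> / 2" using r pCons.prems by (simp add: field_simps)
    finally show ?thesis using V(3)[of \<sigma>] s by (simp add: t.map_poly_pCons_hom t0.map_poly_pCons_hom)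
  qed
  moreover have "openin GT (U \<inter> V)" "\<sigma>\<^sub>0 \<in> U \<inter> V" using U(1,2) V(1,2) by (simp_all add: openin_Int)
  ultimately show ?case by (intro exI[of _ "U \<inter> V"] conjI ballI)
qed

text \<open>Near \<open>(\<sigma>\<^sub>0, x\<^sub>0)\<close>, the value at \<open>\<sigma>(P)\<close> is
  close to the value at \<open>\<sigma>\<^sub>0(P)\<close> uniformly in \<open>x\<close>, since
  points are Lipschitz on a ball, and the latter is continuous in \<open>x\<close>.\<close>

lemma continuous_action: "continuous_map (prod_topology GT LC) LC (\<lambda>(\<sigma>, x). act \<sigma> x)"
proof (rule c.continuous_map_into_berkovich_line)
  show "(case t of (\<sigma>, x) \<Rightarrow> act \<sigma> x) \<in> pts" if "t \<in> topspace (prod_topology GT LC)" for t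
    using that act_in_pts by (auto simp: topspace_GT topspace_berkovich_line)
  fix P
  show "continuous_map (prod_topology GT LC) euclideanreal (\<lambda>t. (case t of (\<sigma>, x) \<Rightarrow> act \<sigma> x) P)"
  proof (rule continuous_map_realI)
    fix t and \<epsilon> :: real assume t: "t \<in> topspace (prod_topology GT LC)" and \<epsilon>: "\<epsilon> > 0"
    then obtain \<sigma>\<^sub>0 x\<^sub>0 where t0: "t = (\<sigma>\<^sub>0, x\<^sub>0)" "\<sigma>\<^sub>0 \<in> G" "x\<^sub>0 \<in> pts"
      by (auto simp: topspace_GT topspace_berkovich_line)
    interpret x0: berkovich_point vc x\<^sub>0 by unfold_locales (fact t0(3))
    \<comment> \<open>A ball that is a neighbourhood of \<open>x\<^sub>0\<close>, so that the Lipschitz bound is uniform on it.\<close>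
    define r where "r = x\<^sub>0 [:0, 1:] + 1"
    have r: "0 \<le> r" unfolding r_def using x0.x_nonneg[of "[:0, 1:]"] by simp
    have "\<epsilon> / 2 > 0" using \<epsilon> by simp
    then obtain U where U: "openin GT U" "\<sigma>\<^sub>0 \<in> U"
      "\<And>\<sigma>. \<sigma> \<in> U \<Longrightarrow> c.poly_norm r (map_poly (E \<sigma>) P - map_poly (E \<sigma>\<^sub>0) P) < \<epsilon> / 2"
      using E_poly_continuous[OF t0(2) r, of "\<epsilon> / 2" P] by blast
    define P0 where "P0 = map_poly (E \<sigma>\<^sub>0) P"
    define V where "V = {x \<in> topspace LC. x [:0, 1:] \<in> {..<r}} \<inter> {x \<in> topspace LC. x P0 \<in> ball (x\<^sub>0 P0) (\<epsilon> / 2)}"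
    have V: "openin LC V" unfolding V_def
      by (intro openin_Int openin_continuous_map_preimage[OF c.continuous_map_eval]) simp_all
    have "x\<^sub>0 \<in> V" using t0(3) \<epsilon> by (simp add: V_def topspace_berkovich_line r_def)
    have "\<bar>act \<sigma> x P - act \<sigma>\<^sub>0 x\<^sub>0 P\<bar> < \<epsilon>" if "\<sigma> \<in> U" "x \<in> V" for \<sigma> x
    proof -
      have x: "x \<in> pts" "x [:0, 1:] \<le> r" "\<bar>x P0 - x\<^sub>0 P0\<bar> < \<epsilon> / 2"
        using that(2) by (auto simp: V_def topspace_berkovich_line dist_real_def abs_minus_commute)
      interpret x: berkovich_point vc x by unfold_locales (fact x(1))
      have "\<bar>x (map_poly (E \<sigma>) P) - x P0\<bar> \<le> c.poly_norm (x [:0, 1:]) (map_poly (E \<sigma>) P - P0)"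
        by (rule x.x_diff_poly_norm)
      also have "\<dots> \<le> c.poly_norm r (map_poly (E \<sigma>) P - P0)"
        by (rule c.poly_norm_mono[OF x.x_nonneg x(2)])
      also have "\<dots> < \<epsilon> / 2" unfolding P0_def by (rule U(3)[OF that(1)])
      finally have "\<bar>x (map_poly (E \<sigma>) P) - x\<^sub>0 P0\<bar> < \<epsilon>" using x(3) by linarith
      then show ?thesis by (simp add: galois_act_def P0_def)
    qed
    then show "\<exists>W. openin (prod_topology GT LC) W \<and> t \<in> W \<and>
        (\<forall>s\<in>W. \<bar>(case s of (\<sigma>, x) \<Rightarrow> act \<sigma> x) P - (case t of (\<sigma>, x) \<Rightarrow> act \<sigma> x) P\<bar> < \<epsilon>)"
      using U(1,2) V \<open>x\<^sub>0 \<in> V\<close> by (intro exI[of _ "U \<times> V"]) (auto simp: t0(1) openin_prod_Times_iff)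
  qed
qed

text \<open>The action fixes the variable, so the preimage of a ball is the product of the compact group
  with the same ball.\<close>

lemma proper_action: "proper_map (prod_topology GT LC) LC (\<lambda>(\<sigma>, x). act \<sigma> x)"
proof (rule c.proper_map_into_berkovich_line[OF continuous_action])
  fix r
  have "{t \<in> topspace (prod_topology GT LC). (case t of (\<sigma>, x) \<Rightarrow> act \<sigma> x) [:0, 1:] \<le> r}
      = topspace GT \<times> {x \<in> pts. x [:0, 1:] \<le> r}"
    using act_linear(2) by (auto simp: topspace_GT topspace_berkovich_line)
  moreover have "compactin (prod_topology GT LC) (topspace GT \<times> {x \<in> pts. x [:0, 1:] \<le> r})"
    using compact_galois_topology[OF algebraic_i] c.compactin_ball
    by (simp add: compactin_Times compact_space_def)
  ultimately show "compactin (prod_topology GT LC)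
      {t \<in> topspace (prod_topology GT LC). (case t of (\<sigma>, x) \<Rightarrow> act \<sigma> x) [:0, 1:] \<le> r}" by simp
qed

lemma continuous_act: 
  assumes "\<sigma> \<in> G"
  shows "continuous_map LC LC (act \<sigma>)"
proof -
  have "continuous_map LC (prod_topology GT LC) (\<lambda>x. (\<sigma>, x))"
    using assms by (intro continuous_map_pairedI) (simp_all add: topspace_GT)
  from continuous_map_compose[OF this continuous_action] show ?thesis by (simp add: comp_def)
qed

lemma continuous_orbit_map:
  assumes "x \<in> pts"
  shows "continuous_map GT LC (\<lambda>\<sigma>. act \<sigma> x)"
proof -
  have "continuous_map GT (prod_topology GT LC) (\<lambda>\<sigma>. (\<sigma>, x))"
    using assms by (intro continuous_map_pairedI) (simp_all add: topspace_berkovich_line)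
  from continuous_map_compose[OF this continuous_action] show ?thesis by (simp add: comp_def)
qed

text \<open>The automorphisms that match the two points at one given \<open>T - b\<close> form a closed
  set, and finitely many of these sets meet by \<open>conjugate_on_finite_set\<close>; so all of
  them meet in the compact group.\<close>

lemma same_projection_imp_conjugate:
  assumes x: "x \<in> pts" and y: "y \<in> pts" and eq: "proj x = proj y"
  shows "\<exists>\<sigma>\<in>G. act \<sigma> x = y"
proof -
  define C where "C b = {\<sigma> \<in> topspace GT. act \<sigma> x [:- l b, 1:] \<in> {y [:- l b, 1:]}}" for b
  have closed: "closedin GT (C b)" for b
  proof -
    have "continuous_map GT euclideanreal (\<lambda>\<sigma>. act \<sigma> x [:- l b, 1:])"
      using continuous_map_compose[OF continuous_orbit_map[OF x] c.continuous_map_eval] by (simp add: comp_def)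
    then show ?thesis unfolding C_def by (rule closedin_continuous_map_preimage) simp
  qed
  have "\<Inter>\<F> \<noteq> {}" if fin: "finite \<F>" "\<F> \<subseteq> range C" for \<F>
  proof -
    obtain F where F: "finite F" "\<F> = C ` F" using finite_subset_image[OF fin] by blast
    obtain \<sigma> where "\<sigma> \<in> G" "\<And>b. b \<in> F \<Longrightarrow> x [:- E \<sigma> (l b), 1:] = y [:- l b, 1:]"
      using conjugate_on_finite_set[OF x y eq F(1)] by blast
    then have "\<sigma> \<in> \<Inter>\<F>" unfolding F(2) C_def by (auto simp: topspace_GT act_linear(1))
    then show ?thesis by blast
  qed
  moreover have "\<forall>X\<in>range C. closedin GT X" using closed by blast
  ultimately have "\<Inter>(range C) \<noteq> {}"
    using compact_galois_topology[OF algebraic_i, unfolded compact_space_fip, THEN spec, of "range C"] by simp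
  then obtain \<sigma> where \<sigma>: "\<And>b. \<sigma> \<in> C b" by blast
  then have "\<sigma> \<in> G" "\<And>b. act \<sigma> x [:- l b, 1:] = y [:- l b, 1:]" unfolding C_def topspace_GT by blast+
  then have "act \<sigma> x = y"
    by (intro points_eqI_linear[OF dn.dense_valued_extension_axioms act_in_pts[OF _ x] y])
  then show ?thesis using \<open>\<sigma> \<in> G\<close> by blast
qed

lemma continuous_proj: "continuous_map LC LK proj"
proof (rule k.continuous_map_into_berkovich_line)
  show "proj x \<in> berkovich_points vk" if "x \<in> topspace LC" for x
    using that proj_in_points by (simp add: topspace_berkovich_line)
  show "continuous_map LC euclideanreal (\<lambda>x. proj x P)" for P
    unfolding berkovich_projection_def by (rule c.continuous_map_eval)
qed

lemma proper_proj: "proper_map LC LK proj"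
proof (rule k.proper_map_into_berkovich_line[OF continuous_proj])
  fix r
  have "proj x [:0, 1:] = x [:0, 1:]" for x
    unfolding proj_eq by (simp add: ext.e.map_poly_pCons_hom l.map_poly_pCons_hom)
  then show "compactin LC {x \<in> topspace LC. proj x [:0, 1:] \<le> r}"
    using c.compactin_ball[of r] by (simp add: topspace_berkovich_line)
qed

lemma quotient_proj: "quotient_map LC LK proj"
  by (rule continuous_closed_imp_quotient_map[OF continuous_proj proper_imp_closed_map[OF proper_proj]])
    (simp add: topspace_berkovich_line proj_surj)

text \<open>The saturation of an open set is the union of its translates, which are open, and the
  projection is a quotient map.\<close>

lemma open_proj: "open_map LC LK proj"
  unfolding open_map_def
proof (intro allI impI)
  fix U assume U: "openin LC U"
  have UX: "U \<subseteq> pts" using openin_subset[OF U] by (simp add: topspace_berkovich_line)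
  have eq: "{x \<in> topspace LC. proj x \<in> proj ` U} = (\<Union>\<sigma>\<in>G. {x \<in> topspace LC. act \<sigma> x \<in> U})"
  proof (intro equalityI subsetI)
    fix x assume "x \<in> {x \<in> topspace LC. proj x \<in> proj ` U}"
    then obtain u where "x \<in> pts" "u \<in> U" "proj x = proj u" by (auto simp: topspace_berkovich_line)
    then obtain \<sigma> where "\<sigma> \<in> G" "act \<sigma> x = u" using same_projection_imp_conjugate[of x u] UX by blast
    then show "x \<in> (\<Union>\<sigma>\<in>G. {x \<in> topspace LC. act \<sigma> x \<in> U})"
      using \<open>x \<in> pts\<close> \<open>u \<in> U\<close> by (auto simp: topspace_berkovich_line)
  next
    fix x assume "x \<in> (\<Union>\<sigma>\<in>G. {x \<in> topspace LC. act \<sigma> x \<in> U})"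
    then obtain \<sigma> where \<sigma>: "\<sigma> \<in> G" "x \<in> topspace LC" "act \<sigma> x \<in> U" by blast
    then have "proj x \<in> proj ` U" using proj_act[OF \<sigma>(1), of x] by (intro image_eqI[of _ _ "act \<sigma> x"]) simp
    then show "x \<in> {x \<in> topspace LC. proj x \<in> proj ` U}" using \<sigma>(2) by blast
  qed
  have "openin LC (\<Union>\<sigma>\<in>G. {x \<in> topspace LC. act \<sigma> x \<in> U})"
    by (intro openin_clauses(3) ballI) (auto intro!: openin_continuous_map_preimage[OF continuous_act] U)
  moreover have "proj ` U \<subseteq> topspace LK" using UX proj_in_points by (auto simp: topspace_berkovich_line)
  ultimately show "openin LK (proj ` U)" using quotient_proj unfolding quotient_map_def eq[symmetric] by blast
qed

lemma galois_orbit_eq: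
  assumes "x \<in> pts"
  shows "galois_orbit i vc (l \<circ> j) x = {y \<in> pts. proj y = proj x}"
proof (intro equalityI subsetI)
  fix y assume "y \<in> galois_orbit i vc (l \<circ> j) x"
  then obtain \<sigma> where \<sigma>: "\<sigma> \<in> G" "y = act \<sigma> x" unfolding galois_orbit_def by blast
  show "y \<in> {y \<in> pts. proj y = proj x}"
    unfolding \<sigma>(2) using act_in_pts[OF \<sigma>(1) assms] proj_act[OF \<sigma>(1)] by blast
next
  fix y assume "y \<in> {y \<in> pts. proj y = proj x}"
  then have "y \<in> pts" "proj x = proj y" by simp_all
  then obtain \<sigma> where "\<sigma> \<in> G" "act \<sigma> x = y" using same_projection_imp_conjugate[OF assms] by blast
  then show "y \<in> galois_orbit i vc (l \<circ> j) x" unfolding galois_orbit_def by blast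
qed

lemma quotient_homeomorphism:
  "\<exists>h. (\<forall>x \<in> topspace LC. h (galois_orbit i vc (l \<circ> j) x) = proj x) \<and>
    homeomorphic_map (quotient_topology LC (galois_orbit i vc (l \<circ> j))) LK h"
proof -
  let ?q = "galois_orbit i vc (l \<circ> j)"
  \<comment> \<open>The projection is constant on orbits, so any representative gives the same value.\<close>
  define h where "h S = proj (SOME x. x \<in> S)" for S
  have h: "h (?q x) = proj x" if "x \<in> pts" for x
  proof -
    have "x \<in> ?q x" using that by (simp add: galois_orbit_eq)
    then have "(SOME y. y \<in> ?q x) \<in> ?q x" by (rule someI[of "\<lambda>y. y \<in> ?q x"])
    then show ?thesis unfolding h_def using galois_orbit_eq[OF that] by simp
  qed
  have q: "quotient_map LC (quotient_topology LC ?q) ?q" by (rule quotient_map_quotient_topology)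
  have hq: "quotient_map LC LK (h \<circ> ?q)"
    by (rule quotient_map_eq[OF quotient_proj]) (use h in \<open>simp add: topspace_berkovich_line\<close>)
  have "continuous_map (quotient_topology LC ?q) LK h"
    by (rule continuous_compose_quotient_map[OF q quotient_imp_continuous_map[OF hq]])
  then have "quotient_map (quotient_topology LC ?q) LK h"
    by (rule quotient_map_from_composition[OF quotient_imp_continuous_map[OF q] _ hq])
  moreover have "inj_on h (topspace (quotient_topology LC ?q))"
    unfolding topspace_quotient_topology topspace_berkovich_line
  proof (rule inj_onI)
    fix S T assume "S \<in> ?q ` pts" "T \<in> ?q ` pts" and eq: "h S = h T"
    then obtain x y where xy: "x \<in> pts" "S = ?q x" "y \<in> pts" "T = ?q y" by blast
    then have "proj x = proj y" using eq h by simp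
    then show "S = T" using xy by (simp only: galois_orbit_eq)
  qed
  ultimately have "homeomorphic_map (quotient_topology LC ?q) LK h" unfolding homeomorphic_map_def by blast
  then show ?thesis using h by (auto simp: topspace_berkovich_line)
qed

end

theorem corollary5p6:
  fixes vk :: "'k::field \<Rightarrow> real"
    and va :: "'a::alg_closed_field \<Rightarrow> real"
    and vc :: "'c::field \<Rightarrow> real"
    and i :: "'k \<Rightarrow> 's::field"
    and j :: "'s \<Rightarrow> 'a"
    and l :: "'a \<Rightarrow> 'c"
  assumes "complete_nonarch_field vk"
    and "is_separable_closure i"
    and "field_hom j"
    and "is_algebraic_closure (j \<circ> i)"
    and "nonarch_abs_value va"
    and "\<forall>a. va (j (i a)) = vk a"
    and "is_completion va vc l"
  shows
    "continuous_map (prod_topology (galois_topology i) (berkovich_line vc)) (berkovich_line vc)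
        (\<lambda>(\<sigma>, x). galois_act vc (l \<circ> j) \<sigma> x)
     \<and> proper_map (prod_topology (galois_topology i) (berkovich_line vc)) (berkovich_line vc)
        (\<lambda>(\<sigma>, x). galois_act vc (l \<circ> j) \<sigma> x)
     \<and> (\<exists>h. (\<forall>x \<in> topspace (berkovich_line vc).
                h (galois_orbit i vc (l \<circ> j) x) = berkovich_projection (l \<circ> j \<circ> i) x)
            \<and> homeomorphic_map
                (quotient_topology (berkovich_line vc) (galois_orbit i vc (l \<circ> j)))
                (berkovich_line vk) h)
     \<and> continuous_map (berkovich_line vc) (berkovich_line vk) (berkovich_projection (l \<circ> j \<circ> i))
     \<and> proper_map (berkovich_line vc) (berkovich_line vk) (berkovich_projection (l \<circ> j \<circ> i))
     \<and> open_map (berkovich_line vc) (berkovich_line vk) (berkovich_projection (l \<circ> j \<circ> i))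
     \<and> berkovich_projection (l \<circ> j \<circ> i) ` topspace (berkovich_line vc)
         = topspace (berkovich_line vk)"
proof -
  interpret berkovich_galois vk va vc i j l by (rule berkovich_galois.intro) fact+
  show ?thesis
    using continuous_action proper_action quotient_homeomorphism continuous_proj proper_proj open_proj proj_surj
    by (simp add: topspace_berkovich_line)
qed

end
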